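(* A measure $\nu\in\mathcal{ID}(\boxtimes\boxtimes)$ has no non-trivial $\boxtimes\boxtimes$-idempotent factor if and only if $m_{1,0}(\nu)\neq0$ and $m_{0,1}(\nu)\neq0$; in this case, also $m_{1,1}(\nu)\neq0$.
   Context: $\mathscr{P}_{\mathbb{T}^2}$: Borel probability measures on $\mathbb{T}^2$; $m_{p,q}(\nu)=\int s_1^ps_2^q\,d\nu$. $\boxtimes\boxtimes$: bi-free multiplicative convolution ($\nu_1\boxtimes\boxtimes\nu_2$ is the distribution of $(u_1u_2,v_1v_2)$ with $(u_1,v_1),(u_2,v_2)$ bi-free bipartite pairs of commuting unitaries with distributions $\nu_1,\nu_2$). $\mathcal{ID}(\boxtimes\boxtimes)$: $\boxtimes\boxtimes$-infinitely divisible measures. $\mu$ is a $\boxtimes\boxtimes$-factor of $\nu$ if $\nu=\mu\boxtimes\boxtimes\mu''$ for some $\mu''$; $\mu$ is $\boxtimes\boxtimes$-idempotent if $\mu=\mu\boxtimes\boxtimes\mu$. The non-trivial $\boxtimes\boxtimes$-idempotent measures are those other than $\delta_{(1,1)}$, namely $\mathrm{m}\times\delta_1$, $\delta_1\times\mathrm{m}$, $\mathrm{m}\times\mathrm{m}$ and $P$, where $\mathrm{m}$ is normalized Haar measure on $\mathbb{T}$ and $P(B)=\mathrm{m}(\{s:(s,\bar s)\in B\})$. *)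

theory Defs
  imports "HOL-Analysis.Analysis" "HOL-Probability.Probability" "HOL-Library.Disjoint_Sets"
begin

definition torus2 :: "(complex \<times> complex) set" where
  "torus2 = sphere 0 1 \<times> sphere 0 1"

definition PT2 :: "(complex \<times> complex) measure \<Rightarrow> bool" where
  "PT2 \<nu> \<longleftrightarrow> prob_space \<nu> \<and> sets \<nu> = sets borel \<and> emeasure \<nu> torus2 = 1"

definition mom :: "(complex \<times> complex) measure \<Rightarrow> int \<Rightarrow> int \<Rightarrow> complex" where
  "mom \<nu> p q = (\<integral>s. (fst s powi p) * (snd s powi q) \<partial>\<nu>)"

text \<open>A letter is an operator u_i^e (left face, lft = True) or v_i^e (right face);
  the pair index is a bool: False = first pair, True = second pair.\<close>
datatype letter = Let (pidx: bool) (lft: bool) (expo: int)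

definition bpos :: "letter list \<Rightarrow> nat \<Rightarrow> int" where
  "bpos w k = (if lft (w ! k) then int k else 2 * int (length w) - int k)"

text \<open>Bi-non-crossing partitions BNC(chi) of the positions of a word: non-crossing after
  reordering left positions increasingly followed by right positions decreasingly.\<close>
definition BNC :: "letter list \<Rightarrow> nat set set set" where
  "BNC w = {\<pi>. partition_on {..<length w} \<pi> \<and>
     (\<forall>B1\<in>\<pi>. \<forall>B2\<in>\<pi>. B1 \<noteq> B2 \<longrightarrow>
        \<not> (\<exists>a\<in>B1. \<exists>c\<in>B1. \<exists>b\<in>B2. \<exists>d\<in>B2.
              bpos w a < bpos w b \<and> bpos w b < bpos w c \<and> bpos w c < bpos w d))}"

text \<open>Moment of a word in one commuting pair (u,v) with distribution nu.\<close>
definition pair_moment :: "(complex \<times> complex) measure \<Rightarrow> letter list \<Rightarrow> complex" where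
  "pair_moment \<nu> w = mom \<nu> (sum_list (map expo (filter lft w)))
                            (sum_list (map expo (filter (\<lambda>x. \<not> lft x) w)))"

text \<open>Bi-free cumulants of the family (u_1,v_1),(u_2,v_2) of bi-free pairs: determined by the
  bi-free moment-cumulant formula within each pair, and vanishing of mixed cumulants.\<close>
definition bf_cumulant ::
  "(complex \<times> complex) measure \<Rightarrow> (complex \<times> complex) measure \<Rightarrow> letter list \<Rightarrow> complex" where
  "bf_cumulant \<nu>1 \<nu>2 = (THE \<kappa>. \<kappa> [] = 0 \<and>
     (\<forall>w. (\<exists>a\<in>set w. \<exists>b\<in>set w. pidx a \<noteq> pidx b) \<longrightarrow> \<kappa> w = 0) \<and>
     (\<forall>w i. w \<noteq> [] \<longrightarrow> (\<forall>a\<in>set w. pidx a = i) \<longrightarrow>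
        pair_moment (if i then \<nu>2 else \<nu>1) w = (\<Sum>\<pi>\<in>BNC w. \<Prod>B\<in>\<pi>. \<kappa> (nths w B))))"

definition bf_moment ::
  "(complex \<times> complex) measure \<Rightarrow> (complex \<times> complex) measure \<Rightarrow> letter list \<Rightarrow> complex" where
  "bf_moment \<nu>1 \<nu>2 w = (\<Sum>\<pi>\<in>BNC w. \<Prod>B\<in>\<pi>. bf_cumulant \<nu>1 \<nu>2 (nths w B))"

text \<open>The word (u1 u2)^p (v1 v2)^q, negative powers meaning adjoints (u2* u1*)^|p| etc.\<close>
definition prod_pow :: "bool \<Rightarrow> int \<Rightarrow> letter list" where
  "prod_pow l p = (if p \<ge> 0
      then concat (replicate (nat p) [Let False l 1, Let True l 1])
      else concat (replicate (nat (- p)) [Let True l (-1), Let False l (-1)]))"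

definition UV_word :: "int \<Rightarrow> int \<Rightarrow> letter list" where
  "UV_word p q = prod_pow True p @ prod_pow False q"

definition bfmult :: "(complex \<times> complex) measure \<Rightarrow> (complex \<times> complex) measure
    \<Rightarrow> (complex \<times> complex) measure" (infixl \<open>\<boxtimes>\<boxtimes>\<close> 70) where
  "\<nu>1 \<boxtimes>\<boxtimes> \<nu>2 = (THE \<mu>. PT2 \<mu> \<and> (\<forall>p q. mom \<mu> p q = bf_moment \<nu>1 \<nu>2 (UV_word p q)))"

fun bfpow :: "(complex \<times> complex) measure \<Rightarrow> nat \<Rightarrow> (complex \<times> complex) measure" where
  "bfpow \<mu> 0 = return borel (1, 1)"
| "bfpow \<mu> (Suc n) = bfpow \<mu> n \<boxtimes>\<boxtimes> \<mu>"

definition ID_bb :: "(complex \<times> complex) measure set" where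
  "ID_bb = {\<nu>. PT2 \<nu> \<and> (\<forall>n::nat. n \<ge> 1 \<longrightarrow> (\<exists>\<mu>. PT2 \<mu> \<and> \<nu> = bfpow \<mu> n))}"

definition bb_factor :: "(complex \<times> complex) measure \<Rightarrow> (complex \<times> complex) measure \<Rightarrow> bool" where
  "bb_factor \<mu> \<nu> \<longleftrightarrow> PT2 \<mu> \<and> (\<exists>\<mu>''. PT2 \<mu>'' \<and> \<nu> = \<mu> \<boxtimes>\<boxtimes> \<mu>'')"

definition bb_idempotent :: "(complex \<times> complex) measure \<Rightarrow> bool" where
  "bb_idempotent \<mu> \<longleftrightarrow> PT2 \<mu> \<and> \<mu> = \<mu> \<boxtimes>\<boxtimes> \<mu>"

definition nontrivial_bb_idempotent :: "(complex \<times> complex) measure \<Rightarrow> bool" where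
  "nontrivial_bb_idempotent \<mu> \<longleftrightarrow> bb_idempotent \<mu> \<and> \<mu> \<noteq> return borel (1, 1)"

end

theory Submission
  imports Defs
begin

text \<open>
  Read in the order \<open>l1 < l2 < \<dots> < r2 < r1\<close> (left letters increasingly, then right letters
  decreasingly), a bi-non-crossing partition becomes non-crossing, so
  \<open>m\<^bsub>p,q\<^esub>(\<nu>1 \<boxtimes>\<boxtimes> \<nu>2) = \<tau>((u1 u2)\<^sup>p (v2 v1)\<^sup>q)\<close>, where \<open>\<tau>\<close> is the trace on the free
  product of the two commutative algebras. Since \<open>\<tau>\<close> is a positive trace, this is a positive
  definite function on \<open>\<int>\<^sup>2\<close>, hence by Herglotz's theorem the moment function of a measure.
  The moments \<open>m10\<close>, \<open>m01\<close> and \<open>m11\<close> are multiplicative, so an idempotent factor of a measure with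
  \<open>m10, m01 \<noteq> 0\<close> has \<open>m10 = m01 = 1\<close> and is trivial. The \<open>n\<close>-th roots of \<open>\<nu>\<close> have
  \<open>\<bar>m10\<bar>, \<bar>m01\<bar> \<rightarrow> 1\<close>, so \<open>u\<close> and \<open>v\<close> are almost constant under them and \<open>m11 \<noteq> 0\<close>.
  If \<open>m10 = m01 = 0\<close>, freeness gives \<open>m\<^bsub>p,q\<^esub>(\<nu>) = \<delta>\<^bsub>p,q\<^esub> m11\<^sup>p\<close>, so \<open>\<nu> = P \<boxtimes>\<boxtimes> \<nu>\<close>. If only \<open>m10 = 0\<close>, write
  \<open>\<nu> = \<rho> \<boxtimes>\<boxtimes> \<mu>\<close> with \<open>\<mu>\<close> the \<open>n\<close>-th root: replacing \<open>v2\<close> by its mean costs an error that vanishes as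
  \<open>n \<rightarrow> \<infinity>\<close> and leaves an expression that is zero for \<open>p \<noteq> 0\<close>; hence \<open>\<nu> = (m \<times> \<delta>1) \<boxtimes>\<boxtimes> \<nu>\<close>.
\<close>

section \<open>Non-crossing partitions\<close>

text \<open>\<open>bf_cumulant\<close> and the convolution are definite descriptions, so nothing is
  known about \<open>\<nu>1 \<boxtimes>\<boxtimes> \<nu>2\<close> until existence and uniqueness are
  settled: for the cumulants by recursion on the word length, for the measure by positivity
  (existence) and density of trigonometric polynomials (uniqueness). This is why a statement about
  three moments passes through Herglotz's theorem. The trace is a function \<open>M\<close> on lists
  of pairs (index, bounded function), given by the moment-cumulant formula. The laws of an algebra
  with a trace (merging neighbours, dropping units, linearity in a letter, cyclicity, freeness) are
  then identities for \<open>M\<close>. The hardest is merging, which is the formula for cumulants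
  with products as entries. The limits rest on one estimate: a unitary of mean c has L2 distance
  sqrt (1 - |c|^2) from c, and by Cauchy-Schwarz this bounds the effect of replacing it by c in any
  word whose other letters are unitary.\<close>

definition crosses :: "('i \<Rightarrow> 'p::linorder) \<Rightarrow> 'i set \<Rightarrow> 'i set \<Rightarrow> bool" where
  "crosses pos A B \<longleftrightarrow>
     (\<exists>a\<in>A. \<exists>c\<in>A. \<exists>b\<in>B. \<exists>d\<in>B. pos a < pos b \<and> pos b < pos c \<and> pos c < pos d)"

definition ncfam :: "('i \<Rightarrow> 'p::linorder) \<Rightarrow> 'i set set \<Rightarrow> bool" where
  "ncfam pos \<pi> \<longleftrightarrow> (\<forall>A\<in>\<pi>. \<forall>B\<in>\<pi>. A \<noteq> B \<longrightarrow> \<not> crosses pos A B)"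

text \<open>The reading order is a parameter: \<open>pos = bpos w\<close> gives \<open>BNC w\<close>
  and \<open>pos = id\<close> the ordinary non-crossing partitions; the two are compared by
  reindexing.\<close>

definition NC :: "('i \<Rightarrow> 'p::linorder) \<Rightarrow> 'i set \<Rightarrow> 'i set set set" where
  "NC pos S = {\<pi>. partition_on S \<pi> \<and> ncfam pos \<pi>}"

lemma BNC_eq_NC: "BNC w = NC (bpos w) {..<length w}"
  unfolding BNC_def NC_def ncfam_def crosses_def by simp

lemma finite_NC: "finite S \<Longrightarrow> finite (NC pos S)"
  by (rule finite_subset[OF _ finitely_many_partition_on[of S]]) (auto simp: NC_def)

lemma NC_subset: "\<pi> \<in> NC pos S \<Longrightarrow> A \<in> \<pi> \<Longrightarrow> A \<subseteq> S"
  by (auto simp: NC_def dest: partition_onD1)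

lemma ncfam_alt:
  "ncfam pos \<pi> \<longleftrightarrow> (\<forall>A\<in>\<pi>. \<forall>B\<in>\<pi>. A \<noteq> B \<longrightarrow> \<not> (crosses pos A B \<or> crosses pos B A))"
  unfolding ncfam_def by blast

lemma partition_on_image:
  assumes "partition_on S \<pi>" "inj_on f S"
  shows "partition_on (f ` S) ((`) f ` \<pi>)"
proof -
  have "{} \<notin> (`) f ` \<pi>" using partition_onD3[OF assms(1)] by auto
  then show ?thesis using partition_on_inj_image[OF assms] by simp
qed

lemma inj_image: "inj f \<Longrightarrow> inj ((`) f)"
  by (simp add: inj_on_def inj_image_eq_iff)

lemma partition_on_Suc_image: "partition_on (Suc ` S) ((`) Suc ` \<rho>) \<longleftrightarrow> partition_on S \<rho>"
proof
  assume p: "partition_on (Suc ` S) ((`) Suc ` \<rho>)"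
  have "\<Union>\<rho> = S" using partition_onD1[OF p] by (metis image_Union inj_Suc inj_image_eq_iff)
  moreover have "disjoint \<rho>"
    using partition_onD2[OF p] by (auto simp: disjoint_def inj_image_eq_iff)
  moreover have "{} \<notin> \<rho>" using partition_onD3[OF p] by auto
  ultimately show "partition_on S \<rho>" by (simp add: partition_on_def)
qed (simp add: partition_on_image)

lemma image_Suc_vimage: "0 \<notin> C \<Longrightarrow> Suc ` (Suc -` C) = C"
proof (intro equalityI subsetI)
  fix x assume "0 \<notin> C" "x \<in> C"
  then show "x \<in> Suc ` (Suc -` C)" by (cases x) auto
qed auto

lemma image_Suc_vimage_family:
  assumes "\<And>C. C \<in> P \<Longrightarrow> 0 \<notin> C"
  shows "(`) Suc ` (-`) Suc ` P = P"
proof -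
  have "(`) Suc ` (-`) Suc ` P = (\<lambda>C. Suc ` (Suc -` C)) ` P" by (simp add: image_image)
  also have "\<dots> = (\<lambda>C. C) ` P" using assms image_Suc_vimage by (intro image_cong) auto
  finally show ?thesis by simp
qed

lemma NC_image:
  assumes inj: "inj_on f S"
    and cr: "\<And>A B. A \<subseteq> S \<Longrightarrow> B \<subseteq> S \<Longrightarrow>
      crosses pos' (f ` A) (f ` B) \<or> crosses pos' (f ` B) (f ` A) \<Longrightarrow> crosses pos A B \<or> crosses pos B A"
    and \<pi>: "\<pi> \<in> NC pos S"
  shows "(`) f ` \<pi> \<in> NC pos' (f ` S)"
proof -
  have p: "partition_on S \<pi>" and n: "ncfam pos \<pi>" using \<pi> by (auto simp: NC_def)
  have sub: "A \<subseteq> S" if "A \<in> \<pi>" for A using partition_onD1[OF p] that by auto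
  have "partition_on (f ` S) ((`) f ` \<pi>)" using partition_on_image[OF p inj] .
  moreover have "ncfam pos' ((`) f ` \<pi>)"
    unfolding ncfam_alt
  proof (intro ballI impI)
    fix A B assume "A \<in> (`) f ` \<pi>" "B \<in> (`) f ` \<pi>" "A \<noteq> B"
    then obtain X Y where "A = f ` X" "B = f ` Y" "X \<in> \<pi>" "Y \<in> \<pi>" "X \<noteq> Y" by auto
    then show "\<not> (crosses pos' A B \<or> crosses pos' B A)"
      using n[unfolded ncfam_alt] cr[of X Y] sub[of X] sub[of Y] by blast
  qed
  ultimately show ?thesis by (simp add: NC_def)
qed

text \<open>Only the symmetric relation "one of the two crosses the other" has to be preserved. This
  freedom serves cyclic rotations, which turn the pattern A B A B into B A B A.\<close>

lemma sum_NC_reindex: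
  fixes k :: "'j set \<Rightarrow> complex"
  assumes inj: "inj_on f S"
    and cr: "\<And>A B. A \<subseteq> S \<Longrightarrow> B \<subseteq> S \<Longrightarrow>
      (crosses pos' (f ` A) (f ` B) \<or> crosses pos' (f ` B) (f ` A)) = (crosses pos A B \<or> crosses pos B A)"
  shows "(\<Sum>\<pi>\<in>NC pos' (f ` S). \<Prod>B\<in>\<pi>. k B) = (\<Sum>\<pi>\<in>NC pos S. \<Prod>B\<in>\<pi>. k (f ` B))"
proof -
  define g where "g = inv_into S f"
  have gf: "g ` f ` A = A" if "A \<subseteq> S" for A
    unfolding g_def using that inj by (auto simp: image_image inv_into_f_f subset_iff)
  have fg: "f ` g ` A = A" if "A \<subseteq> f ` S" for A
    unfolding g_def using that by (auto simp: image_image f_inv_into_f subset_iff)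
  have injg: "inj_on g (f ` S)" unfolding g_def by (simp add: inj_on_inv_into)
  have "bij_betw ((`) ((`) f)) (NC pos S) (NC pos' (f ` S))"
  proof (rule bij_betw_byWitness[where f' = "(`) ((`) g)"])
    show "\<forall>a\<in>NC pos S. (`) g ` (`) f ` a = a"
    proof
      fix a assume a: "a \<in> NC pos S"
      have "g ` f ` A = A" if "A \<in> a" for A
        using gf NC_subset[OF a that] by simp
      then show "(`) g ` (`) f ` a = a" by (simp add: image_image[of "(`) g"])
    qed
    show "\<forall>a\<in>NC pos' (f ` S). (`) f ` (`) g ` a = a"
    proof
      fix a assume a: "a \<in> NC pos' (f ` S)"
      have "f ` g ` A = A" if "A \<in> a" for A
        using fg NC_subset[OF a that] by simp
      then show "(`) f ` (`) g ` a = a" by (simp add: image_image[of "(`) f"])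
    qed
    show "(`) ((`) f) ` NC pos S \<subseteq> NC pos' (f ` S)"
      using NC_image[OF inj] cr by blast
    show "(`) ((`) g) ` NC pos' (f ` S) \<subseteq> NC pos S"
    proof
      fix x assume "x \<in> (`) ((`) g) ` NC pos' (f ` S)"
      then obtain \<pi> where pi: "\<pi> \<in> NC pos' (f ` S)" "x = (`) g ` \<pi>" by auto
      have "(`) g ` \<pi> \<in> NC pos (g ` f ` S)"
      proof (rule NC_image[OF injg _ pi(1)])
        fix A B assume AB: "A \<subseteq> f ` S" "B \<subseteq> f ` S"
          "crosses pos (g ` A) (g ` B) \<or> crosses pos (g ` B) (g ` A)"
        have "g ` A \<subseteq> S" "g ` B \<subseteq> S" using AB gf[of S] by blast+
        from cr[OF this] AB fg show "crosses pos' A B \<or> crosses pos' B A" by simp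
      qed
      then show "x \<in> NC pos S" using gf[of S] pi by simp
    qed
  qed
  then have "(\<Sum>\<pi>\<in>NC pos' (f ` S). \<Prod>B\<in>\<pi>. k B) = (\<Sum>\<pi>\<in>NC pos S. \<Prod>B\<in>(`) f ` \<pi>. k B)"
    by (rule sum.reindex_bij_betw[symmetric])
  also have "\<dots> = (\<Sum>\<pi>\<in>NC pos S. \<Prod>B\<in>\<pi>. k (f ` B))"
  proof (rule sum.cong[OF refl])
    fix \<pi> assume a: "\<pi> \<in> NC pos S"
    have "\<pi> \<subseteq> Pow S" using NC_subset[OF a] by auto
    then have "inj_on ((`) f) \<pi>" using inj_on_image_Pow[OF inj] inj_on_subset by blast
    then show "(\<Prod>B\<in>(`) f ` \<pi>. k B) = (\<Prod>B\<in>\<pi>. k (f ` B))"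
      by (simp add: prod.reindex)
  qed
  finally show ?thesis .
qed

lemma crosses_image:
  assumes "\<And>x y. x \<in> S \<Longrightarrow> y \<in> S \<Longrightarrow> pos' (f x) < pos' (f y) \<longleftrightarrow> pos x < pos y"
    and "A \<subseteq> S" "B \<subseteq> S"
  shows "crosses pos' (f ` A) (f ` B) \<longleftrightarrow> crosses pos A B"
proof -
  have [simp]: "pos' (f x) < pos' (f y) \<longleftrightarrow> pos x < pos y" if "x \<in> A \<union> B" "y \<in> A \<union> B" for x y
    using assms that by auto
  show ?thesis unfolding crosses_def by auto
qed

subsection \<open>Removing the block of the first letter\<close>

abbreviation peel :: "nat set \<Rightarrow> nat set set \<Rightarrow> nat set set" where
  "peel U \<rho> \<equiv> insert (insert 0 (Suc ` U)) ((`) Suc ` \<rho>)"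

text \<open>The trace \<open>U\<close> of the block of 0 on the other points and the partition of
  the complement are independent data. The shift by \<open>Suc\<close> matches the passage from a
  list to its tail.\<close>

lemma partition_on_peel_bij:
  "bij_betw (\<lambda>(U, \<rho>). peel U \<rho>)
     (SIGMA U:Pow S. {\<rho>. partition_on (S - U) \<rho>}) {\<pi>. partition_on (insert 0 (Suc ` S)) \<pi>}"
proof (rule bij_betwI')
  fix x y assume xy: "x \<in> (SIGMA U:Pow S. {\<rho>. partition_on (S - U) \<rho>})"
     "y \<in> (SIGMA U:Pow S. {\<rho>. partition_on (S - U) \<rho>})"
  obtain U \<rho> U' \<rho>' where [simp]: "x = (U, \<rho>)" "y = (U', \<rho>')" by (metis surj_pair)
  let ?X = "insert 0 (Suc ` U)" and ?Y = "insert 0 (Suc ` U')"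
  have no: "0 \<notin> B" if "B \<in> (`) Suc ` r" for B r using that by auto
  have "?X = ?Y \<and> (`) Suc ` \<rho> = (`) Suc ` \<rho>'"
    if e: "insert ?X ((`) Suc ` \<rho>) = insert ?Y ((`) Suc ` \<rho>')"
  proof -
    have "?X \<in> insert ?Y ((`) Suc ` \<rho>')" using e by (metis insertI1)
    moreover have n: "?X \<notin> (`) Suc ` r" "?Y \<notin> (`) Suc ` r" for r
      using no[of ?X r] no[of ?Y r] by (meson insertI1)+
    ultimately have "?X = ?Y" by (metis insertE)
    then show ?thesis using e n insert_ident by metis
  qed
  moreover have "U = U'" if "?X = ?Y"
    using that by (metis image_iff insert_iff inj_Suc inj_image_eq_iff insert_ident nat.distinct(1))
  moreover have "\<rho> = \<rho>'" if "(`) Suc ` \<rho> = (`) Suc ` \<rho>'"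
    using that by (metis inj_Suc inj_image inj_image_eq_iff)
  ultimately show "((case x of (U, \<rho>) \<Rightarrow> peel U \<rho>) =
       (case y of (U, \<rho>) \<Rightarrow> peel U \<rho>)) = (x = y)"
    by auto
next
  fix x assume x: "x \<in> (SIGMA U:Pow S. {\<rho>. partition_on (S - U) \<rho>})"
  obtain U \<rho> where [simp]: "x = (U, \<rho>)" by (metis surj_pair)
  have U: "U \<subseteq> S" and p: "partition_on (S - U) \<rho>" using x by auto
  have p2: "partition_on (Suc ` (S - U)) ((`) Suc ` \<rho>)"
    by (simp add: partition_on_Suc_image p)
  have "\<Union>((`) Suc ` \<rho>) = Suc ` (S - U)" using partition_onD1[OF p2] by simp
  then have d: "disjnt (insert 0 (Suc ` U)) (\<Union>((`) Suc ` \<rho>))" by (auto simp: disjnt_def)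
  have e: "insert 0 (Suc ` S) - insert 0 (Suc ` U) = Suc ` (S - U)" by auto
  show "(case x of (U, \<rho>) \<Rightarrow> peel U \<rho>) \<in> {\<pi>. partition_on (insert 0 (Suc ` S)) \<pi>}"
    using partition_on_insert[OF d, of "insert 0 (Suc ` S)"] p2 e U by auto
next
  fix \<pi> assume "\<pi> \<in> {\<pi>. partition_on (insert 0 (Suc ` S)) \<pi>}"
  then have p: "partition_on (insert 0 (Suc ` S)) \<pi>" by simp
  obtain B where B: "B \<in> \<pi>" "0 \<in> B" using partition_onD1[OF p] by auto
  define U where "U = Suc -` B"
  define \<rho> where "\<rho> = (-`) Suc ` (\<pi> - {B})"
  have Bs: "B \<subseteq> insert 0 (Suc ` S)" using partition_onD1[OF p] B by auto
  have "Suc ` U = B - {0}" 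
  proof -
    have "Suc -` (B - {0}) = U" unfolding U_def by auto
    then show ?thesis using image_Suc_vimage[of "B - {0}"] by simp
  qed
  then have BU: "B = insert 0 (Suc ` U)" using B by auto
  have Us: "U \<subseteq> S" using Bs unfolding U_def by auto
  have n0: "0 \<notin> C" if "C \<in> \<pi> - {B}" for C
    using partition_onD2[OF p] that B by (auto simp: disjoint_def)
  have r: "(`) Suc ` \<rho> = \<pi> - {B}" unfolding \<rho>_def by (rule image_Suc_vimage_family[OF n0])
  have ins: "insert B (\<pi> - {B}) = \<pi>" using B by auto
  have d: "disjnt B (\<Union>(\<pi> - {B}))" using partition_onD2[OF p] B by (auto simp: disjoint_def disjnt_def)
  have "partition_on (insert 0 (Suc ` S) - B) (\<pi> - {B})"
    using partition_on_insert[OF d, of "insert 0 (Suc ` S)"] p ins by simp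
  moreover have "insert 0 (Suc ` S) - B = Suc ` (S - U)" unfolding BU by auto
  ultimately have p3: "partition_on (Suc ` (S - U)) (\<pi> - {B})" by simp
  have "partition_on (S - U) \<rho>" using p3 unfolding r[symmetric] by (simp only: partition_on_Suc_image)
  then show "\<exists>x\<in>(SIGMA U:Pow S. {\<rho>. partition_on (S - U) \<rho>}).
      \<pi> = (case x of (U, \<rho>) \<Rightarrow> peel U \<rho>)"
    using Us r ins BU by (intro bexI[of _ "(U, \<rho>)"]) auto
qed

lemma sum_partitions_peel:
  assumes "finite S"
  shows "(\<Sum>\<pi> | partition_on (insert 0 (Suc ` S)) \<pi>. F \<pi>) =
    (\<Sum>U\<in>Pow S. \<Sum>\<rho> | partition_on (S - U) \<rho>. F (peel U \<rho>))"
proof -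
  have "(\<Sum>\<pi> | partition_on (insert 0 (Suc ` S)) \<pi>. F \<pi>) =
    (\<Sum>(U, \<rho>)\<in>(SIGMA U:Pow S. {\<rho>. partition_on (S - U) \<rho>}). F (peel U \<rho>))"
    by (subst sum.reindex_bij_betw[OF partition_on_peel_bij, symmetric]) (simp add: case_prod_unfold)
  also have "\<dots> = (\<Sum>U\<in>Pow S. \<Sum>\<rho> | partition_on (S - U) \<rho>. F (peel U \<rho>))"
    using assms by (subst sum.Sigma) (auto intro: finitely_many_partition_on)
  finally show ?thesis .
qed

lemma sum_partitions_Suc:
  "(\<Sum>\<pi> | partition_on (Suc ` S) \<pi>. F \<pi>) = (\<Sum>\<rho> | partition_on S \<rho>. F ((`) Suc ` \<rho>))"
proof -
  have "bij_betw ((`) ((`) Suc)) {\<rho>. partition_on S \<rho>} {\<pi>. partition_on (Suc ` S) \<pi>}"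
  proof (rule bij_betw_imageI)
    show "inj_on ((`) ((`) Suc)) {\<rho>. partition_on S \<rho>}"
      by (metis inj_Suc inj_image inj_on_subset subset_UNIV)
    show "(`) ((`) Suc) ` {\<rho>. partition_on S \<rho>} = {\<pi>. partition_on (Suc ` S) \<pi>}"
    proof (intro equalityI subsetI)
      fix \<pi> assume "\<pi> \<in> {\<pi>. partition_on (Suc ` S) \<pi>}"
      then have p: "partition_on (Suc ` S) \<pi>" by simp
      have r: "(`) Suc ` (-`) Suc ` \<pi> = \<pi>"
        by (rule image_Suc_vimage_family) (use partition_onD1[OF p] in auto)
      then have "partition_on S ((-`) Suc ` \<pi>)" using p by (metis partition_on_Suc_image)
      then show "\<pi> \<in> (`) ((`) Suc) ` {\<rho>. partition_on S \<rho>}" using r by (metis image_eqI mem_Collect_eq)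
    qed (auto simp: partition_on_Suc_image)
  qed
  from sum.reindex_bij_betw[OF this, of F] show ?thesis by simp
qed

definition splits :: "nat set \<Rightarrow> nat set \<Rightarrow> bool" where
  "splits U B \<longleftrightarrow> (\<exists>c\<in>U. \<exists>b\<in>B. \<exists>d\<in>B. b < c \<and> c < d)"

lemma crosses_Suc [simp]: "crosses id (Suc ` A) (Suc ` B) \<longleftrightarrow> crosses id A B"
  by (rule crosses_image[of UNIV]) auto

lemma ncfam_insert:
  assumes "A \<notin> P"
  shows "ncfam pos (insert A P) \<longleftrightarrow> ncfam pos P \<and> (\<forall>B\<in>P. \<not> (crosses pos A B \<or> crosses pos B A))"
  unfolding ncfam_alt using assms by auto

lemma ncfam_Suc [simp]: "ncfam id ((`) Suc ` \<rho>) \<longleftrightarrow> ncfam id \<rho>"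
  unfolding ncfam_def by (auto simp: inj_image_eq_iff)

text \<open>A point of \<open>U\<close> between two points of \<open>B\<close> gives a crossing with
  0 as its outer end; conversely each of the two patterns contains such a point.\<close>

lemma crosses_zero:
  "(crosses id (insert 0 (Suc ` U)) (Suc ` B) \<or> crosses id (Suc ` B) (insert 0 (Suc ` U))) \<longleftrightarrow> splits U B"
proof
  assume "crosses id (insert 0 (Suc ` U)) (Suc ` B) \<or> crosses id (Suc ` B) (insert 0 (Suc ` U))"
  then show "splits U B"
  proof
    assume "crosses id (insert 0 (Suc ` U)) (Suc ` B)"
    then obtain a b c d where "b \<in> Suc ` B" "d \<in> Suc ` B" "c \<in> insert 0 (Suc ` U)" "b < c" "c < d"
      unfolding crosses_def id_def by blast
    then show ?thesis unfolding splits_def by auto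
  next
    assume "crosses id (Suc ` B) (insert 0 (Suc ` U))"
    then obtain a b c where "a \<in> Suc ` B" "c \<in> Suc ` B" "b \<in> insert 0 (Suc ` U)" "a < b" "b < c"
      unfolding crosses_def id_def by blast
    then show ?thesis unfolding splits_def by auto
  qed
next
  assume "splits U B"
  then obtain b c d where "c \<in> U" "b \<in> B" "d \<in> B" "b < c" "c < d" unfolding splits_def by blast
  then have "crosses id (insert 0 (Suc ` U)) (Suc ` B)"
    unfolding crosses_def id_def
    by (intro bexI[of _ 0] bexI[of _ "Suc c"] bexI[of _ "Suc b"] bexI[of _ "Suc d"]) auto
  then show "crosses id (insert 0 (Suc ` U)) (Suc ` B) \<or> crosses id (Suc ` B) (insert 0 (Suc ` U))" ..
qed

lemma ncfam_zero:
  "ncfam id (peel U \<rho>) \<longleftrightarrow> ncfam id \<rho> \<and> (\<forall>B\<in>\<rho>. \<not> splits U B)"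
proof -
  have "insert 0 (Suc ` U) \<notin> (`) Suc ` \<rho>" by auto
  then show ?thesis by (auto simp: ncfam_insert crosses_zero[symmetric])
qed

text \<open>The non-crossing partitions of \<open>S - U\<close> that stay non-crossing next to a block consisting of \<open>U\<close> and
  a point to the left of \<open>S\<close>.\<close>

definition Gset :: "nat set \<Rightarrow> nat set \<Rightarrow> nat set set set" where
  "Gset S U = {\<rho>. partition_on (S - U) \<rho> \<and> ncfam id \<rho> \<and> (\<forall>B\<in>\<rho>. \<not> splits U B)}"

text \<open>The empty set and \<open>U\<close> itself are included; they become the cuts at the two
  ends of a list.\<close>

definition Init :: "nat set \<Rightarrow> nat set set" where
  "Init U = {T. T \<subseteq> U \<and> (\<forall>t\<in>T. \<forall>s\<in>U - T. t < s)}"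

lemma sum_NC_of_bool:
  assumes "finite S"
  shows "(\<Sum>\<pi>\<in>NC pos S. F \<pi>) = (\<Sum>\<pi> | partition_on S \<pi>. of_bool (ncfam pos \<pi>) * (F \<pi> :: complex))"
proof -
  have "(\<Sum>\<pi>\<in>NC pos S. F \<pi>) = (\<Sum>\<pi>\<in>{\<pi>\<in>{\<pi>. partition_on S \<pi>}. ncfam pos \<pi>}. F \<pi>)"
    by (simp add: NC_def)
  also have "\<dots> = (\<Sum>\<pi>\<in>{\<pi>. partition_on S \<pi>}. if ncfam pos \<pi> then F \<pi> else 0)"
    by (rule sum.inter_filter) (rule finitely_many_partition_on[OF assms])
  also have "\<dots> = (\<Sum>\<pi> | partition_on S \<pi>. of_bool (ncfam pos \<pi>) * F \<pi>)"
    by (rule sum.cong) auto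
  finally show ?thesis .
qed

lemma sum_Gset_of_bool:
  assumes "finite S"
  shows "(\<Sum>\<rho>\<in>Gset S U. F \<rho>) =
    (\<Sum>\<rho> | partition_on (S - U) \<rho>. of_bool (ncfam id \<rho> \<and> (\<forall>B\<in>\<rho>. \<not> splits U B)) * (F \<rho> :: complex))"
proof -
  have "(\<Sum>\<rho>\<in>Gset S U. F \<rho>) = (\<Sum>\<rho>\<in>{\<rho>\<in>{\<rho>. partition_on (S-U) \<rho>}. ncfam id \<rho> \<and> (\<forall>B\<in>\<rho>. \<not> splits U B)}. F \<rho>)"
    by (simp add: Gset_def)
  also have "\<dots> = (\<Sum>\<rho>\<in>{\<rho>. partition_on (S-U) \<rho>}. if ncfam id \<rho> \<and> (\<forall>B\<in>\<rho>. \<not> splits U B) then F \<rho> else 0)"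
    by (rule sum.inter_filter) (rule finitely_many_partition_on, use assms in auto)
  also have "\<dots> = (\<Sum>\<rho> | partition_on (S-U) \<rho>. of_bool (ncfam id \<rho> \<and> (\<forall>B\<in>\<rho>. \<not> splits U B)) * F \<rho>)"
    by (rule sum.cong) auto
  finally show ?thesis .
qed

lemma prod_insert_Suc:
  fixes k :: "nat set \<Rightarrow> complex"
  assumes "finite \<rho>" "0 \<in> X"
  shows "(\<Prod>B\<in>insert X ((`) Suc ` \<rho>). k B) = k X * (\<Prod>B\<in>\<rho>. k (Suc ` B))"
proof -
  have "X \<notin> (`) Suc ` \<rho>" using assms by auto
  moreover have "inj_on ((`) Suc) \<rho>" by (simp add: inj_on_def inj_image_eq_iff)
  ultimately show ?thesis using assms by (simp add: prod.reindex)
qed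

lemma sum_NC_peel:
  fixes k :: "nat set \<Rightarrow> complex"
  assumes "finite S"
  shows "(\<Sum>\<pi>\<in>NC id (insert 0 (Suc ` S)). \<Prod>B\<in>\<pi>. k B) =
    (\<Sum>U\<in>Pow S. k (insert 0 (Suc ` U)) * (\<Sum>\<rho>\<in>Gset S U. \<Prod>B\<in>\<rho>. k (Suc ` B)))"
proof -
  have "(\<Sum>\<pi>\<in>NC id (insert 0 (Suc ` S)). \<Prod>B\<in>\<pi>. k B) =
     (\<Sum>U\<in>Pow S. \<Sum>\<rho> | partition_on (S - U) \<rho>.
        of_bool (ncfam id (peel U \<rho>)) * (\<Prod>B\<in>peel U \<rho>. k B))"
    using assms by (subst sum_NC_of_bool) (simp, rule sum_partitions_peel, simp)
  also have "\<dots> = (\<Sum>U\<in>Pow S. \<Sum>\<rho> | partition_on (S - U) \<rho>.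
        k (insert 0 (Suc ` U)) * (of_bool (ncfam id \<rho> \<and> (\<forall>B\<in>\<rho>. \<not> splits U B)) * (\<Prod>B\<in>\<rho>. k (Suc ` B))))"
  proof (intro sum.cong refl)
    fix U \<rho> assume "\<rho> \<in> {\<rho>. partition_on (S - U) \<rho>}"
    then have "finite \<rho>" using assms finite_elements[of "S - U" \<rho>] by simp
    then show "of_bool (ncfam id (peel U \<rho>)) * (\<Prod>B\<in>peel U \<rho>. k B)
      = k (insert 0 (Suc ` U)) * (of_bool (ncfam id \<rho> \<and> (\<forall>B\<in>\<rho>. \<not> splits U B)) * (\<Prod>B\<in>\<rho>. k (Suc ` B)))"
      by (subst prod_insert_Suc, simp, simp, subst ncfam_zero) (simp add: algebra_simps)
  qed
  also have "\<dots> = (\<Sum>U\<in>Pow S. k (insert 0 (Suc ` U)) * (\<Sum>\<rho>\<in>Gset S U. \<Prod>B\<in>\<rho>. k (Suc ` B)))"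
    by (simp add: sum_Gset_of_bool[OF assms] sum_distrib_left)
  finally show ?thesis .
qed

lemma sum_Pow_insert_Suc:
  assumes "finite S"
  shows "(\<Sum>V\<in>Pow (insert 0 (Suc ` S)). g V) = (\<Sum>U\<in>Pow S. g (insert 0 (Suc ` U)) + (g (Suc ` U) :: complex))"
proof -
  have inj: "inj_on ((`) Suc) A" for A by (metis inj_Suc inj_image inj_on_subset subset_UNIV)
  have inj2: "inj_on (insert 0) ((`) Suc ` Pow S)" by (rule inj_onI) (auto simp: insert_ident)
  have "Pow (insert 0 (Suc ` S)) = (`) Suc ` Pow S \<union> insert 0 ` (`) Suc ` Pow S"
    by (simp add: Pow_insert image_Pow_surj[OF refl])
  moreover have "(`) Suc ` Pow S \<inter> insert 0 ` (`) Suc ` Pow S = {}" by auto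
  ultimately have "(\<Sum>V\<in>Pow (insert 0 (Suc ` S)). g V) =
      (\<Sum>V\<in>(`) Suc ` Pow S. g V) + (\<Sum>V\<in>insert 0 ` (`) Suc ` Pow S. g V)"
    using assms by (simp add: sum.union_disjoint)
  also have "\<dots> = (\<Sum>U\<in>Pow S. g (Suc ` U)) + (\<Sum>U\<in>Pow S. g (insert 0 (Suc ` U)))"
    by (simp add: sum.reindex[OF inj] sum.reindex[OF inj2] o_def)
  finally show ?thesis by (simp add: sum.distrib add.commute)
qed

lemma splits_simps:
  "splits (insert 0 (Suc ` U)) (Suc ` B) \<longleftrightarrow> splits U B"
  "splits (Suc ` U) (Suc ` B) \<longleftrightarrow> splits U B"
  "splits (Suc ` W) (insert 0 (Suc ` T)) \<longleftrightarrow> (\<exists>c\<in>W. \<exists>d\<in>T. c < d)"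
  "splits (W \<union> T) B \<longleftrightarrow> splits W B \<or> splits T B"
  unfolding splits_def by auto

lemma sum_Pow_Pow_diff:
  assumes "finite S"
  shows "(\<Sum>W\<in>Pow S. \<Sum>T\<in>Pow (S - W). g W T) = (\<Sum>U\<in>Pow S. \<Sum>T\<in>Pow U. (g (U - T) T :: complex))"
proof -
  have f: "finite U" if "U \<in> Pow S" for U using that assms finite_subset by auto
  have "(\<Sum>W\<in>Pow S. \<Sum>T\<in>Pow (S - W). g W T) = (\<Sum>(W,T)\<in>(SIGMA W:Pow S. Pow (S - W)). g W T)"
    using assms by (subst sum.Sigma) auto
  also have "\<dots> = (\<Sum>(U,T)\<in>(SIGMA U:Pow S. Pow U). g (U - T) T)"
    by (rule sum.reindex_bij_witness[of _ "\<lambda>(U,T). (U - T, T)" "\<lambda>(W,T). (W \<union> T, T)"]) (auto simp: Un_Diff intro!: arg_cong2[where f = g])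
  also have "\<dots> = (\<Sum>U\<in>Pow S. \<Sum>T\<in>Pow U. g (U - T) T)"
    using assms f by (subst sum.Sigma) auto
  finally show ?thesis .
qed

lemma sum_Gset_insert:
  assumes "finite S"
  shows "(\<Sum>\<sigma>\<in>Gset (insert 0 (Suc ` S)) (insert 0 (Suc ` U)). \<Prod>B\<in>\<sigma>. k B) =
    (\<Sum>\<rho>\<in>Gset S U. \<Prod>B\<in>\<rho>. (k (Suc ` B) :: complex))"
proof -
  have e: "insert 0 (Suc ` S) - insert 0 (Suc ` U) = Suc ` (S - U)" by auto
  have inj: "inj_on ((`) Suc) A" for A by (metis inj_Suc inj_image inj_on_subset subset_UNIV)
  show ?thesis
    unfolding sum_Gset_of_bool[OF assms]
    by (subst sum_Gset_of_bool) (simp_all add: assms e sum_partitions_Suc splits_simps prod.reindex[OF inj])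
qed

text \<open>Here the block of the first letter misses the second letter, whose own block continues
  with \<open>T\<close>. The two blocks do not cross exactly when \<open>T\<close> lies to the left
  of \<open>W\<close>, and a further block is compatible with both when no point of
  \<open>W \<union> T\<close> splits it.\<close>

lemma sum_Gset_Suc:
  assumes "finite S"
  shows "(\<Sum>\<sigma>\<in>Gset (insert 0 (Suc ` S)) (Suc ` W). \<Prod>B\<in>\<sigma>. k B) =
    (\<Sum>T\<in>Pow (S - W). of_bool (T \<in> Init (W \<union> T)) * k (insert 0 (Suc ` T)) *
        (\<Sum>\<rho>\<in>Gset S (W \<union> T). \<Prod>B\<in>\<rho>. (k (Suc ` B) :: complex)))"
proof -
  have e: "insert 0 (Suc ` S) - Suc ` W = insert 0 (Suc ` (S - W))" by auto
  have e2: "S - W - T = S - (W \<union> T)" for T by auto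
  have "(\<Sum>\<sigma>\<in>Gset (insert 0 (Suc ` S)) (Suc ` W). \<Prod>B\<in>\<sigma>. k B) =
    (\<Sum>T\<in>Pow (S - W). \<Sum>\<rho> | partition_on (S - (W \<union> T)) \<rho>.
       of_bool (ncfam id (peel T \<rho>) \<and>
           (\<forall>B\<in>peel T \<rho>. \<not> splits (Suc ` W) B)) *
       (\<Prod>B\<in>peel T \<rho>. k B))"
    by (subst sum_Gset_of_bool) (use assms in \<open>simp_all add: e sum_partitions_peel e2\<close>)
  also have "\<dots> = (\<Sum>T\<in>Pow (S - W). \<Sum>\<rho> | partition_on (S - (W \<union> T)) \<rho>.
       of_bool (T \<in> Init (W \<union> T)) * k (insert 0 (Suc ` T)) *
        (of_bool (ncfam id \<rho> \<and> (\<forall>B\<in>\<rho>. \<not> splits (W \<union> T) B)) * (\<Prod>B\<in>\<rho>. k (Suc ` B))))"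
  proof (intro sum.cong refl)
    fix T assume T: "T \<in> Pow (S - W)"
    fix \<rho> assume "\<rho> \<in> {\<rho>. partition_on (S - (W \<union> T)) \<rho>}"
    then have fin: "finite \<rho>" using assms finite_elements[of "S - (W \<union> T)" \<rho>] by simp
    have "W \<union> T - T = W" "W \<inter> T = {}" using T by auto
    then have "T \<in> Init (W \<union> T) \<longleftrightarrow> (\<forall>t\<in>T. \<forall>s\<in>W. t < s)" unfolding Init_def by auto
    also have "\<dots> \<longleftrightarrow> \<not> (\<exists>c\<in>W. \<exists>d\<in>T. c < d)"
      using \<open>W \<inter> T = {}\<close> by (metis IntI empty_iff linorder_neqE_nat order_less_asym)
    finally have E: "(ncfam id (peel T \<rho>) \<and>
           (\<forall>B\<in>peel T \<rho>. \<not> splits (Suc ` W) B)) \<longleftrightarrow>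
        T \<in> Init (W \<union> T) \<and> ncfam id \<rho> \<and> (\<forall>B\<in>\<rho>. \<not> splits (W \<union> T) B)"
      by (auto simp: ncfam_zero splits_simps)
    show "of_bool (ncfam id (peel T \<rho>) \<and>
           (\<forall>B\<in>peel T \<rho>. \<not> splits (Suc ` W) B)) *
       (\<Prod>B\<in>peel T \<rho>. k B) =
       of_bool (T \<in> Init (W \<union> T)) * k (insert 0 (Suc ` T)) *
        (of_bool (ncfam id \<rho> \<and> (\<forall>B\<in>\<rho>. \<not> splits (W \<union> T) B)) * (\<Prod>B\<in>\<rho>. k (Suc ` B)))"
      unfolding E using fin by (simp only: of_bool_conj prod_insert_Suc insertI1 mult_ac)
  qed
  also have "\<dots> = (\<Sum>T\<in>Pow (S - W). of_bool (T \<in> Init (W \<union> T)) * k (insert 0 (Suc ` T)) *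
        (\<Sum>\<rho>\<in>Gset S (W \<union> T). \<Prod>B\<in>\<rho>. k (Suc ` B)))"
    by (simp add: sum_Gset_of_bool[OF assms] sum_distrib_left)
  finally show ?thesis .
qed

text \<open>Whether the first two letters share a block or have blocks with traces
  \<open>U - T\<close> and \<open>T\<close>, the restriction on the remaining blocks depends on
  \<open>U\<close> alone. This common factor permits the comparison with a word whose first two
  letters are multiplied.\<close>

lemma sum_NC_peel2:
  fixes k :: "nat set \<Rightarrow> complex"
  assumes fin: "finite S"
  shows "(\<Sum>\<pi>\<in>NC id (insert 0 (Suc ` insert 0 (Suc ` S))). \<Prod>B\<in>\<pi>. k B) =
    (\<Sum>U\<in>Pow S. (k (insert 0 (Suc ` insert 0 (Suc ` U))) +
        (\<Sum>T\<in>Init U. k (Suc ` insert 0 (Suc ` T)) * k (insert 0 (Suc ` Suc ` (U - T))))) *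
      (\<Sum>\<rho>\<in>Gset S U. \<Prod>B\<in>\<rho>. k (Suc ` Suc ` B)))"
proof -
  let ?G = "\<lambda>U. \<Sum>\<rho>\<in>Gset S U. \<Prod>B\<in>\<rho>. k (Suc ` Suc ` B)"
  have fU: "finite U" if "U \<in> Pow S" for U using that fin finite_subset by auto
  have "(\<Sum>\<pi>\<in>NC id (insert 0 (Suc ` insert 0 (Suc ` S))). \<Prod>B\<in>\<pi>. k B) =
    (\<Sum>U\<in>Pow S. k (insert 0 (Suc ` insert 0 (Suc ` U))) * ?G U +
       k (insert 0 (Suc ` Suc ` U)) * (\<Sum>T\<in>Pow (S - U). of_bool (T \<in> Init (U \<union> T)) * k (Suc ` insert 0 (Suc ` T)) * ?G (U \<union> T)))"
    by (subst sum_NC_peel) (simp_all add: fin sum_Pow_insert_Suc sum_Gset_insert sum_Gset_Suc)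
  also have "\<dots> = (\<Sum>U\<in>Pow S. k (insert 0 (Suc ` insert 0 (Suc ` U))) * ?G U) +
      (\<Sum>W\<in>Pow S. \<Sum>T\<in>Pow (S - W). k (insert 0 (Suc ` Suc ` W)) *
          (of_bool (T \<in> Init (W \<union> T)) * k (Suc ` insert 0 (Suc ` T)) * ?G (W \<union> T)))"
    by (simp only: sum.distrib sum_distrib_left)
  also have "(\<Sum>W\<in>Pow S. \<Sum>T\<in>Pow (S - W). k (insert 0 (Suc ` Suc ` W)) *
          (of_bool (T \<in> Init (W \<union> T)) * k (Suc ` insert 0 (Suc ` T)) * ?G (W \<union> T))) =
      (\<Sum>U\<in>Pow S. \<Sum>T\<in>Pow U. k (insert 0 (Suc ` Suc ` (U - T))) *
          (of_bool (T \<in> Init (U - T \<union> T)) * k (Suc ` insert 0 (Suc ` T)) * ?G (U - T \<union> T)))"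
    by (rule sum_Pow_Pow_diff[OF fin])
  also have "\<dots> = (\<Sum>U\<in>Pow S. \<Sum>T\<in>Pow U. if T \<in> Init U then
       k (Suc ` insert 0 (Suc ` T)) * k (insert 0 (Suc ` Suc ` (U - T))) * ?G U else 0)"
    by (intro sum.cong refl) (simp add: Un_absorb2)
  also have "\<dots> = (\<Sum>U\<in>Pow S. \<Sum>T\<in>Init U.
       k (Suc ` insert 0 (Suc ` T)) * k (insert 0 (Suc ` Suc ` (U - T))) * ?G U)"
  proof (rule sum.cong[OF refl])
    fix U assume U: "U \<in> Pow S"
    have "Init U = {T \<in> Pow U. T \<in> Init U}" by (auto simp: Init_def)
    moreover have "finite (Pow U)" using fU[OF U] by simp
    ultimately show "(\<Sum>T\<in>Pow U. if T \<in> Init U then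
       k (Suc ` insert 0 (Suc ` T)) * k (insert 0 (Suc ` Suc ` (U - T))) * ?G U else 0) = (\<Sum>T\<in>Init U.
       k (Suc ` insert 0 (Suc ` T)) * k (insert 0 (Suc ` Suc ` (U - T))) * ?G U)"
      by (simp only: sum.inter_filter[symmetric])
  qed
  finally show ?thesis
    by (simp only: sum.distrib sum_distrib_right distrib_right)
qed

subsection \<open>Sums over non-crossing partitions of a word\<close>

lemma nths_Cons_Suc [simp]: "nths (x # z) (Suc ` T) = nths z T"
  by (simp add: nths_Cons image_iff)

lemma nths_Cons_insert [simp]: "nths (x # z) (insert 0 (Suc ` T)) = x # nths z T"
  by (simp add: nths_Cons image_iff)

lemma nths_cong_set:
  assumes "{i. i < length y \<and> i \<in> A} = {i. i < length y \<and> i \<in> B}"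
  shows "nths y A = nths y B"
proof -
  have "i \<in> A \<longleftrightarrow> i \<in> B" if "i < length y" for i using assms that by blast
  then have "filter (\<lambda>p. snd p \<in> A) (zip y [0..<length y]) = filter (\<lambda>p. snd p \<in> B) (zip y [0..<length y])"
    by (intro filter_cong refl) (auto dest!: set_zip_rightD)
  then show ?thesis by (simp add: nths_def)
qed

lemma Init_Suc: "Init (Suc ` U) = (`) Suc ` Init U"
proof (intro equalityI subsetI)
  fix T assume T: "T \<in> Init (Suc ` U)"
  then have i: "Suc ` (Suc -` T) = T" by (auto simp: Init_def)
  have "Suc -` T \<in> Init U" using T unfolding Init_def by fastforce
  then show "T \<in> (`) Suc ` Init U" using i by (metis image_eqI)
qed (fastforce simp: Init_def)

lemma Init_insert: "Init (insert 0 (Suc ` U)) = insert {} ((\<lambda>T. insert 0 (Suc ` T)) ` Init U)"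
proof (intro equalityI subsetI)
  fix T assume T: "T \<in> Init (insert 0 (Suc ` U))"
  show "T \<in> insert {} ((\<lambda>T. insert 0 (Suc ` T)) ` Init U)"
  proof (cases "T = {}")
    case False
    then have 0: "0 \<in> T" using T unfolding Init_def by fastforce
    then have i: "insert 0 (Suc ` (Suc -` T)) = T" using T by (auto simp: Init_def)
    have "Suc -` T \<in> Init U" using T unfolding Init_def by fastforce
    then show ?thesis using i by (metis image_eqI insertCI)
  qed simp
next
  fix T assume "T \<in> insert {} ((\<lambda>T. insert 0 (Suc ` T)) ` Init U)"
  then show "T \<in> Init (insert 0 (Suc ` U))" by (auto simp: Init_def)
qed

text \<open>An initial segment of \<open>U\<close> is a place to cut the subword on
  \<open>U\<close>; the extra empty segment in \<open>Init_insert\<close> is the cut in front of the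
  head.\<close>

lemma sum_Init:
  assumes "U \<subseteq> {..<length z}"
  shows "(\<Sum>T\<in>Init U. F (nths z T) (nths z (U - T))) =
    (\<Sum>j\<le>length (nths z U). (F (take j (nths z U)) (drop j (nths z U)) :: complex))"
  using assms
proof (induction z arbitrary: U F)
  case Nil
  then have "Init U = {{}}" by (auto simp: Init_def)
  then show ?case by simp
next
  case (Cons x z)
  define V where "V = Suc -` U"
  have V: "V \<subseteq> {..<length z}" using Cons.prems unfolding V_def by auto
  have fV: "finite (Init V)" by (rule finite_subset[of _ "Pow V"]) (use V finite_subset in \<open>auto simp: Init_def\<close>)
  have inj: "inj_on ((`) Suc) A" for A by (metis inj_Suc inj_image inj_on_subset subset_UNIV)
  have inj2: "inj_on (\<lambda>T. insert 0 (Suc ` T)) A" for A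
    by (rule inj_onI) (metis (no_types, lifting) Diff_insert_absorb image_iff inj_Suc inj_image_eq_iff nat.distinct(1))
  have d1: "Suc ` V - Suc ` T = Suc ` (V - T)" for T by auto
  have d2: "insert 0 (Suc ` V) - insert 0 (Suc ` T) = Suc ` (V - T)" for T by auto
  show ?case
  proof (cases "0 \<in> U")
    case False
    then have U: "U = Suc ` V" using image_Suc_vimage[of U] V_def by simp
    show ?thesis using Cons.IH[OF V, of F]
      unfolding U Init_Suc by (simp add: sum.reindex[OF inj] d1)
  next
    case True
    have "Suc -` (U - {0}) = V" unfolding V_def by auto
    then have U: "U = insert 0 (Suc ` V)" using True image_Suc_vimage[of "U - {0}"] by auto
    have n: "{} \<notin> (\<lambda>T. insert 0 (Suc ` T)) ` Init V" by auto
    show ?thesis using Cons.IH[OF V, of "\<lambda>a. F (x # a)"]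
      unfolding U Init_insert
      by (simp add: sum.insert[OF _ n] fV sum.reindex[OF inj2] d2 sum.atMost_Suc_shift del: sum.atMost_Suc)
  qed
qed

text \<open>The moment-cumulant formula read as a definition: the moment that a cumulant functional
  \<open>K\<close> assigns to a word.\<close>

definition MC :: "('a list \<Rightarrow> complex) \<Rightarrow> 'a list \<Rightarrow> complex" where
  "MC K w = (\<Sum>\<pi>\<in>NC id {..<length w}. \<Prod>B\<in>\<pi>. K (nths w B))"

text \<open>The contribution of all other blocks once a letter in front of \<open>y\<close> and the
  letters of \<open>y\<close> at \<open>U\<close> form one block.\<close>

definition GW :: "('a list \<Rightarrow> complex) \<Rightarrow> 'a list \<Rightarrow> nat set \<Rightarrow> complex" where
  "GW K y U = (\<Sum>\<rho>\<in>Gset {..<length y} U. \<Prod>B\<in>\<rho>. K (nths y B))"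

lemma MC_Nil [simp]: "MC K [] = 1"
proof -
  have "NC id {..<length ([] :: 'a list)} = {{}}" by (auto simp: NC_def partition_on_empty ncfam_def)
  then show ?thesis by (simp add: MC_def)
qed

lemma lessThan_Suc_insert: "{..<Suc n} = insert 0 (Suc ` {..<n})"
  by (rule lessThan_Suc_eq_insert_0)

lemma MC_Cons: "MC K (a # y) = (\<Sum>U\<in>Pow {..<length y}. K (a # nths y U) * GW K y U)"
  unfolding MC_def GW_def length_Cons lessThan_Suc_insert by (subst sum_NC_peel) simp_all

text \<open>The value that a cumulant with the product of \<open>a\<close> and \<open>b\<close> as
  first entry has to take: both lie in one block, or \<open>b\<close> keeps an initial piece of the
  rest and \<open>a\<close> the remainder.\<close>

definition splitK :: "('a list \<Rightarrow> complex) \<Rightarrow> 'a \<Rightarrow> 'a \<Rightarrow> 'a list \<Rightarrow> complex" where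
  "splitK K a b z = K (a # b # z) + (\<Sum>j\<le>length z. K (b # take j z) * K (a # drop j z))"

lemma MC_Cons2:
  "MC K (a # b # y) = (\<Sum>U\<in>Pow {..<length y}. splitK K a b (nths y U) * GW K y U)"
proof -
  have "MC K (a # b # y) = (\<Sum>U\<in>Pow {..<length y}. (K (a # b # nths y U) +
     (\<Sum>T\<in>Init U. K (b # nths y T) * K (a # nths y (U - T)))) * GW K y U)"
    unfolding MC_def GW_def length_Cons lessThan_Suc_insert by (subst sum_NC_peel2) (simp_all del: image_insert)
  also have "\<dots> = (\<Sum>U\<in>Pow {..<length y}. splitK K a b (nths y U) * GW K y U)"
    by (intro sum.cong refl) (simp add: splitK_def sum_Init[where F = "\<lambda>s t. K (b # s) * K (a # t)"])
  finally show ?thesis .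
qed

lemma GW_top: "GW K y {..<length y} = 1"
proof -
  have "Gset {..<length y} {..<length y} = {{}}"
    by (auto simp: Gset_def partition_on_empty ncfam_def)
  then show ?thesis by (simp add: GW_def)
qed

lemma GW_cong:
  assumes "\<And>B. B \<subseteq> {..<length y} - U \<Longrightarrow> K (nths y B) = K' (nths y B)"
  shows "GW K y U = GW K' y U"
  unfolding GW_def
  by (intro sum.cong prod.cong refl assms) (auto simp: Gset_def dest: partition_onD1)

lemma length_nths_less:
  assumes "U \<in> Pow {..<length y} - {{..<length y}}"
  shows "length (nths y U) < length y"
proof -
  have "{i. i < length y \<and> i \<in> U} \<subset> {..<length y}" using assms by auto
  then show ?thesis unfolding length_nths using psubset_card_mono[of "{..<length y}"] by simp
qed

lemma MC_Cons_top:
  "MC K (a # y) = K (a # y) + (\<Sum>U\<in>Pow {..<length y} - {{..<length y}}. K (a # nths y U) * GW K y U)"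
  unfolding MC_Cons by (subst sum.remove[of _ "{..<length y}"]) (auto simp: GW_top nths_all)

text \<open>Non-crossing partitions live on a circle, so rotating the positions preserves them and
  cyclic invariance of cumulants passes to moments.\<close>

lemma MC_rotate:
  assumes rot: "\<And>B. K (nths y B @ [a]) = K (a # nths y B)"
  shows "MC K (y @ [a]) = MC K (a # y)"
proof -
  let ?n = "length y"
  \<comment> \<open>The cyclic shift that sends the first position to the last one.\<close>
  define f where "f i = (if i = 0 then ?n else i - 1)" for i :: nat
  have fnz: "i \<noteq> 0" if "f i < f j" "j < Suc ?n" for i j using that by (auto simp: f_def split: if_splits)
  have inj: "inj_on f {..<Suc ?n}" unfolding f_def inj_on_def by auto
  have im: "f ` {..<Suc ?n} = {..<Suc ?n}"
    by (rule endo_inj_surj[OF _ _ inj]) (auto simp: f_def)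
  have c1: "crosses id A B \<or> crosses id B A"
    if AB: "A \<subseteq> {..<Suc ?n}" "B \<subseteq> {..<Suc ?n}" and c: "crosses id (f ` A) (f ` B)" for A B
  proof -
    obtain a b c d where x: "a \<in> A" "b \<in> B" "c \<in> A" "d \<in> B" "f a < f b" "f b < f c" "f c < f d"
      using c unfolding crosses_def id_def by blast
    have l: "a < Suc ?n" "b < Suc ?n" "c < Suc ?n" "d < Suc ?n" using AB x by auto
    show ?thesis
    proof (cases "d = 0")
      \<comment> \<open>The last point of the pattern is the one that was moved to the end; before
        the shift it comes first, and the blocks swap roles.\<close>
      case True
      have "a \<noteq> 0" "b \<noteq> 0" "c \<noteq> 0" using x l fnz[of a b] fnz[of b c] fnz[of c d] by auto
      then have "d < a \<and> a < b \<and> b < c" using True x by (simp add: f_def) linarith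
      then have "crosses id B A" unfolding crosses_def id_def using x by blast
      then show ?thesis ..
    next
      case False
      have "a \<noteq> 0" "b \<noteq> 0" "c \<noteq> 0" using x l fnz[of a b] fnz[of b c] fnz[of c d] by auto
      then have "a < b \<and> b < c \<and> c < d" using False x by (simp add: f_def) linarith
      then have "crosses id A B" unfolding crosses_def id_def using x by blast
      then show ?thesis ..
    qed
  qed
  have c2: "crosses id (f ` A) (f ` B) \<or> crosses id (f ` B) (f ` A)"
    if AB: "A \<subseteq> {..<Suc ?n}" "B \<subseteq> {..<Suc ?n}" and c: "crosses id A B" for A B
  proof -
    obtain a b c d where x: "a \<in> A" "b \<in> B" "c \<in> A" "d \<in> B" "a < b" "b < c" "c < d"
      using c unfolding crosses_def id_def by blast
    have l: "a < Suc ?n" "b < Suc ?n" "c < Suc ?n" "d < Suc ?n" using AB x by auto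
    have y: "f a \<in> f ` A" "f b \<in> f ` B" "f c \<in> f ` A" "f d \<in> f ` B" using x by auto
    show ?thesis
    proof (cases "a = 0")
      case True
      then have "f b < f c \<and> f c < f d \<and> f d < f a" using x l unfolding f_def by auto
      then have "crosses id (f ` B) (f ` A)" unfolding crosses_def id_def using y by blast
      then show ?thesis ..
    next
      case False
      then have "f a < f b \<and> f b < f c \<and> f c < f d" using x l unfolding f_def by auto
      then have "crosses id (f ` A) (f ` B)" unfolding crosses_def id_def using y by blast
      then show ?thesis ..
    qed
  qed
  have K: "K (nths (y @ [a]) (f ` B)) = K (nths (a # y) B)" if B: "B \<subseteq> {..<Suc ?n}" for B
  proof -
    have "nths y (f ` B) = nths y (Suc -` B)"
    proof -
      have "{i. i < ?n \<and> i \<in> f ` B} = {i. i < ?n \<and> i \<in> Suc -` B}"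
      proof (intro Collect_cong conj_cong refl)
        fix i assume i: "i < ?n"
        have "i \<in> f ` B" if "Suc i \<in> B" using imageI[OF that, of f] by (simp add: f_def)
        moreover have "Suc i \<in> B" if "i \<in> f ` B" using that i by (auto simp: f_def split: if_splits)
        ultimately show "(i \<in> f ` B) = (i \<in> Suc -` B)" by auto
      qed
      then show ?thesis by (rule nths_cong_set)
    qed
    moreover have "nths [a] {j. j + ?n \<in> f ` B} = (if 0 \<in> B then [a] else [])"
    proof -
      have "?n \<in> f ` B \<longleftrightarrow> 0 \<in> B" using B by (force simp: f_def split: if_splits)
      then show ?thesis by simp
    qed
    ultimately show ?thesis using rot[of "Suc -` B"] by (simp add: nths_append nths_Cons vimage_def)
  qed
  have "MC K (y @ [a]) = (\<Sum>\<pi>\<in>NC id (f ` {..<Suc ?n}). \<Prod>B\<in>\<pi>. K (nths (y @ [a]) B))"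
    by (simp add: MC_def im)
  also have "\<dots> = (\<Sum>\<pi>\<in>NC id {..<Suc ?n}. \<Prod>B\<in>\<pi>. K (nths (y @ [a]) (f ` B)))"
    by (rule sum_NC_reindex[OF inj]) (use c1 c2 in blast)
  also have "\<dots> = (\<Sum>\<pi>\<in>NC id {..<Suc ?n}. \<Prod>B\<in>\<pi>. K (nths (a # y) B))"
    by (intro sum.cong prod.cong refl K) (auto dest: NC_subset)
  finally show ?thesis by (simp add: MC_def)
qed

text \<open>Without singletons, take two points of one block at minimal distance. The right
  neighbour of the left one has another colour, hence another block; a partner of it inside the gap
  contradicts minimality, a partner outside produces a crossing.\<close>

lemma NC_alternating_singleton:
  assumes \<pi>: "\<pi> \<in> NC id {..<n}" and n: "n > 0"
    and hom: "\<And>B i j. B \<in> \<pi> \<Longrightarrow> i \<in> B \<Longrightarrow> j \<in> B \<Longrightarrow> c i = c j"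
    and alt: "\<And>i. Suc i < n \<Longrightarrow> c i \<noteq> c (Suc i)"
  shows "\<exists>i<n. {i} \<in> \<pi>"
proof (rule ccontr)
  assume no: "\<not> (\<exists>i<n. {i} \<in> \<pi>)"
  have p: "partition_on {..<n} \<pi>" and nc: "ncfam id \<pi>" using \<pi> by (auto simp: NC_def)
  have other: "\<exists>B\<in>\<pi>. i \<in> B \<and> (\<exists>j\<in>B. j \<noteq> i)" if i: "i < n" for i
  proof -
    obtain B where B: "B \<in> \<pi>" "i \<in> B" using partition_onD1[OF p] i by (metis UnionE lessThan_iff)
    then have "B \<noteq> {i}" using no i by auto
    then show ?thesis using B by auto
  qed
  define Q where "Q d \<longleftrightarrow> (\<exists>B\<in>\<pi>. \<exists>x\<in>B. \<exists>y\<in>B. x < y \<and> y - x = d)" for d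
  have "\<exists>d. Q d"
  proof -
    obtain B j where "B \<in> \<pi>" "0 \<in> B" "j \<in> B" "j \<noteq> 0" using other[OF n] by auto
    then show ?thesis unfolding Q_def by (metis gr0I)
  qed
  then have "Q (LEAST d. Q d)" by (rule LeastI_ex)
  then obtain B x y where B: "B \<in> \<pi>" "x \<in> B" "y \<in> B" "x < y" and d: "y - x = (LEAST d. Q d)"
    unfolding Q_def by blast
  have yn: "y < n" using NC_subset[OF \<pi> B(1)] B by auto
  then have "c x \<noteq> c (Suc x)" using alt B by auto
  then have z: "Suc x < y" using hom[OF B(1,2,3)] B(4) by (metis Suc_lessI)
  obtain C w where C: "C \<in> \<pi>" "Suc x \<in> C" "w \<in> C" "w \<noteq> Suc x" using other[of "Suc x"] z yn by auto
  have CB: "C \<noteq> B" using C B hom \<open>c x \<noteq> c (Suc x)\<close> by blast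
  have disj: "C \<inter> B = {}" using partition_onD2[OF p] C B CB by (auto simp: disjoint_def)
  have wxy: "w \<noteq> x" "w \<noteq> y" using disj C B by auto
  consider "w < x" | "x < w" "w < y" | "y < w" using wxy by linarith
  then show False
  proof cases
    case 1
    then have "crosses id C B" unfolding crosses_def id_def using C B z by (meson lessI)
    then show False using nc C B CB unfolding ncfam_def by auto
  next
    case 2
    then have "Suc x < w" using C by auto
    then have "Q (w - Suc x)" unfolding Q_def using C by blast
    then have "y - x \<le> w - Suc x" unfolding d by (rule Least_le)
    then show False using 2 by auto
  next
    case 3
    then have "crosses id B C" unfolding crosses_def id_def using C B z by (meson lessI)
    then show False using nc C B CB unfolding ncfam_def by auto
  qed
qed

section \<open>Free cumulants of two probability spaces\<close>

text \<open>The moment-cumulant formula solved for the one-block term. \<open>P\<close> is the class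
  of partitions, \<open>h\<close> selects the words that may have non-zero cumulants and
  \<open>m\<close> gives their moments, so free and bi-free cumulants are two instances. The length
  test makes the recursion terminate; by \<open>length_nths_block\<close> it succeeds on every block
  of a partition with more than one block.\<close>

function cumul :: "('a list \<Rightarrow> nat set set set) \<Rightarrow> ('a list \<Rightarrow> bool) \<Rightarrow> ('a list \<Rightarrow> complex) \<Rightarrow> 'a list \<Rightarrow> complex"
  where
  "cumul P h m w = (if w = [] \<or> \<not> h w then 0 else
     m w - (\<Sum>\<pi>\<in>P w - {{{..<length w}}}. \<Prod>B\<in>\<pi>.
        if length (nths w B) < length w then cumul P h m (nths w B) else 0))"
  by pat_completeness auto
termination by (relation "Wellfounded.measure (\<lambda>(P, h, m, w). length w)") auto

declare cumul.simps [simp del]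

lemma length_nths_block:
  assumes "partition_on {..<length w} \<pi>" "\<pi> \<noteq> {{..<length w}}" "B \<in> \<pi>"
  shows "length (nths w B) < length w"
proof -
  have B: "B \<subseteq> {..<length w}" using partition_onD1[OF assms(1)] assms(3) by auto
  have "B \<noteq> {..<length w}"
  proof
    assume e: "B = {..<length w}"
    have eqB: "C = B" if C: "C \<in> \<pi>" for C
    proof (rule ccontr)
      assume "C \<noteq> B"
      then have "C \<inter> B = {}" using partition_onD2[OF assms(1)] C assms(3) by (auto simp: disjoint_def)
      moreover have "C \<subseteq> B" unfolding e partition_onD1[OF assms(1)] using C by auto
      ultimately have "C = {}" by blast
      then show False using partition_onD3[OF assms(1)] C by blast
    qed
    have "\<pi> \<subseteq> {B}" by (simp add: subset_iff eqB)
    then show False using assms(2,3) e by auto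
  qed
  then show ?thesis using length_nths_less[of B w] B by auto
qed

lemma cumul_moment:
  assumes P: "\<And>\<pi>. \<pi> \<in> P w \<Longrightarrow> partition_on {..<length w} \<pi>" and top: "{{..<length w}} \<in> P w"
    and w: "w \<noteq> []" "h w"
  shows "(\<Sum>\<pi>\<in>P w. \<Prod>B\<in>\<pi>. cumul P h m (nths w B)) = m w"
proof -
  have fin: "finite (P w)"
    by (rule finite_subset[OF _ finitely_many_partition_on[of "{..<length w}"]]) (use P in auto)
  have "(\<Sum>\<pi>\<in>P w. \<Prod>B\<in>\<pi>. cumul P h m (nths w B)) =
     (\<Prod>B\<in>{{..<length w}}. cumul P h m (nths w B)) +
     (\<Sum>\<pi>\<in>P w - {{{..<length w}}}. \<Prod>B\<in>\<pi>. cumul P h m (nths w B))"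
    by (rule sum.remove[OF fin top])
  also have "(\<Prod>B\<in>{{..<length w}}. cumul P h m (nths w B)) = cumul P h m w" by simp
  also have "cumul P h m w = m w - (\<Sum>\<pi>\<in>P w - {{{..<length w}}}. \<Prod>B\<in>\<pi>.
        if length (nths w B) < length w then cumul P h m (nths w B) else 0)"
    by (subst cumul.simps) (use w in simp)
  also have "(\<Sum>\<pi>\<in>P w - {{{..<length w}}}. \<Prod>B\<in>\<pi>.
        if length (nths w B) < length w then cumul P h m (nths w B) else 0) =
     (\<Sum>\<pi>\<in>P w - {{{..<length w}}}. \<Prod>B\<in>\<pi>. cumul P h m (nths w B))"
    using P length_nths_block by (intro sum.cong prod.cong refl) auto
  finally show ?thesis by simp
qed

lemma cumul_trivial: "w = [] \<or> \<not> h w \<Longrightarrow> cumul P h m w = 0"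
  by (subst cumul.simps) simp

text \<open>Induction on the length: the full sums over \<open>P w\<close> agree, and so do all
  terms but the one-block term, which carries \<open>\<kappa> w\<close>.\<close>

lemma cumul_unique:
  assumes P: "\<And>w \<pi>. \<pi> \<in> P w \<Longrightarrow> partition_on {..<length w} \<pi>" and top: "\<And>w. w \<noteq> [] \<Longrightarrow> {{..<length w}} \<in> P w"
    and triv: "\<And>w. w = [] \<or> \<not> h w \<Longrightarrow> \<kappa> w = 0"
    and mom: "\<And>w. w \<noteq> [] \<Longrightarrow> h w \<Longrightarrow> (\<Sum>\<pi>\<in>P w. \<Prod>B\<in>\<pi>. \<kappa> (nths w B)) = m w"
  shows "\<kappa> w = cumul P h m w"
proof (induction "length w" arbitrary: w rule: less_induct)
  case less
  show ?case
  proof (cases "w = [] \<or> \<not> h w")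
    case True
    then show ?thesis by (simp add: triv cumul_trivial)
  next
    case False
    have fin: "finite (P w)"
      by (rule finite_subset[OF _ finitely_many_partition_on[of "{..<length w}"]]) (use P in auto)
    have tp: "{{..<length w}} \<in> P w" using top False by simp
    have "(\<Sum>\<pi>\<in>P w. \<Prod>B\<in>\<pi>. \<kappa> (nths w B)) = (\<Sum>\<pi>\<in>P w. \<Prod>B\<in>\<pi>. cumul P h m (nths w B))"
      using mom[of w] cumul_moment[of P w h m] P tp False by auto
    moreover have "(\<Sum>\<pi>\<in>P w - {{{..<length w}}}. \<Prod>B\<in>\<pi>. \<kappa> (nths w B)) =
       (\<Sum>\<pi>\<in>P w - {{{..<length w}}}. \<Prod>B\<in>\<pi>. cumul P h m (nths w B))"
    proof (intro sum.cong prod.cong refl)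
      fix \<pi> B assume "\<pi> \<in> P w - {{{..<length w}}}" "B \<in> \<pi>"
      then have "length (nths w B) < length w" by (intro length_nths_block[OF P]) auto
      then show "\<kappa> (nths w B) = cumul P h m (nths w B)" by (rule less.hyps)
    qed
    ultimately show ?thesis
      unfolding sum.remove[OF fin tp] by simp
  qed
qed

text \<open>Truncating \<open>K\<close> below the length of \<open>w\<close> kills the one-block
  partition and changes nothing else, all other blocks being shorter. Properties of moments can thus
  be passed to cumulants by induction.\<close>

lemma MC_top:
  assumes "w \<noteq> []"
  shows "MC K w = K w + MC (\<lambda>v. if length v < length w then K v else 0) w"
proof -
  obtain a y where w: "w = a # y" using assms by (cases w) auto
  let ?K = "\<lambda>v. if length v < length w then K v else 0"
  have l: "length (nths y B) \<le> length y" for B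
    unfolding length_nths using card_mono[of "{..<length y}" "{i. i < length y \<and> i \<in> B}"] by auto
  have "GW ?K y U = GW K y U" for U
    by (rule GW_cong) (use l in \<open>auto simp: w less_Suc_eq_le\<close>)
  moreover have "?K (a # nths y U) = K (a # nths y U)" if "U \<in> Pow {..<length y} - {{..<length y}}" for U
    using length_nths_less[OF that] by (simp add: w)
  ultimately show ?thesis unfolding w MC_Cons_top[of K] MC_Cons_top[of ?K, unfolded w]
    by (simp add: w)
qed

lemma nths_singleton_nth: "i < length w \<Longrightarrow> nths w {i} = [w ! i]"
proof (induction w arbitrary: i)
  case (Cons a w)
  show ?case
  proof (cases i)
    case 0
    have "{j. Suc j \<in> {0::nat}} = {}" by auto
    then show ?thesis using 0 by (simp add: nths_Cons)
  next
    case (Suc k)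
    have "{j. Suc j \<in> {Suc k}} = {k}" by auto
    then show ?thesis using Suc Cons by (simp add: nths_Cons)
  qed
qed simp

text \<open>A letter \<open>(i, f)\<close> is a function \<open>f\<close> viewed in the i-th of two
  commutative probability spaces. Both share the measurable sets of \<open>X\<close>, so that one
  notion \<open>good\<close> of bounded measurable function serves both indices.\<close>

locale free_pair =
  fixes \<nu> :: "bool \<Rightarrow> 's measure" and X :: "'s measure"
  assumes prob: "prob_space (\<nu> i)" and sets_\<nu>: "sets (\<nu> i) = sets X"
begin

definition good :: "('s \<Rightarrow> complex) \<Rightarrow> bool" where
  "good f \<longleftrightarrow> f \<in> borel_measurable X \<and> (\<exists>B. \<forall>s. norm (f s) \<le> B)"

lemma good_integrable: "good f \<Longrightarrow> integrable (\<nu> i) f"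
proof -
  assume "good f"
  then obtain B where B: "\<And>s. norm (f s) \<le> B" and m: "f \<in> borel_measurable X" by (auto simp: good_def)
  interpret prob_space "\<nu> i" by (rule prob)
  have "f \<in> borel_measurable (\<nu> i)" using m by (simp cong: measurable_cong_sets add: sets_\<nu>)
  then show ?thesis by (intro integrable_const_bound[where B = B]) (simp_all add: B)
qed

lemma good_const: "good (\<lambda>_. c)" by (auto simp: good_def)

lemma good_mult: "good f \<Longrightarrow> good g \<Longrightarrow> good (\<lambda>s. f s * g s)"
proof -
  assume f: "good f" and g: "good g"
  obtain B C where B: "\<And>s. norm (f s) \<le> B" "\<And>s. norm (g s) \<le> C" using f g unfolding good_def by meson
  have "norm (f s * g s) \<le> B * C" for s
    unfolding norm_mult using B[of s] by (intro mult_mono) (auto intro: order_trans[OF norm_ge_zero])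
  then show ?thesis using f g unfolding good_def by auto
qed

lemma good_add: "good f \<Longrightarrow> good g \<Longrightarrow> good (\<lambda>s. f s + g s)"
proof -
  assume f: "good f" and g: "good g"
  obtain B C where B: "\<And>s. norm (f s) \<le> B" "\<And>s. norm (g s) \<le> C" using f g unfolding good_def by meson
  have "norm (f s + g s) \<le> B + C" for s using B[of s] norm_triangle_mono by blast
  then show ?thesis using f g unfolding good_def by auto
qed

lemma good_cnj: "good f \<Longrightarrow> good (\<lambda>s. cnj (f s))"
proof -
  have "cnj \<in> borel_measurable borel" by (intro borel_measurable_continuous_onI continuous_intros)
  then show "good f \<Longrightarrow> good (\<lambda>s. cnj (f s))"
    unfolding good_def by (auto intro: measurable_compose)
qed

definition hom :: "(bool \<times> ('s \<Rightarrow> complex)) list \<Rightarrow> bool" where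
  "hom w \<longleftrightarrow> (\<forall>a\<in>set w. \<forall>b\<in>set w. fst a = fst b)"

definition mm :: "(bool \<times> ('s \<Rightarrow> complex)) list \<Rightarrow> complex" where
  "mm w = (\<integral>s. (\<Prod>a\<leftarrow>w. snd a s) \<partial>\<nu> (fst (hd w)))"

text \<open>The argument \<open>hom\<close> builds in the vanishing of mixed cumulants, that is, the
  freeness of the two algebras.\<close>

definition K :: "(bool \<times> ('s \<Rightarrow> complex)) list \<Rightarrow> complex" where
  "K = cumul (\<lambda>w. NC id {..<length w}) hom mm"

text \<open>The free product trace, given on words instead of an algebra.\<close>

definition M :: "(bool \<times> ('s \<Rightarrow> complex)) list \<Rightarrow> complex" where "M = MC K"

definition \<phi> :: "bool \<times> ('s \<Rightarrow> complex) \<Rightarrow> complex" where "\<phi> a = (\<integral>s. snd a s \<partial>\<nu> (fst a))"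

definition goods :: "(bool \<times> ('s \<Rightarrow> complex)) list \<Rightarrow> bool" where "goods w \<longleftrightarrow> (\<forall>a\<in>set w. good (snd a))"

lemma K_triv: "w = [] \<or> \<not> hom w \<Longrightarrow> K w = 0" unfolding K_def by (rule cumul_trivial)

lemma top_NC: "w \<noteq> [] \<Longrightarrow> {{..<length w}} \<in> NC id {..<length w}"
  by (auto simp: NC_def ncfam_def intro!: partition_on_space)

lemma M_hom: "hom w \<Longrightarrow> M w = mm w"
proof (cases "w = []")
  case True
  interpret prob_space "\<nu> i" for i by (rule prob)
  show ?thesis using True by (simp add: M_def mm_def prob_space)
next
  case False
  assume "hom w"
  then show ?thesis unfolding M_def MC_def K_def
    by (intro cumul_moment) (use False top_NC in \<open>auto simp: NC_def\<close>)
qed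

lemma M_Nil [simp]: "M [] = 1" by (simp add: M_def)

lemma hom_Cons: "hom (a # z) \<longleftrightarrow> (\<forall>b\<in>set z. fst b = fst a)"
  unfolding hom_def by auto

lemma hom_snoc: "hom (z @ [a]) \<longleftrightarrow> hom (a # z)" unfolding hom_def by auto

lemma mm_snoc: assumes "hom (a # z)" shows "mm (z @ [a]) = mm (a # z)"
  using assms by (cases z) (auto simp: mm_def hom_Cons mult_ac)

text \<open>Inside one commutative algebra moments do not see the order. In \<open>MC_top\<close>
  the contributions of shorter cumulants agree by induction and \<open>MC_rotate\<close>, hence so
  do the top cumulants.\<close>

lemma K_rotate: "K (z @ [a]) = K (a # z)"
proof (induction "length z" arbitrary: z a rule: less_induct)
  case less
  show ?case
  proof (cases "hom (a # z)")
    case False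
    then show ?thesis by (simp add: K_triv hom_snoc)
  next
    case True
    let ?K = "\<lambda>v. if length v < length (a # z) then K v else 0"
    have le: "length (nths z B) \<le> length z" for B
      unfolding length_nths using card_mono[of "{..<length z}" "{i. i < length z \<and> i \<in> B}"] by auto
    have "MC ?K (z @ [a]) = MC ?K (a # z)"
      by (rule MC_rotate) (use less le in auto)
    moreover have "MC K (z @ [a]) = MC K (a # z)"
      using M_hom[OF True] M_hom[of "z @ [a]"] True mm_snoc[OF True] by (simp add: M_def hom_snoc)
    ultimately show ?thesis using MC_top[of "z @ [a]" K] MC_top[of "a # z" K] by simp
  qed
qed

lemma M_rotate1: "M (z @ [a]) = M (a # z)"
  unfolding M_def by (rule MC_rotate) (rule K_rotate)

lemma M_rotate: "M (x @ y) = M (y @ x)"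
proof (induction x arbitrary: y)
  case (Cons a x)
  have "M ((a # x) @ y) = M ((x @ y) @ [a])" using M_rotate1[of "x @ y" a] by simp
  also have "\<dots> = M (x @ (y @ [a]))" by simp
  also have "\<dots> = M ((y @ [a]) @ x)" by (rule Cons.IH)
  finally show ?case by simp
qed simp

text \<open>Both sides are top terms of the same moment, written with the product as one letter and
  as two. In \<open>MC_Cons\<close> and \<open>MC_Cons2\<close> the lower terms carry the same
  weights \<open>GW\<close>, so they cancel by induction. For mixed words every term
  vanishes.\<close>

lemma K_product: "K ((i, \<lambda>s. f s * g s) # z) = splitK K (i, f) (i, g) z"
proof (induction "length z" arbitrary: z rule: less_induct)
  case less
  show ?case
  proof (cases "\<forall>b\<in>set z. fst b = i")
    case False
    \<comment> \<open>A letter of another index lies in one of the two halves and makes that factor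
      a mixed cumulant.\<close>
    have z0: "K ((i, g) # take j z) * K ((i, f) # drop j z) = 0" for j
    proof -
      have "set z = set (take j z) \<union> set (drop j z)" by (metis append_take_drop_id set_append)
      then have "\<not> hom ((i, g) # take j z) \<or> \<not> hom ((i, f) # drop j z)" using False by (auto simp: hom_Cons)
      then show ?thesis using K_triv by auto
    qed
    moreover have "K ((i, f) # (i, g) # z) = 0" "K ((i, \<lambda>s. f s * g s) # z) = 0"
      using False hom_Cons K_triv by (metis fst_conv list.set_intros(2))+
    ultimately show ?thesis unfolding splitK_def z0 by simp
  next
    case True
    let ?P = "Pow {..<length z} - {{..<length z}}" and ?ab = "(i, \<lambda>s. f s * g s)"
    have "K (?ab # z) + (\<Sum>U\<in>?P. K (?ab # nths z U) * GW K z U) = M (?ab # z)"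
      unfolding M_def MC_Cons_top ..
    also have "\<dots> = M ((i, f) # (i, g) # z)"
      using M_hom[of "?ab # z"] M_hom[of "(i, f) # (i, g) # z"] True
      by (simp add: hom_Cons mm_def mult_ac)
    also have "\<dots> = splitK K (i, f) (i, g) z + (\<Sum>U\<in>?P. splitK K (i, f) (i, g) (nths z U) * GW K z U)"
      unfolding M_def MC_Cons2 by (subst sum.remove[of _ "{..<length z}"]) (auto simp: GW_top nths_all)
    also have "(\<Sum>U\<in>?P. splitK K (i, f) (i, g) (nths z U) * GW K z U) =
        (\<Sum>U\<in>?P. K (?ab # nths z U) * GW K z U)"
      by (intro sum.cong refl arg_cong2[where f = times] less.hyps[symmetric] length_nths_less)
    finally show ?thesis by (rule add_right_imp_eq)
  qed
qed

lemma M_merge0: "M ((i, f) # (i, g) # y) = M ((i, \<lambda>s. f s * g s) # y)"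
  unfolding M_def MC_Cons2 unfolding MC_Cons K_product ..

lemma M_merge: "M (x @ (i, f) # (i, g) # y) = M (x @ (i, \<lambda>s. f s * g s) # y)"
  using M_rotate[of x "(i, f) # (i, g) # y"] M_rotate[of x "(i, \<lambda>s. f s * g s) # y"] M_merge0 by simp

lemma K_single: "K [a] = \<phi> a"
proof -
  have "M [a] = K [a]" unfolding M_def MC_Cons_top by simp
  moreover have "M [a] = mm [a]" by (rule M_hom) (simp add: hom_def)
  ultimately show ?thesis by (simp add: mm_def \<phi>_def)
qed

text \<open>Apply the product formula to f * 1 = f. The cut at 0 reproduces the left side, because
  the cumulant of a single unit is 1, and later cuts vanish by induction; so the term with the unit
  inserted is 0. \<open>K_rotate\<close> moves the unit to the front.\<close>

lemma K_unit: "z \<noteq> [] \<Longrightarrow> K ((i, \<lambda>_. 1) # z) = 0"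
proof (induction "length z" arbitrary: z rule: less_induct)
  case less
  interpret prob_space "\<nu> i" by (rule prob)
  obtain z' a where z: "z = z' @ [a]" using less.prems by (metis rev_exhaust)
  obtain j f where a: "a = (j, f)" by force
  show ?case
  proof (cases "j = i")
    case False
    then show ?thesis by (intro K_triv) (auto simp: hom_Cons z a)
  next
    case True
    let ?u = "(i, \<lambda>_. 1) :: bool \<times> ('s \<Rightarrow> complex)"
    have z1: "K (?u # take k z') = 0" if "k \<in> {..length z'} - {0}" for k
      by (rule less.hyps) (use that z in auto)
    have "K (a # z') = splitK K a ?u z'" using K_product[of i f "\<lambda>_. 1" z'] True a by simp
    also have "\<dots> = K (a # ?u # z') + (\<Sum>k\<in>{..length z'}. K (?u # take k z') * K (a # drop k z'))"
      by (simp add: splitK_def)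
    also have "(\<Sum>k\<in>{..length z'}. K (?u # take k z') * K (a # drop k z')) =
       K (?u # take 0 z') * K (a # drop 0 z') + (\<Sum>k\<in>{..length z'} - {0}. K (?u # take k z') * K (a # drop k z'))"
      by (rule sum.remove) auto
    also have "\<dots> = K (a # z')" using z1 by (simp add: K_single \<phi>_def prob_space)
    finally have "K (a # ?u # z') = 0" by simp
    then show ?thesis using K_rotate[of "?u # z'" a] by (simp add: z)
  qed
qed

lemma M_unit0: "M ((i, \<lambda>_. 1) # y) = M y"
proof -
  interpret prob_space "\<nu> i" by (rule prob)
  have "nths y U \<noteq> []" if U: "U \<in> Pow {..<length y} - {{}}" for U
  proof -
    obtain j where "j \<in> U" using U by auto
    then have "y ! j \<in> set (nths y U)" using U by (auto simp: set_nths)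
    then show ?thesis by auto
  qed
  then have "(\<Sum>U\<in>Pow {..<length y} - {{}}. K ((i, \<lambda>_. 1) # nths y U) * GW K y U) = 0"
    by (intro sum.neutral) (simp add: K_unit)
  \<comment> \<open>When the unit forms a singleton block nothing can be split, so all non-crossing
    partitions of the rest occur.\<close>
  moreover have "GW K y {} = M y"
    unfolding GW_def M_def MC_def by (intro sum.cong) (auto simp: Gset_def NC_def splits_def)
  ultimately show ?thesis
    unfolding M_def MC_Cons by (subst sum.remove[of _ "{}"]) (auto simp: K_single \<phi>_def prob_space M_def)
qed

lemma M_unit: "M (x @ (i, \<lambda>_. 1) # y) = M (x @ y)"
  using M_rotate[of x "(i, \<lambda>_. 1) # y"] M_rotate[of x y] M_unit0 by simp

lemma good_prod_list: "goods z \<Longrightarrow> good (\<lambda>s. \<Prod>a\<leftarrow>z. snd a s)"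
  by (induction z) (auto simp: goods_def good_const intro!: good_mult)

lemma K_linear:
  assumes "good f" "good g" "goods z"
  shows "K ((i, \<lambda>s. f s + c * g s) # z) = K ((i, f) # z) + c * K ((i, g) # z)"
  using assms(3)
proof (induction "length z" arbitrary: z rule: less_induct)
  case less
  let ?h = "\<lambda>s. f s + c * g s"
  show ?case
  proof (cases "\<forall>b\<in>set z. fst b = i")
    case False
    then have "\<not> hom ((i, k) # z)" for k :: "'s \<Rightarrow> complex" by (auto simp: hom_Cons)
    then show ?thesis by (simp add: K_triv)
  next
    case True
    let ?P = "Pow {..<length z} - {{..<length z}}"
    have hom: "hom ((i, k) # z)" for k :: "'s \<Rightarrow> complex" using True by (auto simp: hom_Cons)
    have gp: "good (\<lambda>s. \<Prod>a\<leftarrow>z. snd a s)" by (rule good_prod_list[OF less.prems])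
    have int: "integrable (\<nu> i) (\<lambda>s. f s * (\<Prod>a\<leftarrow>z. snd a s))" "integrable (\<nu> i) (\<lambda>s. g s * (\<Prod>a\<leftarrow>z. snd a s))"
      using good_integrable good_mult assms gp by auto
    have "M ((i, ?h) # z) = M ((i, f) # z) + c * M ((i, g) # z)"
      unfolding M_hom[OF hom] mm_def using int
      by (simp add: distrib_right mult.assoc)
    moreover have e: "M ((i, k) # z) = K ((i, k) # z) + (\<Sum>U\<in>?P. K ((i, k) # nths z U) * GW K z U)" for k
      unfolding M_def MC_Cons_top ..
    moreover have "K ((i, ?h) # nths z U) = K ((i, f) # nths z U) + c * K ((i, g) # nths z U)" if "U \<in> ?P" for U
      by (rule less.hyps[OF length_nths_less[OF that]]) (use less.prems set_nths_subset in \<open>fastforce simp: goods_def\<close>)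
    then have "(\<Sum>U\<in>?P. K ((i, ?h) # nths z U) * GW K z U) =
       (\<Sum>U\<in>?P. K ((i, f) # nths z U) * GW K z U) + c * (\<Sum>U\<in>?P. K ((i, g) # nths z U) * GW K z U)"
      by (simp add: sum.distrib sum_distrib_left distrib_right mult.assoc)
    ultimately show ?thesis by (simp add: algebra_simps)
  qed
qed

lemma M_linear0:
  assumes "good f" "good g" "goods y"
  shows "M ((i, \<lambda>s. f s + c * g s) # y) = M ((i, f) # y) + c * M ((i, g) # y)"
proof -
  have "K ((i, \<lambda>s. f s + c * g s) # nths y U) = K ((i, f) # nths y U) + c * K ((i, g) # nths y U)" for U
    by (rule K_linear) (use assms set_nths_subset in \<open>fastforce simp: goods_def\<close>)+
  then show ?thesis unfolding M_def MC_Cons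
    by (simp add: sum.distrib sum_distrib_left distrib_right mult.assoc)
qed

lemma goods_append [simp]: "goods (x @ y) \<longleftrightarrow> goods x \<and> goods y" by (auto simp: goods_def)
lemma goods_Cons [simp]: "goods (a # y) \<longleftrightarrow> good (snd a) \<and> goods y" by (auto simp: goods_def)
lemma goods_Nil [simp]: "goods []" by (auto simp: goods_def)

lemma M_linear:
  assumes "good f" "good g" "goods x" "goods y"
  shows "M (x @ (i, \<lambda>s. f s + c * g s) # y) = M (x @ (i, f) # y) + c * M (x @ (i, g) # y)"
  using M_rotate[of x "(i, h) # y" for h] M_linear0[of f g "y @ x" i c] assms by simp

lemma M_center:
  assumes "good f" "goods x" "goods y"
  shows "M (x @ (i, f) # y) = M (x @ (i, \<lambda>s. f s - c) # y) + c * M (x @ y)"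
  using M_linear[of "\<lambda>s. f s - c" "\<lambda>_. 1" x y i c] good_add[OF assms(1) good_const[of "- c"]] assms good_const[of 1]
  by (simp add: M_unit)

text \<open>A block mixing the indices has cumulant 0. If there is none,
  \<open>NC_alternating_singleton\<close> finds a singleton, whose cumulant is a mean, hence 0. This
  is freeness in its usual form.\<close>

lemma M_alternating:
  assumes w: "w \<noteq> []" and alt: "distinct_adj (map fst w)" and cent: "\<And>a. a \<in> set w \<Longrightarrow> \<phi> a = 0"
  shows "M w = 0"
  unfolding M_def MC_def
proof (rule sum.neutral, rule ballI)
  fix \<pi> assume \<pi>: "\<pi> \<in> NC id {..<length w}"
  have p: "partition_on {..<length w} \<pi>" using \<pi> by (simp add: NC_def)
  have fin: "finite \<pi>" using finite_elements[OF _ p] by simp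
  show "(\<Prod>B\<in>\<pi>. K (nths w B)) = 0"
  proof (cases "\<forall>B\<in>\<pi>. hom (nths w B)")
    case False
    then show ?thesis using fin K_triv by (auto simp: prod_zero_iff)
  next
    case True
    define c where "c i = fst (w ! i)" for i
    have h1: "c i = c j" if B: "B \<in> \<pi>" "i \<in> B" "j \<in> B" for B i j
    proof -
      have "i < length w" "j < length w" using NC_subset[OF \<pi> B(1)] B by auto
      then have "w ! i \<in> set (nths w B)" "w ! j \<in> set (nths w B)" using B by (auto simp: set_nths)
      then show ?thesis using True B(1) unfolding hom_def c_def by blast
    qed
    have h2: "c i \<noteq> c (Suc i)" if i: "Suc i < length w" for i
    proof -
      have "map fst w ! i \<noteq> map fst w ! Suc i" using alt i unfolding distinct_adj_conv_nth by simp
      then show ?thesis unfolding nth_map[OF i] nth_map[OF Suc_lessD[OF i]] c_def .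
    qed
    have "0 < length w" using w by simp
    then have "\<exists>i<length w. {i} \<in> \<pi>"
      using NC_alternating_singleton[where c = c, OF \<pi>] h1 h2 by blast
    then obtain i where i: "i < length w" "{i} \<in> \<pi>" by blast
    have "nths w {i} = [w ! i]" by (rule nths_singleton_nth[OF i(1)])
    then have "K (nths w {i}) = 0" using K_single cent[OF nth_mem[OF i(1)]] by simp
    then show ?thesis using fin i(2) by (meson prod_zero)
  qed
qed

end

section \<open>Positivity of the free product trace\<close>

lemma sum_list_swap:
  "(\<Sum>x\<leftarrow>xs. \<Sum>y\<leftarrow>ys. f x y) = (\<Sum>y\<leftarrow>ys. \<Sum>x\<leftarrow>xs. f x y)" for f :: "_ \<Rightarrow> _ \<Rightarrow> complex"
  by (induction xs) (simp_all add: sum_list_addf)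

lemma mult_cnj_nonneg_Reals: "z * cnj z \<in> \<real>\<^sub>\<ge>\<^sub>0"
  by (simp add: complex_nonneg_Reals_iff)

lemma integral_nonneg_Reals:
  fixes f :: "'a \<Rightarrow> complex"
  assumes "\<And>s. f s \<in> \<real>\<^sub>\<ge>\<^sub>0"
  shows "(\<integral>s. f s \<partial>M) \<in> \<real>\<^sub>\<ge>\<^sub>0"
proof (cases "integrable M f")
  case True
  then show ?thesis using assms
    by (simp add: complex_nonneg_Reals_iff flip: integral_Re integral_Im)
qed (simp add: not_integrable_integral_eq)

context free_pair
begin

section \<open>Adjoints and reduction to alternating centred words\<close>

definition star :: "(bool \<times> ('s \<Rightarrow> complex)) list \<Rightarrow> (bool \<times> ('s \<Rightarrow> complex)) list" where
  "star w = rev (map (\<lambda>a. (fst a, \<lambda>s. cnj (snd a s))) w)"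

lemma star_Nil [simp]: "star [] = []" by (simp add: star_def)
lemma star_Cons [simp]: "star (a # w) = star w @ [(fst a, \<lambda>s. cnj (snd a s))]" by (simp add: star_def)
lemma star_append [simp]: "star (v @ w) = star w @ star v" by (simp add: star_def)
lemma star_eq_Nil [simp]: "star w = [] \<longleftrightarrow> w = []" by (simp add: star_def)
lemma star_star [simp]: "star (star w) = w"
  by (induction w) auto
lemma goods_star [simp]: "goods w \<Longrightarrow> goods (star w)"
  by (induction w) (auto intro: good_cnj)

definition reduced :: "(bool \<times> ('s \<Rightarrow> complex)) list \<Rightarrow> bool" where
  "reduced w \<longleftrightarrow> goods w \<and> distinct_adj (map fst w) \<and> (\<forall>a\<in>set w. \<phi> a = 0)"

lemma \<phi>_cnj: "\<phi> (i, \<lambda>s. cnj (f s)) = cnj (\<phi> (i, f))"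
  by (simp add: \<phi>_def)

lemma reduced_star: "reduced w \<Longrightarrow> reduced (star w)"
proof -
  assume w: "reduced w"
  have "map fst (star w) = rev (map fst w)" by (simp add: star_def rev_map)
  then have "distinct_adj (map fst (star w))" using w by (simp add: reduced_def)
  moreover have "\<phi> a = 0" if "a \<in> set (star w)" for a
    using that w by (auto simp: star_def reduced_def \<phi>_cnj)
  ultimately show ?thesis using w by (simp add: reduced_def)
qed

lemma reduced_Nil: "reduced []" by (simp add: reduced_def)

lemma reduced_Cons: "reduced (a # w) \<longleftrightarrow> good (snd a) \<and> \<phi> a = 0 \<and> reduced w \<and> (w = [] \<or> fst a \<noteq> fst (hd w))"
  by (cases w) (auto simp: reduced_def)

lemma reduced_append: "reduced (v @ w) \<longleftrightarrow> reduced v \<and> reduced w \<and> (v = [] \<or> w = [] \<or> fst (last v) \<noteq> fst (hd w))"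
  by (auto simp: reduced_def distinct_adj_append_iff hd_map last_map)

lemma M_reduced: "reduced w \<Longrightarrow> w \<noteq> [] \<Longrightarrow> M w = 0"
  by (rule M_alternating) (auto simp: reduced_def)

text \<open>Formal linear combinations are lists of coefficients and words, and equality is tested
  under \<open>M\<close> in every context. The clause for adjoints is carried along because the
  positive form has \<open>star\<close> of a word as its left factor.\<close>

definition lin_equiv where
  "lin_equiv w L \<longleftrightarrow> (\<forall>x y. goods x \<longrightarrow> goods y \<longrightarrow>
     M (x @ w @ y) = (\<Sum>(c, v)\<leftarrow>L. c * M (x @ v @ y)) \<and>
     M (x @ star w @ y) = (\<Sum>(c, v)\<leftarrow>L. cnj c * M (x @ star v @ y)))"

lemma \<phi>_center: "good f \<Longrightarrow> \<phi> (i, \<lambda>s. f s - \<phi> (i, f)) = 0"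
proof -
  interpret prob_space "\<nu> i" by (rule prob)
  assume "good f"
  then have "integrable (\<nu> i) f" by (rule good_integrable)
  then show ?thesis by (simp add: \<phi>_def prob_space)
qed

lemma good_diff_const: "good f \<Longrightarrow> good (\<lambda>s. f s - c)"
  using good_add[of f "\<lambda>_. - c"] good_const by simp

lemma lin_equiv_center:
  assumes "good f" "goods v"
  shows "lin_equiv ((i, f) # v) [(1, (i, \<lambda>s. f s - c) # v), (c, v)]"
proof -
  have "M (x @ (i, f) # v @ y) = M (x @ (i, \<lambda>s. f s - c) # v @ y) + c * M (x @ v @ y)"
    if "goods x" "goods y" for x y
    using M_center[of f x "v @ y"] that assms by simp
  moreover have "M (x @ star v @ (i, \<lambda>s. cnj (f s)) # y) =
      M (x @ star v @ (i, \<lambda>s. cnj (f s - c)) # y) + cnj c * M (x @ star v @ y)"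
    if "goods x" "goods y" for x y
    using M_center[of "\<lambda>s. cnj (f s)" "x @ star v" y i "cnj c"] that assms good_cnj by simp
  ultimately show ?thesis unfolding lin_equiv_def by simp
qed

lemma lin_equiv_merge: "lin_equiv ((i, f) # (i, g) # v) L" if "lin_equiv ((i, \<lambda>s. f s * g s) # v) L"
proof -
  have "M (x @ ((i, f) # (i, g) # v) @ y) = M (x @ ((i, \<lambda>s. f s * g s) # v) @ y)" for x y
    using M_merge by simp
  moreover have "M (x @ star ((i, f) # (i, g) # v) @ y) = M (x @ star ((i, \<lambda>s. f s * g s) # v) @ y)" for x y
    using M_merge[of "x @ star v" i "\<lambda>s. cnj (g s)" "\<lambda>s. cnj (f s)" y] by (simp add: mult.commute)
  ultimately show ?thesis using that unfolding lin_equiv_def by simp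
qed

text \<open>If the new index differs from that of the head, the new letter is centred; otherwise it
  is first multiplied into the head. The mean contributes a shorter reduced word.\<close>

lemma lin_equiv_step:
  assumes f: "good f" and v: "reduced v"
  shows "\<exists>L. (\<forall>(c, u)\<in>set L. reduced u) \<and> lin_equiv ((i, f) # v) L"
proof (cases "v = [] \<or> fst (hd v) \<noteq> i")
  case True
  let ?c = "\<phi> (i, f)"
  have "lin_equiv ((i, f) # v) [(1, (i, \<lambda>s. f s - ?c) # v), (?c, v)]"
    using lin_equiv_center[of f v] f v by (simp add: reduced_def)
  moreover have "reduced ((i, \<lambda>s. f s - ?c) # v)"
    using True v f by (auto simp: reduced_Cons good_diff_const \<phi>_center)
  ultimately show ?thesis using v by (intro exI[of _ "[(1, (i, \<lambda>s. f s - ?c) # v), (?c, v)]"]) simp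
next
  case False
  then obtain g u where vu: "v = (i, g) # u" by (cases v) auto
  have g: "good g" and u: "reduced u" "u = [] \<or> i \<noteq> fst (hd u)" using v by (auto simp: vu reduced_Cons)
  let ?h = "\<lambda>s. f s * g s"
  let ?c = "\<phi> (i, ?h)"
  have h: "good ?h" using f g by (rule good_mult)
  have "lin_equiv ((i, f) # v) [(1, (i, \<lambda>s. ?h s - ?c) # u), (?c, u)]"
    unfolding vu by (rule lin_equiv_merge, rule lin_equiv_center[OF h]) (use u in \<open>simp add: reduced_def\<close>)
  moreover have "reduced ((i, \<lambda>s. ?h s - ?c) # u)"
    using u h by (auto simp: reduced_Cons good_diff_const \<phi>_center)
  ultimately show ?thesis using u by (intro exI[of _ "[(1, (i, \<lambda>s. ?h s - ?c) # u), (?c, u)]"]) simp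
qed

lemma lin_equiv_trans:
  assumes "\<forall>(c, v)\<in>set L. \<exists>L'. (\<forall>(d, u)\<in>set L'. reduced u) \<and> lin_equiv v L'"
  shows "\<exists>L'. (\<forall>(d, u)\<in>set L'. reduced u) \<and> (\<forall>x y. goods x \<longrightarrow> goods y \<longrightarrow>
     (\<Sum>(c, v)\<leftarrow>L. c * M (x @ v @ y)) = (\<Sum>(c, v)\<leftarrow>L'. c * M (x @ v @ y)) \<and>
     (\<Sum>(c, v)\<leftarrow>L. cnj c * M (x @ star v @ y)) = (\<Sum>(c, v)\<leftarrow>L'. cnj c * M (x @ star v @ y)))"
  using assms
proof (induction L)
  case Nil
  show ?case by (rule exI[of _ "[]"]) simp
next
  case (Cons p L)
  obtain c v where p: "p = (c, v)" by force
  obtain L1 where L1: "\<forall>(d, u)\<in>set L1. reduced u" "lin_equiv v L1" using Cons.prems p by auto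
  obtain L2 where L2: "\<forall>(d, u)\<in>set L2. reduced u"
     "\<forall>x y. goods x \<longrightarrow> goods y \<longrightarrow>
     (\<Sum>(c, v)\<leftarrow>L. c * M (x @ v @ y)) = (\<Sum>(c, v)\<leftarrow>L2. c * M (x @ v @ y)) \<and>
     (\<Sum>(c, v)\<leftarrow>L. cnj c * M (x @ star v @ y)) = (\<Sum>(c, v)\<leftarrow>L2. cnj c * M (x @ star v @ y))"
  proof -
    have "\<forall>(c, v)\<in>set L. \<exists>L'. (\<forall>(d, u)\<in>set L'. reduced u) \<and> lin_equiv v L'" using Cons.prems by simp
    from Cons.IH[OF this] show ?thesis using that by blast
  qed
  have sc: "(\<Sum>(c', v)\<leftarrow>map (\<lambda>(d, u). (c * d, u)) L1. c' * F v) = c * (\<Sum>(c', v)\<leftarrow>L1. c' * F v)"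
    "(\<Sum>(c', v)\<leftarrow>map (\<lambda>(d, u). (c * d, u)) L1. cnj c' * F v) = cnj c * (\<Sum>(c', v)\<leftarrow>L1. cnj c' * F v)" for F
    by (induction L1) (auto simp: algebra_simps)
  show ?case
    by (rule exI[of _ "map (\<lambda>(d, u). (c * d, u)) L1 @ L2"])
      (use L1 L2 in \<open>auto simp: p sc lin_equiv_def simp del: map_map\<close>)
qed

lemma lin_equiv_reduced: "goods w \<Longrightarrow> \<exists>L. (\<forall>(c, u)\<in>set L. reduced u) \<and> lin_equiv w L"
proof (induction w)
  case Nil
  show ?case by (rule exI[of _ "[(1, [])]"]) (simp add: lin_equiv_def reduced_Nil)
next
  case (Cons a w)
  obtain i f where a: "a = (i, f)" by force
  have f: "good f" using Cons.prems a by simp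
  obtain L where L: "\<forall>(c, u)\<in>set L. reduced u" "lin_equiv w L" using Cons by auto
  let ?L = "map (\<lambda>(c, u). (c, (i, f) # u)) L"
  have "\<forall>(c, v)\<in>set ?L. \<exists>L'. (\<forall>(d, u)\<in>set L'. reduced u) \<and> lin_equiv v L'"
    using lin_equiv_step[OF f, of _ i] L(1) by fastforce
  from lin_equiv_trans[OF this] obtain L' where L': "\<forall>(d, u)\<in>set L'. reduced u"
     "\<And>x y. goods x \<Longrightarrow> goods y \<Longrightarrow>
     (\<Sum>(c, v)\<leftarrow>?L. c * M (x @ v @ y)) = (\<Sum>(c, v)\<leftarrow>L'. c * M (x @ v @ y)) \<and>
     (\<Sum>(c, v)\<leftarrow>?L. cnj c * M (x @ star v @ y)) = (\<Sum>(c, v)\<leftarrow>L'. cnj c * M (x @ star v @ y))"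
    by blast
  have "lin_equiv (a # w) ?L"
    unfolding lin_equiv_def
  proof (intro allI impI conjI)
    fix x y assume xy: "goods x" "goods y"
    have "goods (x @ [(i, f)])" "goods ([(i, \<lambda>s. cnj (f s))] @ y)" using xy f good_cnj by auto
    then have "M ((x @ [(i, f)]) @ w @ y) = (\<Sum>(c, v)\<leftarrow>L. c * M ((x @ [(i, f)]) @ v @ y))"
      "M (x @ star w @ ([(i, \<lambda>s. cnj (f s))] @ y)) = (\<Sum>(c, v)\<leftarrow>L. cnj c * M (x @ star v @ ([(i, \<lambda>s. cnj (f s))] @ y)))"
      using L(2) xy unfolding lin_equiv_def by blast+
    then show "M (x @ (a # w) @ y) = (\<Sum>(c, v)\<leftarrow>?L. c * M (x @ v @ y))"
      "M (x @ star (a # w) @ y) = (\<Sum>(c, v)\<leftarrow>?L. cnj c * M (x @ star v @ y))"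
      by (simp_all add: a o_def case_prod_unfold)
  qed
  then have "lin_equiv (a # w) L'" using L'(2) unfolding lin_equiv_def by simp
  then show ?case using L'(1) by blast
qed

text \<open>On reduced words this is the inner product of the free product Hilbert space, an
  orthogonal sum of tensor products of centred L2 spaces, one for each alternating pattern of
  indices.\<close>

fun ker :: "(bool \<times> ('s \<Rightarrow> complex)) list \<Rightarrow> (bool \<times> ('s \<Rightarrow> complex)) list \<Rightarrow> complex" where
  "ker [] [] = 1"
| "ker (a # v) (b # w) = (if fst a = fst b then \<phi> (fst a, \<lambda>s. cnj (snd a s) * snd b s) * ker v w else 0)"
| "ker [] (b # w) = 0"
| "ker (a # v) [] = 0"

text \<open>If the two innermost letters have different indices, the whole word is reduced and has
  trace 0. Otherwise they are multiplied: the centred part again gives a reduced word, and the mean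
  factors out and leaves the tails.\<close>

lemma M_star_reduced: "reduced v \<Longrightarrow> reduced w \<Longrightarrow> M (star v @ w) = ker v w"
proof (induction v w rule: ker.induct)
  case 1
  then show ?case by simp
next
  case (2 a v b w)
  obtain i f j g where ab: "a = (i, f)" "b = (j, g)" by force
  have f: "good f" and g: "good g" and v: "reduced v" and w: "reduced w" using 2 by (auto simp: ab reduced_Cons)
  have hd: "w = [] \<or> j \<noteq> fst (hd w)" "v = [] \<or> i \<noteq> fst (hd v)" using 2 by (auto simp: ab reduced_Cons)
  have last: "last (star v) = (fst (hd v), \<lambda>s. cnj (snd (hd v) s))" if "v \<noteq> []"
    using that by (cases v) auto
  show ?case
  proof (cases "i = j")
    case False
    have "reduced (star (a # v) @ b # w)"
      unfolding reduced_append using reduced_star[OF 2(2)] 2(3) False by (simp add: ab)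
    then show ?thesis using M_reduced False by (simp add: ab del: star_Cons)
  next
    case True
    let ?h = "\<lambda>s. cnj (f s) * g s"
    let ?c = "\<phi> (i, ?h)"
    have h: "good ?h" using good_mult[OF good_cnj[OF f] g] .
    have "M (star (a # v) @ b # w) = M (star v @ (i, ?h) # w)"
      using M_merge[of "star v" i] True by (simp add: ab)
    also have "\<dots> = M (star v @ (i, \<lambda>s. ?h s - ?c) # w) + ?c * M (star v @ w)"
      by (rule M_center) (use h v w in \<open>auto simp: reduced_def\<close>)
    also have "M (star v @ (i, \<lambda>s. ?h s - ?c) # w) = 0"
    proof (rule M_reduced)
      show "reduced (star v @ (i, \<lambda>s. ?h s - ?c) # w)"
        unfolding reduced_append reduced_Cons using reduced_star[OF v] w hd True last
        by (auto simp: good_diff_const[OF h] \<phi>_center[OF h])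
    qed simp
    also have "M (star v @ w) = ker v w" using 2(1) True v w by (simp add: ab)
    finally show ?thesis using True by (simp add: ab)
  qed
next
  case (3 b w)
  then show ?case using M_reduced by simp
next
  case (4 a v)
  have "star (a # v) \<noteq> []" by simp
  then show ?case using M_reduced[OF reduced_star[OF 4(1)]] by simp
qed

lemma integrable_const_mult: "good f \<Longrightarrow> good g \<Longrightarrow> integrable (\<nu> i) (\<lambda>s. c * (f s * g s))"
  by (intro good_integrable good_mult good_const)

text \<open>Induction on the length: the inner products of first letters are integrals, and for
  fixed \<open>s\<close> the integrand is the form for the tails with coefficients
  \<open>c k * d i k s\<close>, nonnegative by induction.\<close>

lemma ker_psd:
  assumes "finite I" "\<And>k. k \<in> I \<Longrightarrow> goods (w k) \<and> length (w k) \<le> n"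
  shows "(\<Sum>k\<in>I. \<Sum>l\<in>I. c k * cnj (c l) * ker (w l) (w k)) \<in> \<real>\<^sub>\<ge>\<^sub>0"
  using assms(2)
proof (induction n arbitrary: c w)
  case 0
  then have "ker (w l) (w k) = 1" if "k \<in> I" "l \<in> I" for k l using that by auto
  then have "(\<Sum>k\<in>I. \<Sum>l\<in>I. c k * cnj (c l) * ker (w l) (w k)) = (\<Sum>k\<in>I. c k) * cnj (\<Sum>k\<in>I. c k)"
    by (simp add: sum_product)
  then show ?case by (simp only: mult_cnj_nonneg_Reals)
next
  case (Suc n)
  \<comment> \<open>Empty words pair only with each other and are collected in \<open>e\<close>. The
    default 0 in \<open>d i k\<close> makes pairs of first letters with different indices drop out
    of both integrals.\<close>
  define e where "e k = (if w k = [] then c k else 0)" for k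
  define d where "d i k = (\<lambda>s. if w k \<noteq> [] \<and> fst (hd (w k)) = i then snd (hd (w k)) s else 0)" for i k
  have gd: "good (d i k)" if "k \<in> I" for i k
  proof (cases "w k")
    case (Cons a v)
    then show ?thesis using Suc.prems[OF that] good_const[of 0] by (cases "fst a = i") (auto simp: d_def)
  qed (use good_const[of 0] in \<open>simp add: d_def\<close>)
  let ?F = "\<lambda>i s k l. (c k * d i k s) * cnj (c l * d i l s) * ker (tl (w l)) (tl (w k))"
  have tm: "c k * cnj (c l) * ker (w l) (w k) =
      e k * cnj (e l) + (\<integral>s. ?F True s k l \<partial>\<nu> True) + (\<integral>s. ?F False s k l \<partial>\<nu> False)"
    if "k \<in> I" "l \<in> I" for k l
  proof (cases "w k = [] \<or> w l = []")
    case True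
    then show ?thesis by (cases "w k"; cases "w l") (auto simp: e_def d_def)
  next
    case False
    then obtain a v b u where wk: "w k = a # v" and wl: "w l = b # u" by (cases "w k"; cases "w l") auto
    obtain i f j g where ab: "a = (i, f)" "b = (j, g)" by force
    have *: "(\<integral>s. c k * f s * (cnj (c l) * cnj (g s)) * ker u v \<partial>\<nu> i) =
       c k * cnj (c l) * (\<phi> (i, \<lambda>s. cnj (g s) * f s) * ker u v)" for i
    proof -
      have "(\<integral>s. c k * f s * (cnj (c l) * cnj (g s)) * ker u v \<partial>\<nu> i) =
         (\<integral>s. (c k * cnj (c l) * ker u v) * (cnj (g s) * f s) \<partial>\<nu> i)"
        by (simp add: mult_ac)
      then show ?thesis by (simp add: \<phi>_def)
    qed
    show ?thesis using *[of True] *[of False] by (cases i; cases j) (auto simp: e_def d_def wk wl ab)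
  qed
  have int: "integrable (\<nu> i) (\<lambda>s. ?F i s k l)" if "k \<in> I" "l \<in> I" for i k l
  proof -
    have "integrable (\<nu> i) (\<lambda>s. (c k * cnj (c l) * ker (tl (w l)) (tl (w k))) * (d i k s * cnj (d i l s)))"
      using integrable_const_mult[OF gd[OF that(1)] good_cnj[OF gd[OF that(2)]]] .
    then show ?thesis by (simp add: mult_ac)
  qed
  have pos: "(\<integral>s. (\<Sum>k\<in>I. \<Sum>l\<in>I. ?F i s k l) \<partial>\<nu> i) \<in> \<real>\<^sub>\<ge>\<^sub>0" for i
  proof (rule integral_nonneg_Reals)
    fix s
    have "goods (tl (w k)) \<and> length (tl (w k)) \<le> n" if "k \<in> I" for k
      using Suc.prems[OF that] by (cases "w k") auto
    then show "(\<Sum>k\<in>I. \<Sum>l\<in>I. ?F i s k l) \<in> \<real>\<^sub>\<ge>\<^sub>0"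
      using Suc.IH[of "\<lambda>k. tl (w k)" "\<lambda>k. c k * d i k s"] by blast
  qed
  have ex: "(\<integral>s. (\<Sum>k\<in>I. \<Sum>l\<in>I. ?F i s k l) \<partial>\<nu> i) = (\<Sum>k\<in>I. \<Sum>l\<in>I. \<integral>s. ?F i s k l \<partial>\<nu> i)" for i
    by (subst Bochner_Integration.integral_sum, intro Bochner_Integration.integrable_sum int, assumption+)
      (intro sum.cong refl Bochner_Integration.integral_sum int, assumption+)
  have "(\<Sum>k\<in>I. \<Sum>l\<in>I. c k * cnj (c l) * ker (w l) (w k)) =
     (\<Sum>k\<in>I. e k) * cnj (\<Sum>k\<in>I. e k) + (\<integral>s. (\<Sum>k\<in>I. \<Sum>l\<in>I. ?F True s k l) \<partial>\<nu> True) +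
     (\<integral>s. (\<Sum>k\<in>I. \<Sum>l\<in>I. ?F False s k l) \<partial>\<nu> False)"
  proof -
    have "(\<Sum>k\<in>I. \<Sum>l\<in>I. c k * cnj (c l) * ker (w l) (w k)) =
       (\<Sum>k\<in>I. \<Sum>l\<in>I. e k * cnj (e l) + (\<integral>s. ?F True s k l \<partial>\<nu> True) + (\<integral>s. ?F False s k l \<partial>\<nu> False))"
      by (intro sum.cong refl tm)
    then show ?thesis unfolding ex by (simp only: sum.distrib sum_product cnj_sum)
  qed
  moreover have "(\<Sum>k\<in>I. e k) * cnj (\<Sum>k\<in>I. e k) \<in> \<real>\<^sub>\<ge>\<^sub>0"
    by (rule mult_cnj_nonneg_Reals)
  ultimately show ?case using pos by (auto intro!: nonneg_Reals_add_I)
qed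

text \<open>By sesquilinearity every word is replaced by its reduced expansion, first in the right
  factor and then, through the adjoint clause, in the left one; on reduced words the form is
  \<open>ker\<close>.\<close>

lemma M_psd:
  assumes I: "finite I" and w: "\<And>k. k \<in> I \<Longrightarrow> goods (w k)"
  shows "(\<Sum>k\<in>I. \<Sum>l\<in>I. c k * cnj (c l) * M (star (w l) @ w k)) \<in> \<real>\<^sub>\<ge>\<^sub>0"
proof -
  obtain xs where xs: "set xs = I" "distinct xs" using finite_distinct_list[OF I] by auto
  define L where "L = map (\<lambda>k. (c k, w k)) xs"
  have L: "\<forall>(c, v)\<in>set L. \<exists>L'. (\<forall>(d, u)\<in>set L'. reduced u) \<and> lin_equiv v L'"
    using lin_equiv_reduced w xs by (auto simp: L_def)
  from lin_equiv_trans[OF L] obtain N where N: "\<forall>(d, u)\<in>set N. reduced u"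
     "\<And>x y. goods x \<Longrightarrow> goods y \<Longrightarrow> (\<Sum>(c, v)\<leftarrow>L. c * M (x @ v @ y)) = (\<Sum>(c, v)\<leftarrow>N. c * M (x @ v @ y))"
     "\<And>x y. goods x \<Longrightarrow> goods y \<Longrightarrow> (\<Sum>(c, v)\<leftarrow>L. cnj c * M (x @ star v @ y)) = (\<Sum>(c, v)\<leftarrow>N. cnj c * M (x @ star v @ y))"
    by blast
  have gN: "goods v" if "(d, v) \<in> set N" for d v using N(1) that by (auto simp: reduced_def)
  have gL: "goods v" if "(d, v) \<in> set L" for d v using w xs that by (auto simp: L_def)
  have "(\<Sum>k\<in>I. \<Sum>l\<in>I. c k * cnj (c l) * M (star (w l) @ w k)) =
     (\<Sum>p\<leftarrow>L. \<Sum>q\<leftarrow>L. fst p * cnj (fst q) * M (star (snd q) @ snd p))"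
    using xs by (simp add: L_def o_def sum_list_distinct_conv_sum_set)
  also have "\<dots> = (\<Sum>q\<leftarrow>L. \<Sum>p\<leftarrow>L. fst p * cnj (fst q) * M (star (snd q) @ snd p))"
    by (rule sum_list_swap)
  also have "\<dots> = (\<Sum>q\<leftarrow>L. \<Sum>p\<leftarrow>N. fst p * cnj (fst q) * M (star (snd q) @ snd p))"
  proof (rule arg_cong[where f = sum_list], rule map_cong[OF refl])
    fix q assume q: "q \<in> set L"
    have "goods (star (snd q))" using gL q by (metis goods_star prod.collapse)
    from N(2)[OF this goods_Nil] show "(\<Sum>p\<leftarrow>L. fst p * cnj (fst q) * M (star (snd q) @ snd p)) =
       (\<Sum>p\<leftarrow>N. fst p * cnj (fst q) * M (star (snd q) @ snd p))"
      by (simp add: case_prod_unfold mult.commute[of _ "cnj (fst q)"] mult.assoc sum_list_const_mult)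
  qed
  also have "\<dots> = (\<Sum>p\<leftarrow>N. \<Sum>q\<leftarrow>L. fst p * cnj (fst q) * M (star (snd q) @ snd p))"
    by (rule sum_list_swap)
  also have "\<dots> = (\<Sum>p\<leftarrow>N. \<Sum>q\<leftarrow>N. fst p * cnj (fst q) * M (star (snd q) @ snd p))"
  proof (rule arg_cong[where f = sum_list], rule map_cong[OF refl])
    fix p assume p: "p \<in> set N"
    have "goods (snd p)" using gN p by (metis prod.collapse)
    from N(3)[OF goods_Nil this] show "(\<Sum>q\<leftarrow>L. fst p * cnj (fst q) * M (star (snd q) @ snd p)) =
       (\<Sum>q\<leftarrow>N. fst p * cnj (fst q) * M (star (snd q) @ snd p))"
      by (simp add: case_prod_unfold mult.assoc sum_list_const_mult)
  qed
  also have "\<dots> = (\<Sum>p\<leftarrow>N. \<Sum>q\<leftarrow>N. fst p * cnj (fst q) * ker (snd q) (snd p))"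
  proof (rule arg_cong[where f = sum_list], rule map_cong[OF refl],
         rule arg_cong[where f = sum_list], rule map_cong[OF refl])
    fix p q assume "p \<in> set N" "q \<in> set N"
    then have "reduced (snd p)" "reduced (snd q)" using N(1) by auto
    then show "fst p * cnj (fst q) * M (star (snd q) @ snd p) = fst p * cnj (fst q) * ker (snd q) (snd p)"
      by (simp add: M_star_reduced)
  qed
  also have "\<dots> = (\<Sum>k\<in>{0..<length N}. \<Sum>l\<in>{0..<length N}.
      fst (N ! k) * cnj (fst (N ! l)) * ker (snd (N ! l)) (snd (N ! k)))"
    by (simp add: sum_list_sum_nth)
  also have "\<dots> \<in> \<real>\<^sub>\<ge>\<^sub>0"
  proof (rule ker_psd[where n = "Max (insert 0 ((\<lambda>p. length (snd p)) ` set N))"])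
    fix k assume "k \<in> {0..<length N}"
    then have k: "N ! k \<in> set N" by auto
    then show "goods (snd (N ! k)) \<and> length (snd (N ! k)) \<le> Max (insert 0 ((\<lambda>p. length (snd p)) ` set N))"
      using gN[of "fst (N ! k)" "snd (N ! k)"] by (auto intro!: Max_ge)
  qed simp
  finally show ?thesis .
qed

section \<open>Unitary words and the Cauchy-Schwarz inequality\<close>

definition unitary :: "(bool \<times> ('s \<Rightarrow> complex)) list \<Rightarrow> bool" where
  "unitary w \<longleftrightarrow> (\<forall>a\<in>set w. good (snd a) \<and> (\<forall>s. snd a s * cnj (snd a s) = 1))"

lemma unitary_goods: "unitary w \<Longrightarrow> goods w" by (auto simp: unitary_def goods_def)

lemma unitary_append [simp]: "unitary (v @ w) \<longleftrightarrow> unitary v \<and> unitary w" by (auto simp: unitary_def)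

lemma M_unitary_cancel: "unitary w \<Longrightarrow> M (x @ w @ star w @ y) = M (x @ y)"
proof (induction w arbitrary: x y)
  case (Cons a w)
  obtain i f where a: "a = (i, f)" by force
  have w: "unitary w" and f: "(\<lambda>s. f s * cnj (f s)) = (\<lambda>_. 1)" using Cons.prems by (auto simp: unitary_def a)
  have "M (x @ (a # w) @ star (a # w) @ y) = M ((x @ [a]) @ w @ star w @ ((i, \<lambda>s. cnj (f s)) # y))"
    by (simp add: a)
  also have "\<dots> = M (x @ (i, f) # (i, \<lambda>s. cnj (f s)) # y)" using Cons.IH[OF w, of "x @ [a]"] by (simp add: a)
  also have "\<dots> = M (x @ y)" by (simp add: M_merge f M_unit)
  finally show ?case .
qed simp

text \<open>The vectors are \<open>star x\<close> and \<open>f\<close> followed by \<open>y\<close>;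
  unitarity reduces their squared norms to 1 and to the integral, so the bound does not depend on
  the length of the surrounding words.\<close>

lemma M_Cauchy_Schwarz:
  assumes x: "unitary x" and y: "unitary y" and f: "good f"
  shows "(norm (M (x @ (i, f) # y)))\<^sup>2 \<le> (\<integral>s. (norm (f s))\<^sup>2 \<partial>\<nu> i)"
proof -
  define w where "w k = (if k = 0 then star x else (i, f) # y)" for k :: nat
  define z where "z = M (x @ (i, f) # y)"
  define z' where "z' = M (star ((i, f) # y) @ star x)"
  define b where "b = (\<integral>s. (norm (f s))\<^sup>2 \<partial>\<nu> i)"
  have m00: "M (star (w 0) @ w 0) = 1" using M_unitary_cancel[OF x, of "[]" "[]"] by (simp add: w_def)
  have m01: "M (star (w 0) @ w 1) = z" by (simp add: w_def z_def)
  have m10: "M (star (w 1) @ w 0) = z'" by (simp add: w_def z'_def)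
  have m11: "M (star (w 1) @ w 1) = of_real b"
  proof -
    have "M (star (w 1) @ w 1) = M (star y @ (i, \<lambda>s. cnj (f s) * f s) # y)"
      using M_merge[of "star y" i] by (simp add: w_def)
    also have "\<dots> = M ((i, \<lambda>s. cnj (f s) * f s) # y @ star y)" by (subst M_rotate) simp
    also have "\<dots> = M [(i, \<lambda>s. cnj (f s) * f s)]"
      using M_unitary_cancel[OF y, of "[(i, \<lambda>s. cnj (f s) * f s)]" "[]"] by simp
    also have "\<dots> = (\<integral>s. cnj (f s) * f s \<partial>\<nu> i)" by (subst M_hom) (auto simp: hom_def mm_def)
    also have "\<dots> = (\<integral>s. complex_of_real ((norm (f s))\<^sup>2) \<partial>\<nu> i)"
      by (intro Bochner_Integration.integral_cong refl) (metis complex_norm_square mult.commute of_real_power)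
    also have "\<dots> = of_real b" unfolding b_def by (rule integral_complex_of_real)
    finally show ?thesis .
  qed
  have psd: "c0 * cnj c0 + c1 * cnj c0 * z + c0 * cnj c1 * z' + c1 * cnj c1 * of_real b \<in> \<real>\<^sub>\<ge>\<^sub>0" for c0 c1
  proof -
    have "goods (w k)" for k using unitary_goods[OF x] unitary_goods[OF y] f by (simp add: w_def)
    then have "(\<Sum>k\<in>{0, 1}. \<Sum>l\<in>{0, 1}. (if k = 0 then c0 else c1) * cnj (if l = 0 then c0 else c1) * M (star (w l) @ w k)) \<in> \<real>\<^sub>\<ge>\<^sub>0"
      by (intro M_psd) auto
    then show ?thesis using m00 m01 m10 m11 by (simp add: algebra_simps)
  qed
  \<comment> \<open>Polarisation with the coefficients (1, 1) and (1, i) shows that the off-diagonal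
    entries are conjugate.\<close>
  have "Im (z + z') = 0" using psd[of 1 1] by (simp add: complex_nonneg_Reals_iff)
  moreover have "Re z = Re z'" using psd[of 1 \<i>] by (simp add: complex_nonneg_Reals_iff)
  ultimately have z': "z' = cnj z" by (simp add: complex_eq_iff)
  \<comment> \<open>For second coefficient 1 the form is minimal at first coefficient -z, with value
    b - |z|^2.\<close>
  have "z * cnj z - 2 * (z * cnj z) + of_real b \<in> \<real>\<^sub>\<ge>\<^sub>0"
    using psd[of "- z" 1] unfolding z' by (simp add: algebra_simps)
  then have "of_real (b - (norm z)\<^sup>2) \<in> (\<real>\<^sub>\<ge>\<^sub>0 :: complex set)"
    by (simp add: complex_norm_square[symmetric] algebra_simps)
  then show ?thesis unfolding nonneg_Reals_of_real_iff z_def b_def by simp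
qed

end

section \<open>Schoenberg's curve\<close>

text \<open>A continuous function of period 2 that is 0 on [0, 1/3] and 1 on [2/3, 1]: it reads off
  whether the first ternary digit is 0 or 2.\<close>

definition tooth :: "real \<Rightarrow> real" where "tooth t = max 0 (min 1 (1/2 - cos (pi * t)))"

lemma tooth_bounds: "0 \<le> tooth t" "tooth t \<le> 1" by (auto simp: tooth_def)

lemma continuous_on_tooth:
  fixes g :: "real \<Rightarrow> real"
  shows "continuous_on A g \<Longrightarrow> continuous_on A (\<lambda>x. tooth (g x))"
  unfolding tooth_def by (intro continuous_intros)

lemma tooth_shift: "tooth (2 * of_int m + r) = tooth r"
proof -
  have "cos (pi * (2 * of_int m + r)) = cos ((2 * pi) * of_int m + pi * r)"
    by (simp add: algebra_simps)
  also have "\<dots> = cos (pi * r)" by (simp add: cos_add)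
  finally show ?thesis by (simp add: tooth_def)
qed

lemma tooth_low:
  assumes "0 \<le> r" "r \<le> 1/3"
  shows "tooth r = 0"
proof -
  have "cos (pi / 3) \<le> cos (pi * r)" using assms by (intro cos_monotone_0_pi_le) (auto simp: mult_left_le)
  then show ?thesis by (simp add: tooth_def cos_60)
qed

lemma tooth_high:
  assumes "2/3 \<le> r" "r \<le> 1"
  shows "tooth r = 1"
proof -
  have "cos (pi * r) \<le> cos (pi * (2/3))" using assms by (intro cos_monotone_0_pi_le) (auto simp: mult_left_le)
  also have "\<dots> = - 1/2" using cos_120 by (simp add: mult.commute)
  finally show ?thesis by (simp add: tooth_def)
qed

definition ternary :: "(nat \<Rightarrow> int) \<Rightarrow> real" where
  "ternary a = (\<Sum>j. 2 * of_int (a j) * (1/3) ^ Suc j)"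

lemma sums_third: "(\<lambda>j. 2 * (1/3) ^ Suc j) sums (1 :: real)"
proof -
  have "(\<lambda>j. (1/3 :: real) ^ j) sums (1 / (1 - 1/3))" by (rule geometric_sums) simp
  from sums_mult[OF this, of "2/3"] show ?thesis by simp
qed

lemma summable_ternary:
  assumes a: "\<And>j. a j \<in> {0, 1 :: int}"
  shows "summable (\<lambda>j. 2 * of_int (a j) * (1/3) ^ Suc j :: real)"
proof (rule summable_comparison_test'[where N = 0])
  show "summable (\<lambda>j. 2 * (1/3) ^ Suc j :: real)" using sums_third by (rule sums_summable)
  show "norm (2 * of_int (a j) * (1/3) ^ Suc j :: real) \<le> 2 * (1/3) ^ Suc j" for j
    using a[of j] by auto
qed

lemma ternary_bounds:
  assumes a: "\<And>j. a j \<in> {0, 1 :: int}"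
  shows "0 \<le> ternary a" "ternary a \<le> 1"
proof -
  have a': "0 \<le> a j" "a j \<le> 1" for j using a[of j] by auto
  show "0 \<le> ternary a"
    unfolding ternary_def by (rule suminf_nonneg[OF summable_ternary[OF a]]) (simp add: a')
  have "ternary a \<le> (\<Sum>j. 2 * (1/3) ^ Suc j)"
    unfolding ternary_def using a'
    by (intro suminf_le summable_ternary a sums_summable[OF sums_third]) simp
  also have "\<dots> = 1" using sums_third by (rule sums_unique[symmetric])
  finally show "ternary a \<le> 1" .
qed

lemma ternary_shift:
  assumes a: "\<And>j. a j \<in> {0, 1 :: int}"
  shows "3 * ternary a = 2 * of_int (a 0) + ternary (\<lambda>j. a (Suc j))"
proof -
  have s: "summable (\<lambda>j. 2 * of_int (a (Suc j)) * (1/3) ^ Suc j :: real)"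
    by (rule summable_ternary) (rule a)
  have "ternary a - 2 * of_int (a 0) * (1/3) ^ Suc 0 = (\<Sum>j. 2 * of_int (a (Suc j)) * (1/3) ^ Suc (Suc j))"
    using suminf_split_head[OF summable_ternary[of a]] a unfolding ternary_def by (simp only:)
  also have "\<dots> = (\<Sum>j. (1/3) * (2 * of_int (a (Suc j)) * (1/3) ^ Suc j) :: real)"
    by (simp add: field_simps)
  also have "\<dots> = (1/3) * ternary (\<lambda>j. a (Suc j))"
    unfolding ternary_def by (rule suminf_mult[OF s])
  finally show ?thesis by simp
qed

lemma tooth_ternary0:
  assumes a: "\<And>j. a j \<in> {0, 1 :: int}"
  shows "tooth (ternary a) = of_int (a 0)"
proof -
  have t: "ternary a = 2/3 * of_int (a 0) + ternary (\<lambda>j. a (Suc j)) / 3"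
    using ternary_shift[of a] a by simp
  have "0 \<le> ternary (\<lambda>j. a (Suc j))" "ternary (\<lambda>j. a (Suc j)) \<le> 1"
    using ternary_bounds[of "\<lambda>j. a (Suc j)"] a by auto
  then show ?thesis using a[of 0] t tooth_low[of "ternary a"] tooth_high[of "ternary a"] by auto
qed

text \<open>Multiplication by 3 moves the next digit to the front, up to an even integer that the
  period 2 of \<open>tooth\<close> absorbs.\<close>

lemma tooth_ternary:
  assumes a: "\<And>j. a j \<in> {0, 1 :: int}"
  shows "tooth (3 ^ k * ternary a) = of_int (a k)"
  using a
proof (induction k arbitrary: a)
  case 0
  then show ?case using tooth_ternary0 by simp
next
  case (Suc k)
  have "3 ^ Suc k * ternary a = 3 ^ k * (3 * ternary a)" by simp
  also have "\<dots> = 2 * of_int (3 ^ k * a 0) + 3 ^ k * ternary (\<lambda>j. a (Suc j))"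
    by (subst ternary_shift[OF Suc.prems]) (simp add: algebra_simps)
  finally have "tooth (3 ^ Suc k * ternary a) = tooth (3 ^ k * ternary (\<lambda>j. a (Suc j)))"
    by (simp only: tooth_shift)
  then show ?case using Suc.IH[of "\<lambda>j. a (Suc j)"] Suc.prems by simp
qed

definition digit :: "real \<Rightarrow> nat \<Rightarrow> int" where "digit x k = \<lfloor>2 ^ Suc k * x\<rfloor> mod 2"

lemma digit_range: "digit x k \<in> {0, 1}" unfolding digit_def by auto

lemma sums_digit:
  assumes x: "0 \<le> x" "x < 1"
  shows "(\<lambda>k. of_int (digit x k) * (1/2) ^ Suc k) sums x"
proof -
  \<comment> \<open>Halving drops the last binary digit, so the partial sums below telescope to the
    floor of 2^n x divided by 2^n.\<close>
  have fl: "\<lfloor>2 ^ Suc n * x\<rfloor> = 2 * \<lfloor>2 ^ n * x\<rfloor> + digit x n" for n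
  proof -
    have "\<lfloor>2 ^ n * x\<rfloor> = \<lfloor>2 ^ Suc n * x / of_int 2\<rfloor>" by simp
    also have "\<dots> = \<lfloor>2 ^ Suc n * x\<rfloor> div 2" by (rule floor_divide_real_eq_div) simp
    finally show ?thesis unfolding digit_def by (simp only: mult_div_mod_eq)
  qed
  have part: "(\<Sum>k<n. of_int (digit x k) * (1/2) ^ Suc k) = of_int \<lfloor>2 ^ n * x\<rfloor> / (2 ^ n :: real)" for n
  proof (induction n)
    case 0
    then show ?case using x by (simp add: floor_eq_iff)
  next
    case (Suc n)
    show ?case
      by (simp only: sum.lessThan_Suc Suc.IH fl of_int_add of_int_mult) (simp add: field_simps)
  qed
  have "(\<lambda>n. of_int \<lfloor>2 ^ n * x\<rfloor> / (2 ^ n :: real)) \<longlonglongrightarrow> x"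
  proof (rule tendsto_sandwich[where f = "\<lambda>n. x - (1/2) ^ n" and h = "\<lambda>_. x"])
    show "\<forall>\<^sub>F n in sequentially. x - (1/2) ^ n \<le> of_int \<lfloor>2 ^ n * x\<rfloor> / 2 ^ n"
    proof (rule always_eventually, rule allI)
      fix n
      have "2 ^ n * x - 1 \<le> of_int \<lfloor>2 ^ n * x\<rfloor>" by linarith
      then have "(2 ^ n * x - 1) / 2 ^ n \<le> of_int \<lfloor>2 ^ n * x\<rfloor> / 2 ^ n" by (rule divide_right_mono) simp
      then show "x - (1/2) ^ n \<le> of_int \<lfloor>2 ^ n * x\<rfloor> / 2 ^ n" by (simp add: diff_divide_distrib power_one_over)
    qed
    show "\<forall>\<^sub>F n in sequentially. of_int \<lfloor>2 ^ n * x\<rfloor> / 2 ^ n \<le> x"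
      by (rule always_eventually) (simp add: divide_le_eq mult.commute)
    have "(\<lambda>n. (1/2 :: real) ^ n) \<longlonglongrightarrow> 0" by (rule LIMSEQ_power_zero) simp
    from tendsto_diff[OF tendsto_const this, of x] show "(\<lambda>n. x - (1/2) ^ n) \<longlonglongrightarrow> x" by simp
  qed simp
  then show ?thesis unfolding sums_def part .
qed

text \<open>The even and the odd ternary digits of a point of the Cantor set are the binary digits of its two
  coordinates on Schoenberg's space-filling curve. A continuous curve onto the square lets Helly's
  theorem on the line replace compactness of the measures on the torus.\<close>

definition schoenberg :: "nat \<Rightarrow> real \<Rightarrow> real" where
  "schoenberg i t = (\<Sum>k. (1/2) ^ Suc k * tooth (3 ^ (2 * k + i) * t))"

lemma continuous_on_schoenberg: "continuous_on UNIV (schoenberg i)"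
proof -
  have "uniform_limit UNIV (\<lambda>n t. \<Sum>k<n. (1/2) ^ Suc k * tooth (3 ^ (2 * k + i) * t))
      (\<lambda>t. \<Sum>k. (1/2) ^ Suc k * tooth (3 ^ (2 * k + i) * t)) sequentially"
  proof (rule Weierstrass_m_test)
    show "norm ((1/2) ^ Suc k * tooth (3 ^ (2 * k + i) * t)) \<le> (1/2) ^ Suc k" for k t
      using tooth_bounds[of "3 ^ (2 * k + i) * t"] by (simp add: abs_mult mult_left_le)
    show "summable (\<lambda>k. (1/2 :: real) ^ Suc k)" using summable_geometric[of "1/2 :: real"] by (simp add: summable_mult)
  qed
  moreover have "continuous_on UNIV (\<lambda>t. \<Sum>k<n. (1/2) ^ Suc k * tooth (3 ^ (2 * k + i) * t))" for n
    by (intro continuous_intros continuous_on_tooth)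
  ultimately have "continuous_on UNIV (\<lambda>t. \<Sum>k. (1/2) ^ Suc k * tooth (3 ^ (2 * k + i) * t))"
    by (intro uniform_limit_theorem[of _ "\<lambda>n t. \<Sum>k<n. (1/2) ^ Suc k * tooth (3 ^ (2 * k + i) * t)"]) auto
  then show ?thesis unfolding schoenberg_def .
qed

lemma schoenberg_surj:
  assumes x: "0 \<le> x" "x < 1" and y: "0 \<le> y" "y < 1"
  shows "\<exists>t. 0 \<le> t \<and> t \<le> 1 \<and> schoenberg 0 t = x \<and> schoenberg 1 t = y"
proof -
  define a where "a j = (if even j then digit x (j div 2) else digit y (j div 2))" for j
  have a: "a j \<in> {0, 1}" for j unfolding a_def using digit_range by auto
  have "schoenberg 0 (ternary a) = x"
    unfolding schoenberg_def using sums_unique[OF sums_digit[OF x]]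
    by (simp only: tooth_ternary[OF a]) (simp add: a_def mult.commute)
  moreover have "schoenberg 1 (ternary a) = y"
    unfolding schoenberg_def using sums_unique[OF sums_digit[OF y]]
    by (simp only: tooth_ternary[OF a]) (simp add: a_def mult.commute)
  ultimately show ?thesis using ternary_bounds[of a] a by blast
qed

section \<open>Probability measures on the torus and their moments\<close>

lemma torus2_iff: "s \<in> torus2 \<longleftrightarrow> norm (fst s) = 1 \<and> norm (snd s) = 1"
  by (cases s) (simp add: torus2_def)

lemma compact_torus2: "compact torus2"
  unfolding torus2_def by (intro compact_Times compact_sphere)

lemma PT2_AE: "PT2 \<mu> \<Longrightarrow> AE s in \<mu>. s \<in> torus2"
proof -
  assume p: "PT2 \<mu>"
  then interpret prob_space \<mu> by (simp add: PT2_def)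
  have "emeasure \<mu> torus2 = 1" using p by (simp add: PT2_def)
  moreover have "torus2 \<in> sets \<mu>" using p borel_closed[OF compact_imp_closed[OF compact_torus2]] by (simp add: PT2_def)
  ultimately show ?thesis by (simp add: AE_in_set_eq_1 emeasure_eq_measure)
qed

lemma PT2_AE_I: "PT2 \<mu> \<Longrightarrow> (\<And>s. s \<in> torus2 \<Longrightarrow> P s) \<Longrightarrow> AE s in \<mu>. P s"
  using PT2_AE by (rule eventually_mono)

lemma borel_measurable_powi [measurable]: "(\<lambda>z::complex. z powi p) \<in> borel_measurable borel"
proof (cases "p \<ge> 0")
  case True
  then have "(\<lambda>z::complex. z powi p) = (\<lambda>z. z ^ nat p)" by (simp add: power_int_def)
  then show ?thesis by simp
next
  case False
  then have "(\<lambda>z::complex. z powi p) = (\<lambda>z. inverse z ^ nat (- p))" by (simp add: power_int_def)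
  then show ?thesis by simp
qed

definition mono2 :: "int \<Rightarrow> int \<Rightarrow> complex \<times> complex \<Rightarrow> complex" where
  "mono2 p q s = fst s powi p * snd s powi q"

lemma mono2_measurable: "mono2 p q \<in> borel_measurable borel"
  unfolding mono2_def
  by (intro borel_measurable_times measurable_compose[OF _ borel_measurable_powi] borel_measurable_continuous_onI continuous_intros)

lemma norm_mono2: "s \<in> torus2 \<Longrightarrow> norm (mono2 p q s) = 1"
  by (simp add: mono2_def torus2_iff norm_mult norm_power_int)

lemma mono2_mult: "s \<in> torus2 \<Longrightarrow> mono2 p q s * mono2 p' q' s = mono2 (p + p') (q + q') s"
proof -
  assume "s \<in> torus2"
  then have "fst s \<noteq> 0" "snd s \<noteq> 0" by (auto simp: torus2_iff)
  then show ?thesis by (simp add: mono2_def power_int_add mult_ac)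
qed

lemma integrable_torus:
  assumes \<mu>: "PT2 \<mu>" and f: "f \<in> borel_measurable borel" and B: "\<And>s. s \<in> torus2 \<Longrightarrow> norm (f s) \<le> B"
  shows "integrable \<mu> (f :: _ \<Rightarrow> 'a :: {banach, second_countable_topology})"
proof -
  interpret prob_space \<mu> using \<mu> by (simp add: PT2_def)
  have "f \<in> borel_measurable \<mu>" using f \<mu> by (simp add: PT2_def cong: measurable_cong_sets)
  then show ?thesis using B by (intro integrable_const_bound[where B = B] PT2_AE_I[OF \<mu>])
qed

lemma integrable_mono2: "PT2 \<mu> \<Longrightarrow> integrable \<mu> (mono2 p q)"
  by (rule integrable_torus[OF _ mono2_measurable, where B = 1]) (simp_all add: norm_mono2)

lemma mom_mono2: "mom \<mu> p q = (\<integral>s. mono2 p q s \<partial>\<mu>)" by (simp add: mom_def mono2_def)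

text \<open>Trigonometric polynomials. Products are treated by a lemma about the torus only, where
  exponents add.\<close>

inductive trig :: "(complex \<times> complex \<Rightarrow> complex) \<Rightarrow> bool" where
  mono: "trig (\<lambda>s. c * mono2 p q s)"
| add: "trig f \<Longrightarrow> trig g \<Longrightarrow> trig (\<lambda>s. f s + g s)"

lemma trig_mult_mono: "trig f \<Longrightarrow> \<exists>h. trig h \<and> (\<forall>s\<in>torus2. f s * (c * mono2 p q s) = h s)"
proof (induction rule: trig.induct)
  case (mono d p' q')
  have "trig (\<lambda>s. (d * c) * mono2 (p' + p) (q' + q) s)" by (rule trig.mono)
  moreover have "\<forall>s\<in>torus2. d * mono2 p' q' s * (c * mono2 p q s) = (d * c) * mono2 (p' + p) (q' + q) s"
    by (simp add: mono2_mult[symmetric] mult_ac)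
  ultimately show ?case by blast
next
  case (add f g)
  then obtain h k where "trig h" "\<forall>s\<in>torus2. f s * (c * mono2 p q s) = h s"
    "trig k" "\<forall>s\<in>torus2. g s * (c * mono2 p q s) = k s" by blast
  then show ?case by (intro exI[of _ "\<lambda>s. h s + k s"]) (simp add: trig.add distrib_right)
qed

lemma trig_mult: "trig g \<Longrightarrow> trig f \<Longrightarrow> \<exists>h. trig h \<and> (\<forall>s\<in>torus2. f s * g s = h s)"
proof (induction rule: trig.induct)
  case (mono c p q)
  then show ?case by (rule trig_mult_mono)
next
  case (add g g')
  then obtain h k where "trig h" "\<forall>s\<in>torus2. f s * g s = h s" "trig k" "\<forall>s\<in>torus2. f s * g' s = k s" by blast
  then show ?case by (intro exI[of _ "\<lambda>s. h s + k s"]) (simp add: trig.add distrib_left)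
qed

text \<open>On the unit circle 1/z is the conjugate of z, so real and imaginary parts of the
  coordinates are trigonometric polynomials. This connects Stone-Weierstrass for real polynomials
  with the moments.\<close>

lemma real_polynomial_trig:
  "real_polynomial_function f \<Longrightarrow> \<exists>h. trig h \<and> (\<forall>s\<in>torus2. complex_of_real (f s) = h s)"
proof (induction rule: real_polynomial_function.induct)
  case (linear f)
  interpret bounded_linear f by fact
  define a b c d where "a = f (1, 0)" "b = f (\<i>, 0)" "c = f (0, 1)" "d = f (0, \<i>)"
  have f: "f s = a * Re (fst s) + b * Im (fst s) + c * Re (snd s) + d * Im (snd s)" for s
  proof -
    have "s = Re (fst s) *\<^sub>R (1, 0) + Im (fst s) *\<^sub>R (\<i>, 0) + Re (snd s) *\<^sub>R (0, 1) + Im (snd s) *\<^sub>R (0, \<i>)"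
      by (cases s) (simp add: complex_eq_iff)
    then have "f s = f (Re (fst s) *\<^sub>R (1, 0) + Im (fst s) *\<^sub>R (\<i>, 0) + Re (snd s) *\<^sub>R (0, 1) + Im (snd s) *\<^sub>R (0, \<i>))"
      by simp
    then show ?thesis by (simp only: add scaleR a_b_c_d_def) simp
  qed
  let ?h = "\<lambda>s. ((of_real a - \<i> * of_real b) / 2 * mono2 1 0 s + (of_real a + \<i> * of_real b) / 2 * mono2 (-1) 0 s) +
      ((of_real c - \<i> * of_real d) / 2 * mono2 0 1 s + (of_real c + \<i> * of_real d) / 2 * mono2 0 (-1) s)"
  have ri: "complex_of_real x * of_real (Re z) + of_real y * of_real (Im z) =
      (of_real x - \<i> * of_real y) / 2 * z + (of_real x + \<i> * of_real y) / 2 * inverse z" if "norm z = 1" for x y z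
  proof -
    have "z * cnj z = 1" using that complex_norm_square[of z] by simp
    then have "inverse z = cnj z" by (metis inverse_unique)
    then show ?thesis by (simp add: complex_eq_iff algebra_simps add_divide_distrib diff_divide_distrib)
  qed
  have "trig ?h" by (intro trig.intros)
  moreover have "complex_of_real (f s) = ?h s" if "s \<in> torus2" for s
  proof -
    have "complex_of_real (f s) = (of_real a * of_real (Re (fst s)) + of_real b * of_real (Im (fst s))) +
       (of_real c * of_real (Re (snd s)) + of_real d * of_real (Im (snd s)))" by (simp add: f)
    also have "\<dots> = ?h s" using that by (subst (1 2) ri) (simp_all add: torus2_iff mono2_def power_int_minus)
    finally show ?thesis .
  qed
  ultimately show ?case by blast
next
  case (const c)
  have "trig (\<lambda>s. of_real c * mono2 0 0 s)" by (rule trig.mono)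
  then show ?case by (intro exI[of _ "\<lambda>s. of_real c * mono2 0 0 s"]) (simp add: mono2_def)
next
  case (add f g)
  then obtain h k where "trig h" "\<forall>s\<in>torus2. complex_of_real (f s) = h s"
    "trig k" "\<forall>s\<in>torus2. complex_of_real (g s) = k s" by blast
  then show ?case by (intro exI[of _ "\<lambda>s. h s + k s"]) (simp add: trig.add)
next
  case (mult f g)
  then obtain h k where hk: "trig h" "\<forall>s\<in>torus2. complex_of_real (f s) = h s"
    "trig k" "\<forall>s\<in>torus2. complex_of_real (g s) = k s" by blast
  from trig_mult[OF hk(3,1)] obtain l where "trig l" "\<forall>s\<in>torus2. h s * k s = l s" by blast
  then show ?case using hk by (intro exI[of _ l]) simp
qed

lemma trig_integral:
  assumes "PT2 \<mu>" "PT2 \<nu>" "\<And>p q. mom \<mu> p q = mom \<nu> p q"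
  shows "trig h \<Longrightarrow> integrable \<mu> h \<and> integrable \<nu> h \<and> (\<integral>s. h s \<partial>\<mu>) = (\<integral>s. h s \<partial>\<nu>)"
proof (induction rule: trig.induct)
  case (mono c p q)
  then show ?case using assms integrable_mono2 by (simp add: mom_mono2)
qed auto

lemma measurable_PT2: "PT2 \<mu> \<Longrightarrow> borel_measurable \<mu> = borel_measurable borel"
  by (rule measurable_cong_sets) (simp_all add: PT2_def)

lemma polynomial_integral:
  assumes \<mu>: "PT2 \<mu>" "PT2 \<nu>" "\<And>p q. mom \<mu> p q = mom \<nu> p q" and f: "real_polynomial_function f"
  shows "(\<integral>s. f s \<partial>\<mu>) = (\<integral>s. f s \<partial>\<nu>)"
proof -
  obtain h where h: "trig h" "\<forall>s\<in>torus2. complex_of_real (f s) = h s" using real_polynomial_trig[OF f] by blast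
  note hi = trig_integral[OF \<mu> h(1)]
  have fm: "f \<in> borel_measurable borel"
    using f by (intro borel_measurable_continuous_onI continuous_on_polymonial_function) (simp add: real_polynomial_function_eq)
  have "complex_of_real (\<integral>s. f s \<partial>m) = (\<integral>s. h s \<partial>m)" if m: "PT2 m" "integrable m h" for m
  proof -
    have "complex_of_real (\<integral>s. f s \<partial>m) = (\<integral>s. complex_of_real (f s) \<partial>m)" by simp
    moreover have "h \<in> borel_measurable borel"
      using borel_measurable_integrable[OF m(2)] by (simp add: measurable_PT2[OF m(1)])
    then have "(\<integral>s. complex_of_real (f s) \<partial>m) = (\<integral>s. h s \<partial>m)"
      using fm m h(2) by (intro integral_cong_AE PT2_AE_I[OF m(1)]) (simp_all add: measurable_PT2)
    ultimately show ?thesis by simp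
  qed
  then have "complex_of_real (\<integral>s. f s \<partial>\<mu>) = complex_of_real (\<integral>s. f s \<partial>\<nu>)" using hi \<mu> by metis
  then show ?thesis using of_real_eq_iff by blast
qed

lemma continuous_integral:
  assumes \<mu>: "PT2 \<mu>" "PT2 \<nu>" "\<And>p q. mom \<mu> p q = mom \<nu> p q" and f: "continuous_on UNIV f"
  shows "(\<integral>s. f s \<partial>\<mu>) = (\<integral>s. (f s :: real) \<partial>\<nu>)"
proof (rule ccontr)
  assume ne: "(\<integral>s. f s \<partial>\<mu>) \<noteq> (\<integral>s. f s \<partial>\<nu>)"
  \<comment> \<open>The gap is 2 e, whereas a polynomial within e/2 of \<open>f\<close> on the torus
    allows at most e/2 + e/2.\<close>
  define e where "e = \<bar>(\<integral>s. f s \<partial>\<mu>) - (\<integral>s. f s \<partial>\<nu>)\<bar> / 2"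
  have e: "e > 0" using ne by (simp add: e_def)
  obtain g where g: "real_polynomial_function g" "\<And>s. s \<in> torus2 \<Longrightarrow> \<bar>f s - g s\<bar> < e/2"
    using Stone_Weierstrass_real_polynomial_function[OF compact_torus2 continuous_on_subset[OF f subset_UNIV], of "e/2"] e
    by auto
  have fm: "f \<in> borel_measurable borel" using f by (rule borel_measurable_continuous_onI)
  have gc: "continuous_on UNIV g"
    using g by (intro continuous_on_polymonial_function) (simp add: real_polynomial_function_eq)
  have gm: "g \<in> borel_measurable borel" using gc by (rule borel_measurable_continuous_onI)
  have bd: "\<exists>B. \<forall>s\<in>torus2. norm (k s) \<le> B" if "continuous_on UNIV k" for k :: "complex \<times> complex \<Rightarrow> real"
    using compact_imp_bounded[OF compact_continuous_image[OF continuous_on_subset[OF that subset_UNIV] compact_torus2]]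
    by (auto simp: bounded_iff)
  have "\<bar>(\<integral>s. f s \<partial>m) - (\<integral>s. g s \<partial>m)\<bar> \<le> e/2" if m: "PT2 m" for m
  proof -
    interpret prob_space m using m by (simp add: PT2_def)
    have i: "integrable m f" "integrable m g"
      using bd[OF f] bd[OF gc] integrable_torus[OF m fm] integrable_torus[OF m gm] by blast+
    have "\<bar>\<integral>s. f s - g s \<partial>m\<bar> \<le> (\<integral>s. \<bar>f s - g s\<bar> \<partial>m)" using integral_norm_bound[of m "\<lambda>s. f s - g s"] by simp
    also have "\<dots> \<le> (\<integral>s. e/2 \<partial>m)"
      using i g(2) by (intro integral_mono_AE PT2_AE_I[OF m]) (simp_all add: less_imp_le)
    finally show ?thesis using i by (simp add: prob_space)
  qed
  from this[OF \<mu>(1)] this[OF \<mu>(2)] polynomial_integral[OF \<mu> g(1)] e show False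
    unfolding e_def by (simp add: abs_if split: if_splits)
qed

text \<open>Closed sets form a generator stable under intersection, and their indicators are
  decreasing limits of continuous functions, whose integrals are fixed by the moments.\<close>

lemma PT2_eqI:
  assumes \<mu>: "PT2 \<mu>" "PT2 \<nu>" "\<And>p q. mom \<mu> p q = mom \<nu> p q"
  shows "\<mu> = \<nu>"
proof (rule measure_eqI_generator_eq[of "Collect closed" UNIV _ _ "\<lambda>_. UNIV"])
  show "Int_stable (Collect closed :: (complex \<times> complex) set set)" by (auto simp: Int_stable_def)
  have sb: "sets borel = sigma_sets UNIV (Collect closed :: (complex \<times> complex) set set)"
    by (subst borel_eq_closed) (simp add: sets_measure_of)
  show "sets \<mu> = sigma_sets UNIV (Collect closed)" "sets \<nu> = sigma_sets UNIV (Collect closed)"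
    using \<mu> sb by (auto simp: PT2_def)
  interpret m: prob_space \<mu> using \<mu> by (simp add: PT2_def)
  interpret n: prob_space \<nu> using \<mu> by (simp add: PT2_def)
  show "emeasure \<mu> UNIV \<noteq> \<infinity>" by simp
  fix C :: "(complex \<times> complex) set" assume "C \<in> Collect closed"
  then have C: "closed C" by simp
  show "emeasure \<mu> C = emeasure \<nu> C"
  proof (cases "C = {}")
    case False
    define f where "f k s = max 0 (1 - real k * infdist s C)" for k and s :: "complex \<times> complex"
    have fc: "continuous_on UNIV (f k)" for k unfolding f_def by (intro continuous_intros)
    have fm: "f k \<in> borel_measurable borel" for k using fc by (rule borel_measurable_continuous_onI)
    have fb: "norm (f k s) \<le> 1" for k s unfolding f_def using infdist_nonneg[of s C] by (auto simp: max_def)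
    have lim: "(\<lambda>k. f k s) \<longlonglongrightarrow> indicator C s" for s
    proof (cases "s \<in> C")
      case True
      then show ?thesis by (simp add: f_def)
    next
      case sC: False
      then have pos: "infdist s C > 0" using C False by (simp add: infdist_pos_not_in_closed)
      obtain N :: nat where N: "1 / infdist s C < N" using reals_Archimedean2 by blast
      have "f k s = 0" if "k \<ge> N" for k
      proof -
        have "1 / infdist s C < k" using N that by (meson less_le_trans of_nat_le_iff)
        then have "1 < k * infdist s C" using pos by (simp add: field_simps)
        then show ?thesis by (simp add: f_def)
      qed
      then have "\<forall>\<^sub>F k in sequentially. f k s = indicator C s"
        using sC by (auto simp: eventually_sequentially)
      then show ?thesis by (rule tendsto_eventually)
    qed
    have L: "(\<lambda>k. \<integral>s. f k s \<partial>m) \<longlonglongrightarrow> measure m C" if m: "PT2 m" for m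
    proof -
      interpret prob_space m using m by (simp add: PT2_def)
      have Cm: "C \<in> sets m" using C m by (simp add: PT2_def)
      have "(\<lambda>k. \<integral>s. f k s \<partial>m) \<longlonglongrightarrow> (\<integral>s. indicator C s \<partial>m)"
        by (rule integral_dominated_convergence[where w = "\<lambda>_. 1"])
          (use fm fb lim borel_closed[OF C] m in \<open>auto simp: measurable_PT2\<close>)
      then show ?thesis using Cm by simp
    qed
    have "measure \<mu> C = measure \<nu> C"
      using L[OF \<mu>(1)] L[OF \<mu>(2)] continuous_integral[OF \<mu> fc] LIMSEQ_unique by auto
    then show ?thesis by (simp add: m.emeasure_eq_measure n.emeasure_eq_measure)
  qed simp
qed auto

section \<open>Herglotz's theorem on the two-dimensional torus\<close>

lemma sum_roots_of_unity:
  fixes N :: nat and m :: int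
  assumes N: "N > 0" and m: "\<bar>m\<bar> < int N"
  shows "(\<Sum>j<N. cis (2 * pi * (real j * of_int m / N))) = (if m = 0 then of_nat N else 0)"
proof (cases "m = 0")
  case False
  define z where "z = cis (2 * pi * (of_int m / N))"
  have "(\<Sum>j<N. cis (2 * pi * (real j * of_int m / N))) = (\<Sum>j<N. z ^ j)"
    by (intro sum.cong refl) (simp add: z_def Complex.DeMoivre mult_ac)
  moreover have "z ^ N = 1"
  proof -
    have "z ^ N = cis (2 * pi * of_int m)" using N by (simp add: z_def Complex.DeMoivre)
    then show ?thesis by simp
  qed
  moreover have "z \<noteq> 1"
  proof
    assume "z = 1"
    then have "cos (2 * pi * (of_int m / N)) = 1" by (simp add: z_def complex_eq_iff)
    then obtain k :: int where k: "2 * pi * (of_int m / N) = of_int k * 2 * pi"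
      unfolding cos_one_2pi_int by blast
    then have "(2 * pi) * (of_int m / real N) = (2 * pi) * of_int k" by (simp only: mult_ac)
    then have "of_int m / real N = of_int k" unfolding mult_cancel_left by simp
    then have "real_of_int m = of_int (k * int N)" using N by (simp add: field_simps)
    then have "m = k * int N" by (simp only: of_int_eq_iff)
    then have "k \<noteq> 0" "\<bar>m\<bar> = \<bar>k\<bar> * int N" using False by (auto simp: abs_mult)
    moreover have "1 * int N \<le> \<bar>k\<bar> * int N" using \<open>k \<noteq> 0\<close> by (intro mult_right_mono) auto
    ultimately show False using m by simp
  qed
  ultimately show ?thesis using False by (simp add: geometric_sum)
qed simp

lemma card_diff_eq:
  assumes "\<bar>p\<bar> \<le> int n"
  shows "card {(a, b). a \<in> {0..<int n} \<and> b \<in> {0..<int n} \<and> a - b = p} = nat (int n - \<bar>p\<bar>)"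
proof -
  have "bij_betw (\<lambda>a. (a, a - p)) {max 0 p..<min (int n) (int n + p)}
     {(a, b). a \<in> {0..<int n} \<and> b \<in> {0..<int n} \<and> a - b = p}"
    by (rule bij_betw_byWitness[where f' = fst]) auto
  from bij_betw_same_card[OF this, symmetric] show ?thesis using assms by (auto simp: min_def max_def)
qed

lemma sum_diff_indicator:
  assumes "\<bar>p\<bar> \<le> int n"
  shows "(\<Sum>a\<in>{0..<int n}. \<Sum>b\<in>{0..<int n}. if a - b = p then c else 0) = of_int (int n - \<bar>p\<bar>) * (c :: complex)"
proof -
  have "(\<Sum>a\<in>{0..<int n}. \<Sum>b\<in>{0..<int n}. if a - b = p then c else 0) =
     (\<Sum>x\<in>{0..<int n} \<times> {0..<int n}. if fst x - snd x = p then c else 0)"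
    by (simp add: sum.cartesian_product case_prod_unfold)
  also have "\<dots> = (\<Sum>x\<in>{x \<in> {0..<int n} \<times> {0..<int n}. fst x - snd x = p}. c)"
    by (rule sum.inter_filter[symmetric]) simp
  also have "{x \<in> {0..<int n} \<times> {0..<int n}. fst x - snd x = p} =
     {(a, b). a \<in> {0..<int n} \<and> b \<in> {0..<int n} \<and> a - b = p}" by auto
  also have "(\<Sum>x\<in>\<dots>. c) = of_nat (nat (int n - \<bar>p\<bar>)) * c"
    using card_diff_eq[OF assms] by simp
  finally show ?thesis using assms by simp
qed

lemma sum_prod_mult:
  "(\<Sum>x\<in>A \<times> B. g (fst x) * h (snd x)) = sum g A * (sum h B :: complex)"
  by (simp add: sum_product sum.cartesian_product case_prod_unfold)

section \<open>Fejer weights on a finite grid\<close>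

locale herglotz =
  fixes f :: "int \<Rightarrow> int \<Rightarrow> complex"
  assumes psd: "\<And>(I :: (int \<times> int) set) c. finite I \<Longrightarrow>
      (\<Sum>a\<in>I. \<Sum>b\<in>I. c a * cnj (c b) * f (fst a - fst b) (snd a - snd b)) \<in> \<real>\<^sub>\<ge>\<^sub>0"
    and f0: "f 0 0 = 1"
begin

text \<open>The positive definite form evaluated on the character of the grid point
  \<open>j\<close>. Up to normalisation this is a Fejer mean of the Fourier series with coefficients
  \<open>f\<close>, so its nonnegativity is the hypothesis \<open>psd\<close>.\<close>

definition wtsum :: "nat \<Rightarrow> nat \<times> nat \<Rightarrow> complex" where
  "wtsum n j = (\<Sum>a\<in>{0..<int n} \<times> {0..<int n}. \<Sum>b\<in>{0..<int n} \<times> {0..<int n}.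
      cis (- 2 * pi * ((real (fst j) * of_int (fst a) + real (snd j) * of_int (snd a)) / (2 * n))) *
      cnj (cis (- 2 * pi * ((real (fst j) * of_int (fst b) + real (snd j) * of_int (snd b)) / (2 * n)))) *
      f (fst a - fst b) (snd a - snd b))"

text \<open>The grid has 2n points per coordinate although only n characters enter: then
  \<open>p - (a - b)\<close> stays below 2n in modulus for |p| up to n, and grid sums detect p = a -
  b without aliasing. The denominator combines the (2n)^2 grid points with the n^2 of the Fejer
  mean.\<close>

definition wt :: "nat \<Rightarrow> nat \<times> nat \<Rightarrow> complex" where
  "wt n j = wtsum n j / (2 * of_nat n * of_nat n)\<^sup>2"

lemma wt_nonneg: "wt n j \<in> \<real>\<^sub>\<ge>\<^sub>0"
proof -
  have "((2 * of_nat n * of_nat n)\<^sup>2 :: complex) = of_real ((2 * real n * real n)\<^sup>2)" by simp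
  moreover have "of_real ((2 * real n * real n)\<^sup>2) \<in> (\<real>\<^sub>\<ge>\<^sub>0 :: complex set)"
    by (simp only: nonneg_Reals_of_real_iff) simp
  ultimately show ?thesis
    unfolding wt_def wtsum_def by (intro nonneg_Reals_divide_I psd) simp_all
qed

text \<open>Orthogonality on the grid keeps the pairs a, b with a - b = (p, q); there are (n - |p|)
  (n - |q|) of them, which gives the Fejer factors.\<close>

lemma wt_moment:
  assumes n: "n > 0" and pq: "\<bar>p\<bar> \<le> int n" "\<bar>q\<bar> \<le> int n"
  shows "(\<Sum>j\<in>{..<2*n} \<times> {..<2*n}. wt n j *
      (cis (2 * pi * (real (fst j) * of_int p / (2 * n))) * cis (2 * pi * (real (snd j) * of_int q / (2 * n))))) =
    (1 - of_int \<bar>p\<bar> / of_nat n) * (1 - of_int \<bar>q\<bar> / of_nat n) * f p q"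
proof -
  let ?I = "{0..<int n}" and ?N = "2 * n"
  let ?c = "\<lambda>x m. cis (2 * pi * (real x * of_int m / (2 * n)))"
  let ?J = "{..<?N} \<times> {..<?N}"
  let ?F = "\<lambda>j a b. f (fst a - fst b) (snd a - snd b) * (?c (fst j) (p - (fst a - fst b)) * ?c (snd j) (q - (snd a - snd b)))"
  have aux: "a * b * z * c = z * r" if "a * b * c = r" for a b c r z :: complex
    unfolding that[symmetric] by (simp only: mult_ac)
  have E: "cis (- 2 * pi * ((real x * of_int a + real y * of_int a') / (2 * n))) *
      cnj (cis (- 2 * pi * ((real x * of_int b + real y * of_int b') / (2 * n)))) * z * (?c x p * ?c y q)
      = z * (?c x (p - (a - b)) * ?c y (q - (a' - b')))" for x y a a' b b' z
  proof -
    have "cis (- 2 * pi * ((real x * of_int a + real y * of_int a') / (2 * n))) *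
      cnj (cis (- 2 * pi * ((real x * of_int b + real y * of_int b') / (2 * n)))) * (?c x p * ?c y q) =
      ?c x (p - (a - b)) * ?c y (q - (a' - b'))"
      unfolding cis_cnj cis_mult
      by (rule arg_cong[where f = cis]) (use n in \<open>simp add: field_simps\<close>)
    then show ?thesis by (rule aux)
  qed
  have orth: "(\<Sum>j\<in>{..<?N}. ?c j (p - (a - b))) = (if a - b = p then of_nat ?N else 0)"
    if "a \<in> ?I" "b \<in> ?I" "\<bar>p\<bar> \<le> int n" for a b p
    using sum_roots_of_unity[of ?N "p - (a - b)"] that n by auto
  have "(\<Sum>j\<in>?J. wt n j * (?c (fst j) p * ?c (snd j) q)) * (2 * of_nat n * of_nat n)\<^sup>2 =
     (\<Sum>j\<in>?J. \<Sum>a\<in>?I \<times> ?I. \<Sum>b\<in>?I \<times> ?I.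
        ?F j a b)"
  proof -
    have "wt n j * c * (2 * of_nat n * of_nat n)\<^sup>2 = wtsum n j * c" for j c
      using n by (simp add: wt_def)
    then have "(\<Sum>j\<in>?J. wt n j * (?c (fst j) p * ?c (snd j) q)) * (2 * of_nat n * of_nat n)\<^sup>2 =
      (\<Sum>j\<in>?J. wtsum n j * (?c (fst j) p * ?c (snd j) q))"
      by (simp only: sum_distrib_right)
    also have "\<dots> = (\<Sum>j\<in>?J. \<Sum>a\<in>?I \<times> ?I. \<Sum>b\<in>?I \<times> ?I.
        ?F j a b)"
      unfolding wtsum_def sum_distrib_right by (intro sum.cong refl E)
    finally show ?thesis .
  qed
  also have "\<dots> = (\<Sum>a\<in>?I \<times> ?I. \<Sum>b\<in>?I \<times> ?I. \<Sum>j\<in>?J. ?F j a b)"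
    (is "sum ?g1 _ = _")
  proof -
    have "sum ?g1 ?J = (\<Sum>a\<in>?I \<times> ?I. \<Sum>j\<in>?J. \<Sum>b\<in>?I \<times> ?I.
        ?F j a b)"
      by (rule sum.swap)
    also have "\<dots> = (\<Sum>a\<in>?I \<times> ?I. \<Sum>b\<in>?I \<times> ?I. \<Sum>j\<in>?J. ?F j a b)"
      by (rule sum.cong[OF refl], rule sum.swap)
    finally show ?thesis .
  qed
  also have "\<dots> = (\<Sum>a\<in>?I \<times> ?I. \<Sum>b\<in>?I \<times> ?I. f p q * (of_nat ?N)\<^sup>2 *
       ((if fst a - fst b = p then 1 else 0) * (if snd a - snd b = q then 1 else 0)))"
  proof (intro sum.cong refl)
    fix a b assume ab: "a \<in> ?I \<times> ?I" "b \<in> ?I \<times> ?I"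
    have "(\<Sum>j\<in>?J. ?F j a b)
       = f (fst a - fst b) (snd a - snd b) * ((\<Sum>j\<in>{..<?N}. ?c j (p - (fst a - fst b))) * (\<Sum>k\<in>{..<?N}. ?c k (q - (snd a - snd b))))"
      unfolding sum_distrib_left[symmetric]
      by (rule arg_cong[where f = "times _"])
        (rule sum_prod_mult[of "\<lambda>j. ?c j (p - (fst a - fst b))" "\<lambda>k. ?c k (q - (snd a - snd b))"])
    also have "\<dots> = f (fst a - fst b) (snd a - snd b) * ((if fst a - fst b = p then of_nat ?N else 0) * (if snd a - snd b = q then of_nat ?N else 0))"
      using ab pq by (subst (1 2) orth) auto
    also have "\<dots> = f p q * (of_nat ?N)\<^sup>2 * ((if fst a - fst b = p then 1 else 0) * (if snd a - snd b = q then 1 else 0))"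
      by (simp add: power2_eq_square)
    finally show "(\<Sum>j\<in>?J. ?F j a b)
       = f p q * (of_nat ?N)\<^sup>2 * ((if fst a - fst b = p then 1 else 0) * (if snd a - snd b = q then 1 else 0))" .
  qed
  also have "\<dots> = f p q * (of_nat ?N)\<^sup>2 * ((\<Sum>a\<in>?I. \<Sum>b\<in>?I. if a - b = p then 1 else 0) * (\<Sum>a\<in>?I. \<Sum>b\<in>?I. if a - b = q then 1 else 0))"
  proof -
    have "(\<Sum>a\<in>?I \<times> ?I. \<Sum>b\<in>?I \<times> ?I. u (fst a) (fst b) * v (snd a) (snd b)) =
        (\<Sum>a\<in>?I. \<Sum>b\<in>?I. u a b) * (\<Sum>a\<in>?I. \<Sum>b\<in>?I. v a b)" for u v :: "int \<Rightarrow> int \<Rightarrow> complex"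
    proof -
      have "(\<Sum>a\<in>?I \<times> ?I. \<Sum>b\<in>?I \<times> ?I. u (fst a) (fst b) * v (snd a) (snd b)) =
          (\<Sum>a\<in>?I \<times> ?I. (\<Sum>b\<in>?I. u (fst a) b) * (\<Sum>b\<in>?I. v (snd a) b))"
        by (intro sum.cong refl sum_prod_mult)
      also have "\<dots> = (\<Sum>a\<in>?I. \<Sum>b\<in>?I. u a b) * (\<Sum>a\<in>?I. \<Sum>b\<in>?I. v a b)"
        by (rule sum_prod_mult[of "\<lambda>a. \<Sum>b\<in>?I. u a b" "\<lambda>a. \<Sum>b\<in>?I. v a b"])
      finally show ?thesis .
    qed
    from this[of "\<lambda>a b. if a - b = p then 1 else 0" "\<lambda>a b. if a - b = q then 1 else 0"]
    show ?thesis by (simp only: sum_distrib_left[symmetric])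
  qed
  also have "\<dots> = f p q * (of_nat ?N)\<^sup>2 * (of_int (int n - \<bar>p\<bar>) * of_int (int n - \<bar>q\<bar>))"
    using pq by (simp only: sum_diff_indicator mult_1_right)
  finally have "(\<Sum>j\<in>?J. wt n j * (?c (fst j) p * ?c (snd j) q)) * (2 * of_nat n * of_nat n)\<^sup>2 =
     f p q * (of_nat ?N)\<^sup>2 * (of_int (int n - \<bar>p\<bar>) * of_int (int n - \<bar>q\<bar>))" .
  then have "(\<Sum>j\<in>?J. wt n j * (?c (fst j) p * ?c (snd j) q)) =
     f p q * (of_nat ?N)\<^sup>2 * (of_int (int n - \<bar>p\<bar>) * of_int (int n - \<bar>q\<bar>)) / (2 * of_nat n * of_nat n)\<^sup>2"
    using n by (subst nonzero_eq_divide_eq) simp_all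
  also have "\<dots> = (1 - of_int \<bar>p\<bar> / of_nat n) * (1 - of_int \<bar>q\<bar> / of_nat n) * f p q"
    using n by (simp add: field_simps power2_eq_square)
  finally show ?thesis .
qed

definition W :: "nat \<Rightarrow> nat \<times> nat \<Rightarrow> real" where
  "W n j = (if j \<in> {..<2*n} \<times> {..<2*n} then Re (wt n j) else 0)"

lemma W_wt: "j \<in> {..<2*n} \<times> {..<2*n} \<Longrightarrow> complex_of_real (W n j) = wt n j"
  using wt_nonneg[of n j] by (auto simp: W_def complex_nonneg_Reals_iff complex_eq_iff)

lemma W_nonneg: "0 \<le> W n j" using wt_nonneg[of n j] by (simp add: W_def complex_nonneg_Reals_iff)

lemma sum_W: "n > 0 \<Longrightarrow> (\<Sum>j\<in>{..<2*n} \<times> {..<2*n}. W n j) = 1"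
proof -
  assume n: "n > 0"
  have "complex_of_real (\<Sum>j\<in>{..<2*n} \<times> {..<2*n}. W n j) = (\<Sum>j\<in>{..<2*n} \<times> {..<2*n}. wt n j)"
    by (simp add: W_wt)
  also have "\<dots> = 1" using wt_moment[OF n, of 0 0] by (simp add: f0)
  finally show ?thesis using of_real_eq_1_iff by blast
qed

section \<open>Transport of the grid measures to the line and passage to the limit\<close>

definition grid :: "nat \<Rightarrow> (nat \<times> nat) pmf" where "grid n = embed_pmf (W (Suc n))"

lemma pmf_grid: "pmf (grid n) j = W (Suc n) j"
  unfolding grid_def
proof (rule pmf_embed_pmf)
  let ?A = "{..<2 * Suc n} \<times> {..<2 * Suc n}"
  have "(\<integral>\<^sup>+x. ennreal (W (Suc n) x) \<partial>count_space UNIV) = (\<Sum>x\<in>?A. ennreal (W (Suc n) x))"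
    by (rule nn_integral_count_space'[of ?A]) (auto simp: W_def)
  also have "\<dots> = ennreal (\<Sum>x\<in>?A. W (Suc n) x)" by (rule sum_ennreal) (rule W_nonneg)
  also have "\<dots> = 1" by (subst sum_W) simp_all
  finally show "(\<integral>\<^sup>+x. ennreal (W (Suc n) x) \<partial>count_space UNIV) = 1" .
qed (rule W_nonneg)

text \<open>For a grid point, a parameter of Schoenberg's curve above it; its coordinates are below
  1, as \<open>schoenberg_surj\<close> requires.\<close>

definition preim :: "nat \<Rightarrow> nat \<times> nat \<Rightarrow> real" where
  "preim n j = (SOME t. 0 \<le> t \<and> t \<le> 1 \<and> schoenberg 0 t = real (fst j) / (2 * Suc n) \<and> schoenberg 1 t = real (snd j) / (2 * Suc n))"

lemma preim:
  assumes "j \<in> {..<2 * Suc n} \<times> {..<2 * Suc n}"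
  shows "0 \<le> preim n j" "preim n j \<le> 1" "schoenberg 0 (preim n j) = real (fst j) / (2 * Suc n)"
    "schoenberg 1 (preim n j) = real (snd j) / (2 * Suc n)"
proof -
  have l: "fst j < 2 * Suc n" "snd j < 2 * Suc n" using assms by auto
  have "real (fst j) / (2 * Suc n) < 1" "real (snd j) / (2 * Suc n) < 1"
    using l by (simp_all add: divide_less_eq del: mult_Suc_right of_nat_Suc)
  then have "\<exists>t. 0 \<le> t \<and> t \<le> 1 \<and> schoenberg 0 t = real (fst j) / (2 * Suc n) \<and> schoenberg 1 t = real (snd j) / (2 * Suc n)"
    by (intro schoenberg_surj) simp_all
  from someI_ex[OF this] show "0 \<le> preim n j" "preim n j \<le> 1" "schoenberg 0 (preim n j) = real (fst j) / (2 * Suc n)"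
    "schoenberg 1 (preim n j) = real (snd j) / (2 * Suc n)" unfolding preim_def by blast+
qed

definition approx :: "nat \<Rightarrow> real measure" where "approx n = distr (measure_pmf (grid n)) borel (preim n)"

lemma set_grid: "set_pmf (grid n) \<subseteq> {..<2 * Suc n} \<times> {..<2 * Suc n}"
  unfolding set_pmf_eq pmf_grid W_def by auto

lemma real_distribution_approx: "real_distribution (approx n)"
proof -
  have "prob_space (approx n)" unfolding approx_def by (rule measure_pmf.prob_space_distr) simp
  then show ?thesis by (simp add: real_distribution_def real_distribution_axioms_def approx_def)
qed

lemma tight_approx: "tight approx"
  unfolding tight_def
proof (intro conjI allI impI)
  fix e :: real assume e: "e > 0"
  \<comment> \<open>All parameters lie in [0, 1]; the left end -1 makes the half-open interval
    contain 0.\<close>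
  have "measure (approx n) {-1<..1} = 1" for n
  proof -
    have "measure (approx n) {-1<..1} = measure (measure_pmf (grid n)) (preim n -` {-1<..1})"
      unfolding approx_def by (subst measure_distr) simp_all
    also have "\<dots> = 1"
    proof (subst measure_pmf.prob_eq_1)
      show "AE x in measure_pmf (grid n). x \<in> preim n -` {-1<..1}"
        unfolding AE_measure_pmf_iff
      proof
        fix x assume "x \<in> set_pmf (grid n)"
        then have "x \<in> {..<2 * Suc n} \<times> {..<2 * Suc n}" using set_grid by blast
        from preim(1,2)[OF this] show "x \<in> preim n -` {-1<..1}" by simp
      qed
    qed simp
    finally show ?thesis .
  qed
  then show "\<exists>a b. a < b \<and> (\<forall>n. 1 - e < measure (approx n) {a<..b})"
    using e by (intro exI[of _ "-1"] exI[of _ 1]) simp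
qed (rule real_distribution_approx)

definition curve :: "real \<Rightarrow> complex \<times> complex" where
  "curve t = (cis (2 * pi * schoenberg 0 t), cis (2 * pi * schoenberg 1 t))"

lemma continuous_on_cis_schoenberg: "continuous_on UNIV (\<lambda>t. cis (2 * pi * (r * schoenberg i t)))"
proof -
  have "continuous_on UNIV (\<lambda>t. exp (\<i> * complex_of_real (2 * pi * (r * schoenberg i t))))"
    by (intro continuous_intros continuous_on_schoenberg)
  then show ?thesis by (simp add: cis_conv_exp)
qed

lemma continuous_on_curve: "continuous_on UNIV curve"
  unfolding curve_def using continuous_on_cis_schoenberg[of 1] by (intro continuous_on_Pair) simp_all

lemma mono2_curve: "mono2 p q (curve t) = cis (2 * pi * (of_int p * schoenberg 0 t)) * cis (2 * pi * (of_int q * schoenberg 1 t))"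
  by (simp add: mono2_def curve_def cis_power_int mult_ac)

lemma approx_moment:
  assumes pq: "\<bar>p\<bar> \<le> int (Suc n)" "\<bar>q\<bar> \<le> int (Suc n)"
  shows "(\<integral>t. mono2 p q (curve t) \<partial>approx n) = (1 - of_int \<bar>p\<bar> / of_nat (Suc n)) * (1 - of_int \<bar>q\<bar> / of_nat (Suc n)) * f p q"
proof -
  let ?A = "{..<2 * Suc n} \<times> {..<2 * Suc n}"
  have cm: "(\<lambda>t. mono2 p q (curve t)) \<in> borel_measurable borel"
    by (rule measurable_compose[OF _ mono2_measurable]) (rule borel_measurable_continuous_onI[OF continuous_on_curve])
  have "(\<integral>t. mono2 p q (curve t) \<partial>approx n) = (\<integral>j. mono2 p q (curve (preim n j)) \<partial>measure_pmf (grid n))"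
    unfolding approx_def by (rule integral_distr[OF _ cm]) simp
  also have "\<dots> = (\<Sum>j\<in>?A. pmf (grid n) j *\<^sub>R mono2 p q (curve (preim n j)))"
    by (rule integral_measure_pmf) (use set_grid in auto)
  also have "\<dots> = (\<Sum>j\<in>?A. wt (Suc n) j *
      (cis (2 * pi * (real (fst j) * of_int p / (2 * Suc n))) * cis (2 * pi * (real (snd j) * of_int q / (2 * Suc n)))))"
  proof (intro sum.cong refl)
    fix j assume j: "j \<in> ?A"
    show "pmf (grid n) j *\<^sub>R mono2 p q (curve (preim n j)) = wt (Suc n) j *
      (cis (2 * pi * (real (fst j) * of_int p / (2 * Suc n))) * cis (2 * pi * (real (snd j) * of_int q / (2 * Suc n))))"
      unfolding pmf_grid scaleR_conv_of_real W_wt[OF j] mono2_curve preim(3,4)[OF j]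
      by (simp only: times_divide_eq_right times_divide_eq_left mult_ac)
  qed
  also have "\<dots> = (1 - of_int \<bar>p\<bar> / of_nat (Suc n)) * (1 - of_int \<bar>q\<bar> / of_nat (Suc n)) * f p q"
    using wt_moment[of "Suc n" p q] pq by simp
  finally show ?thesis .
qed

text \<open>Helly's theorem gives a weak limit on the line, which \<open>curve\<close> carries to
  the torus. A monomial along the curve is a bounded continuous function of the parameter, so its
  integrals converge, while the Fejer factors tend to 1.\<close>

theorem herglotz: "\<exists>\<mu>. PT2 \<mu> \<and> (\<forall>p q. mom \<mu> p q = f p q)"
proof -
  obtain r L where r: "strict_mono r" and L: "real_distribution L" and wc: "weak_conv_m (approx \<circ> id \<circ> r) L"
    using tight_imp_convergent_subsubsequence[OF tight_approx, of id] by (auto simp: strict_mono_id strict_mono_def)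
  interpret L: real_distribution L by fact
  define \<mu> where "\<mu> = distr L borel curve"
  have cm: "curve \<in> borel_measurable borel" using continuous_on_curve by (rule borel_measurable_continuous_onI)
  then have cL: "curve \<in> measurable L borel" by (simp add: cong: measurable_cong_sets)
  have t: "curve t \<in> torus2" for t by (simp add: curve_def torus2_iff)
  have "prob_space \<mu>" unfolding \<mu>_def by (rule L.prob_space_distr[OF cL])
  moreover have "emeasure \<mu> torus2 = 1"
  proof -
    have "emeasure \<mu> torus2 = emeasure L (curve -` torus2 \<inter> space L)"
      unfolding \<mu>_def using cL borel_closed[OF compact_imp_closed[OF compact_torus2]] by (rule emeasure_distr)
    also have "curve -` torus2 \<inter> space L = space L" using t by auto
    finally show ?thesis using L.emeasure_space_1 by simp
  qed
  ultimately have P: "PT2 \<mu>" by (simp add: PT2_def \<mu>_def)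
  have "mom \<mu> p q = f p q" for p q
  proof -
    have "mom \<mu> p q = (\<integral>t. mono2 p q (curve t) \<partial>L)"
      unfolding mom_mono2 \<mu>_def by (rule integral_distr[OF cL mono2_measurable])
    moreover have "(\<lambda>n. \<integral>t. mono2 p q (curve t) \<partial>(approx \<circ> id \<circ> r) n) \<longlonglongrightarrow> (\<integral>t. mono2 p q (curve t) \<partial>L)"
    proof (rule weak_conv_imp_integral_bdd_continuous_conv)
      show "real_distribution ((approx \<circ> id \<circ> r) n)" for n using real_distribution_approx by simp
      show "weak_conv_m (approx \<circ> id \<circ> r) L" by fact
      have "continuous_on UNIV (\<lambda>t. mono2 p q (curve t))"
        unfolding mono2_curve by (intro continuous_intros continuous_on_cis_schoenberg)
      then show "isCont (\<lambda>t. mono2 p q (curve t)) x" for x by (simp add: continuous_on_eq_continuous_at)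
      show "norm (mono2 p q (curve x)) \<le> 1" for x using norm_mono2[OF t] by simp
    qed (rule L)
    moreover have "(\<lambda>n. \<integral>t. mono2 p q (curve t) \<partial>(approx \<circ> id \<circ> r) n) \<longlonglongrightarrow> f p q"
    proof -
      have inv: "(\<lambda>n. of_int k / of_nat (Suc n) :: complex) \<longlonglongrightarrow> 0" for k
      proof -
        have "(\<lambda>n. complex_of_real (of_int k * inverse (real (Suc n)))) \<longlonglongrightarrow> of_real (of_int k * 0)"
          by (intro tendsto_of_real tendsto_mult tendsto_const LIMSEQ_inverse_real_of_nat)
        then show ?thesis by (simp add: divide_inverse)
      qed
      have "(\<lambda>n. (1 - of_int \<bar>p\<bar> / of_nat (Suc n)) * (1 - of_int \<bar>q\<bar> / of_nat (Suc n)) * f p q) \<longlonglongrightarrow> (1 - 0) * (1 - 0) * f p q"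
        by (intro tendsto_mult tendsto_diff tendsto_const inv)
      then have "(\<lambda>n. (1 - of_int \<bar>p\<bar> / of_nat (Suc n)) * (1 - of_int \<bar>q\<bar> / of_nat (Suc n)) * f p q) \<longlonglongrightarrow> f p q"
        by simp
      from LIMSEQ_subseq_LIMSEQ[OF this r]
      have l: "(\<lambda>n. (1 - of_int \<bar>p\<bar> / of_nat (Suc (r n))) * (1 - of_int \<bar>q\<bar> / of_nat (Suc (r n))) * f p q) \<longlonglongrightarrow> f p q"
        by (simp add: o_def)
      show ?thesis
      proof (rule Lim_transform_eventually[OF l])
        show "\<forall>\<^sub>F n in sequentially. (1 - of_int \<bar>p\<bar> / of_nat (Suc (r n))) * (1 - of_int \<bar>q\<bar> / of_nat (Suc (r n))) * f p q =
            (\<integral>t. mono2 p q (curve t) \<partial>(approx \<circ> id \<circ> r) n)"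
          unfolding eventually_sequentially
        proof (intro exI[of _ "nat (max \<bar>p\<bar> \<bar>q\<bar>)"] allI impI)
          fix n assume "nat (max \<bar>p\<bar> \<bar>q\<bar>) \<le> n"
          then have "\<bar>p\<bar> \<le> int (Suc (r n))" "\<bar>q\<bar> \<le> int (Suc (r n))" using seq_suble[OF r, of n] by linarith+
          then show "(1 - of_int \<bar>p\<bar> / of_nat (Suc (r n))) * (1 - of_int \<bar>q\<bar> / of_nat (Suc (r n))) * f p q =
            (\<integral>t. mono2 p q (curve t) \<partial>(approx \<circ> id \<circ> r) n)" using approx_moment by simp
        qed
      qed
    qed
    ultimately show ?thesis using LIMSEQ_unique by metis
  qed
  then show ?thesis using P by blast
qed

end

section \<open>The bi-free convolution through the free product trace\<close>

lemma nths_rev: "nths (rev xs) A = rev (nths xs {j. j < length xs \<and> length xs - 1 - j \<in> A})"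
proof (induction xs)
  case (Cons x xs)
  let ?S = "{j. j < length (x # xs) \<and> length (x # xs) - 1 - j \<in> A}"
  have S: "{j. Suc j \<in> ?S} = {j. j < length xs \<and> length xs - 1 - j \<in> A}" by auto
  have "nths (rev (x # xs)) A = nths (rev xs) A @ (if length xs \<in> A then [x] else [])"
    by (simp add: nths_append)
  also have "\<dots> = rev (nths (x # xs) ?S)"
    unfolding nths_Cons S Cons.IH by simp
  finally show ?case .
qed simp

text \<open>The order in which a bi-non-crossing partition reads a word with all left letters first:
  left letters increasingly, then right letters decreasingly.\<close>

definition chi_pos :: "nat \<Rightarrow> nat \<Rightarrow> nat \<Rightarrow> nat" where
  "chi_pos a n i = (if i < a then i else a + n - 1 - i)"

lemma chi_pos_image:
  assumes "a \<le> n"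
  shows "chi_pos a n ` {..<n} = {..<n}"
proof (rule endo_inj_surj)
  show "chi_pos a n ` {..<n} \<subseteq> {..<n}" using assms by (auto simp: chi_pos_def)
  show "inj_on (chi_pos a n) {..<n}" using assms by (auto simp: chi_pos_def inj_on_def split: if_splits)
qed simp

text \<open>Composed with \<open>chi_pos\<close>, the bi-free order is strictly increasing in
  \<open>i\<close>: the right letters start above all left ones.\<close>

lemma bpos_chi_pos:
  assumes ls: "\<forall>x\<in>set ls. lft x" and rs: "\<forall>x\<in>set rs. \<not> lft x"
    and i: "i < length (ls @ rs)"
  shows "bpos (ls @ rs) (chi_pos (length ls) (length (ls @ rs)) i) =
    (if i < length ls then int i else int (length (ls @ rs)) + 1 + int i - int (length ls))"
proof (cases "i < length ls")
  case True
  then have "lft ((ls @ rs) ! i)" using ls by (simp add: nth_append)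
  then show ?thesis using True by (simp add: bpos_def chi_pos_def)
next
  case False
  define j where "j = length ls + length (ls @ rs) - 1 - i"
  have j: "length ls \<le> j" "j < length (ls @ rs)" using False i by (auto simp: j_def)
  then have "rs ! (j - length ls) \<in> set rs" by (intro nth_mem) auto
  then have "\<not> lft ((ls @ rs) ! j)" using rs j by (simp add: nth_append)
  moreover have "int j = int (length ls) + int (length (ls @ rs)) - 1 - int i" using False i by (simp add: j_def)
  moreover have e: "chi_pos (length ls) (length (ls @ rs)) i = j" using False by (simp add: chi_pos_def j_def)
  ultimately show ?thesis unfolding e bpos_def using False by simp
qed

lemma sum_BNC_reindex:
  fixes k :: "nat set \<Rightarrow> complex"
  assumes ls: "\<forall>x\<in>set ls. lft x" and rs: "\<forall>x\<in>set rs. \<not> lft x"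
  defines "f \<equiv> chi_pos (length ls) (length (ls @ rs))"
  shows "(\<Sum>\<pi>\<in>BNC (ls @ rs). \<Prod>B\<in>\<pi>. k B) = (\<Sum>\<pi>\<in>NC id {..<length (ls @ rs)}. \<Prod>B\<in>\<pi>. k (f ` B))"
proof -
  let ?n = "length (ls @ rs)"
  have im: "f ` {..<?n} = {..<?n}" unfolding f_def by (rule chi_pos_image) simp
  have inj: "inj_on f {..<?n}" using im by (intro eq_card_imp_inj_on) simp_all
  have mono: "bpos (ls @ rs) (f x) < bpos (ls @ rs) (f y) \<longleftrightarrow> id x < id y"
    if xy: "x \<in> {..<?n}" "y \<in> {..<?n}" for x y
  proof -
    have b: "bpos (ls @ rs) (f z) = (if z < length ls then int z else int ?n + 1 + int z - int (length ls))"
      if "z \<in> {..<?n}" for z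
      unfolding f_def by (rule bpos_chi_pos[OF ls rs]) (use that in simp)
    show ?thesis unfolding b[OF xy(1)] b[OF xy(2)] by auto
  qed
  have "(\<Sum>\<pi>\<in>BNC (ls @ rs). \<Prod>B\<in>\<pi>. k B) = (\<Sum>\<pi>\<in>NC (bpos (ls @ rs)) (f ` {..<?n}). \<Prod>B\<in>\<pi>. k B)"
    by (simp only: BNC_eq_NC im)
  also have "\<dots> = (\<Sum>\<pi>\<in>NC id {..<?n}. \<Prod>B\<in>\<pi>. k (f ` B))"
    by (rule sum_NC_reindex[OF inj]) (simp only: crosses_image[where S = "{..<?n}" and f = f and pos = id and pos' = "bpos (ls @ rs)", OF mono])
  finally show ?thesis .
qed

text \<open>Read in the two orders, a block shows the same left letters and the right letters
  reversed. Subwords thus keep the form "left letters, then right letters" on which the induction in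
  \<open>cumulant_conv\<close> runs.\<close>

lemma nths_chi_pos:
  assumes B: "B \<subseteq> {..<length (ls @ rs)}"
  defines "f \<equiv> chi_pos (length ls) (length (ls @ rs))"
  shows "\<exists>l r. nths (ls @ rs) (f ` B) = l @ r \<and> nths (ls @ rev rs) B = l @ rev r \<and>
    set l \<subseteq> set ls \<and> set r \<subseteq> set rs"
proof -
  let ?R = "{j. j + length ls \<in> f ` B}"
  have 1: "nths ls (f ` B) = nths ls B"
  proof (rule nths_cong_set, rule Collect_cong, rule conj_cong[OF refl])
    fix i assume "i < length ls"
    then show "i \<in> f ` B \<longleftrightarrow> i \<in> B" using B by (fastforce simp: f_def chi_pos_def image_iff split: if_splits)
  qed
  have 2: "nths rs ?R = nths rs {j. j < length rs \<and> length rs - 1 - j \<in> {j. j + length ls \<in> B}}"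
  proof (rule nths_cong_set, rule Collect_cong, rule conj_cong[OF refl])
    fix j assume j: "j < length rs"
    have "j + length ls \<in> f ` B \<longleftrightarrow> length ls + (length rs - 1 - j) \<in> B"
    proof
      assume "j + length ls \<in> f ` B"
      then obtain b where b: "b \<in> B" "j + length ls = f b" by auto
      then have "b = length ls + (length rs - 1 - j)"
        using B j by (auto simp: f_def chi_pos_def split: if_splits)
      then show "length ls + (length rs - 1 - j) \<in> B" using b by simp
    next
      assume "length ls + (length rs - 1 - j) \<in> B"
      then have "f (length ls + (length rs - 1 - j)) \<in> f ` B" by (rule imageI)
      moreover have "f (length ls + (length rs - 1 - j)) = j + length ls" using j by (simp add: f_def chi_pos_def)
      ultimately show "j + length ls \<in> f ` B" by simp
    qed
    then show "j \<in> ?R \<longleftrightarrow> j \<in> {j. j < length rs \<and> length rs - 1 - j \<in> {j. j + length ls \<in> B}}"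
      using j by (simp add: add.commute)
  qed
  have e1: "nths (ls @ rs) (f ` B) = nths ls B @ nths rs ?R" by (simp add: nths_append 1)
  have e2: "nths (ls @ rev rs) B = nths ls B @ rev (nths rs ?R)"
    unfolding nths_append nths_rev 2 ..
  show ?thesis
    by (rule exI[of _ "nths ls B"], rule exI[of _ "nths rs ?R"]) (intro conjI e1 e2 set_nths_subset)
qed

text \<open>Replaced by 1 off the torus so that it is unitary and multiplicative everywhere.\<close>

definition cm :: "int \<Rightarrow> int \<Rightarrow> complex \<times> complex \<Rightarrow> complex" where
  "cm p q s = (if s \<in> torus2 then mono2 p q s else 1)"

lemma cm_mult: "cm p q s * cm p' q' s = cm (p + p') (q + q') s"
  by (simp add: cm_def mono2_mult)

lemma cm_0: "cm 0 0 s = 1" by (simp add: cm_def mono2_def)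

lemma norm_cm: "norm (cm p q s) = 1" by (simp add: cm_def norm_mono2)

lemma cm_cnj: "cnj (cm p q s) = cm (- p) (- q) s"
proof -
  have "cm p q s * cnj (cm p q s) = 1" using complex_norm_square[of "cm p q s"] norm_cm by simp
  moreover have "cm p q s * cm (- p) (- q) s = 1" by (simp add: cm_mult cm_0)
  ultimately show ?thesis by (metis mult_left_cancel mult_zero_left zero_neq_one)
qed

lemma cm_measurable: "cm p q \<in> borel_measurable borel"
proof -
  have "{s. s \<in> torus2} \<in> sets borel" using borel_closed[OF compact_imp_closed[OF compact_torus2]] by simp
  then show ?thesis unfolding cm_def
    by (intro measurable_If mono2_measurable) (auto simp: pred_def)
qed

lemma mom_cm: "PT2 \<mu> \<Longrightarrow> mom \<mu> p q = (\<integral>s. cm p q s \<partial>\<mu>)"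
proof -
  assume \<mu>: "PT2 \<mu>"
  then have "AE s in \<mu>. mono2 p q s = cm p q s" by (rule PT2_AE_I) (simp add: cm_def)
  then show ?thesis
    unfolding mom_mono2 by (intro integral_cong_AE) (simp_all add: measurable_PT2[OF \<mu>] cm_measurable mono2_measurable)
qed

lemma mom_cnj: "PT2 \<mu> \<Longrightarrow> mom \<mu> (- p) (- q) = cnj (mom \<mu> p q)"
  by (simp add: mom_cm cm_cnj[symmetric])

locale bf_pair =
  fixes \<nu>1 \<nu>2 :: "(complex \<times> complex) measure"
  assumes P1: "PT2 \<nu>1" and P2: "PT2 \<nu>2"

sublocale bf_pair \<subseteq> free_pair "\<lambda>i. if i then \<nu>2 else \<nu>1" borel
proof (rule free_pair.intro)
  show "prob_space (if i then \<nu>2 else \<nu>1)" "sets (if i then \<nu>2 else \<nu>1) = sets borel" for i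
    using P1 P2 unfolding PT2_def by (cases i; simp)+
qed

context bf_pair
begin

definition conv :: "letter \<Rightarrow> bool \<times> (complex \<times> complex \<Rightarrow> complex)" where
  "conv a = (pidx a, if lft a then cm (expo a) 0 else cm 0 (expo a))"

definition homL :: "letter list \<Rightarrow> bool" where
  "homL w \<longleftrightarrow> \<not> (\<exists>a\<in>set w. \<exists>b\<in>set w. pidx a \<noteq> pidx b)"

definition momL :: "letter list \<Rightarrow> complex" where
  "momL w = pair_moment (if pidx (hd w) then \<nu>2 else \<nu>1) w"

lemma top_BNC: "w \<noteq> [] \<Longrightarrow> {{..<length w}} \<in> BNC w"
  unfolding BNC_eq_NC by (auto simp: NC_def ncfam_def intro!: partition_on_space)

lemma BNC_partition: "\<pi> \<in> BNC w \<Longrightarrow> partition_on {..<length w} \<pi>"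
  by (simp add: BNC_def)

text \<open>The description has exactly one solution, since the formula determines the cumulant of a
  word from those of shorter words.\<close>

lemma bf_cumulant_eq: "bf_cumulant \<nu>1 \<nu>2 = cumul BNC homL momL"
  unfolding bf_cumulant_def
proof (rule the_equality, intro conjI allI impI)
  show "cumul BNC homL momL [] = 0" by (rule cumul_trivial) simp
  show "cumul BNC homL momL w = 0" if "\<exists>a\<in>set w. \<exists>b\<in>set w. pidx a \<noteq> pidx b" for w
    by (rule cumul_trivial) (use that in \<open>simp add: homL_def\<close>)
  show "pair_moment (if i then \<nu>2 else \<nu>1) w = (\<Sum>\<pi>\<in>BNC w. \<Prod>B\<in>\<pi>. cumul BNC homL momL (nths w B))"
    if w: "w \<noteq> []" and i: "\<forall>a\<in>set w. pidx a = i" for w i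
  proof -
    have "homL w" using i by (simp add: homL_def)
    then have "(\<Sum>\<pi>\<in>BNC w. \<Prod>B\<in>\<pi>. cumul BNC homL momL (nths w B)) = momL w"
      by (intro cumul_moment top_BNC w BNC_partition)
    then show ?thesis using w i by (simp add: momL_def)
  qed
next
  fix \<kappa> :: "letter list \<Rightarrow> complex"
  assume \<kappa>: "\<kappa> [] = 0 \<and> (\<forall>w. (\<exists>a\<in>set w. \<exists>b\<in>set w. pidx a \<noteq> pidx b) \<longrightarrow> \<kappa> w = 0) \<and>
     (\<forall>w i. w \<noteq> [] \<longrightarrow> (\<forall>a\<in>set w. pidx a = i) \<longrightarrow>
        pair_moment (if i then \<nu>2 else \<nu>1) w = (\<Sum>\<pi>\<in>BNC w. \<Prod>B\<in>\<pi>. \<kappa> (nths w B)))"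
  show "\<kappa> = cumul BNC homL momL"
  proof (rule ext, rule cumul_unique)
    show "(\<Sum>\<pi>\<in>BNC w. \<Prod>B\<in>\<pi>. \<kappa> (nths w B)) = momL w" if w: "w \<noteq> []" "homL w" for w
    proof -
      have "\<forall>a\<in>set w. pidx a = pidx (hd w)" using w unfolding homL_def by (metis hd_in_set)
      then show ?thesis using \<kappa> w(1) unfolding momL_def by metis
    qed
    show "\<kappa> w = 0" if "w = [] \<or> \<not> homL w" for w using that \<kappa> by (auto simp: homL_def)
  qed (auto intro: top_BNC BNC_partition)
qed

lemma prod_conv:
  "(\<Prod>a\<leftarrow>map conv w. snd a s) = cm (sum_list (map expo (filter lft w))) (sum_list (map expo (filter (\<lambda>x. \<not> lft x) w))) s"
  by (induction w) (auto simp: cm_0 conv_def cm_mult)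

lemma mm_conv:
  assumes ls: "\<forall>x\<in>set ls. lft x" and rs: "\<forall>x\<in>set rs. \<not> lft x" and h: "homL (ls @ rs)" and ne: "ls @ rs \<noteq> []"
  shows "mm (map conv (ls @ rev rs)) = momL (ls @ rs)"
proof -
  have f: "filter lft ls = ls" "filter (\<lambda>x. \<not> lft x) ls = []" "filter lft rs = []" "filter (\<lambda>x. \<not> lft x) rs = rs"
    using ls rs by (auto simp: filter_id_conv filter_empty_conv)
  have "hd (ls @ rev rs) \<in> set (ls @ rs)" using hd_in_set[of "ls @ rev rs"] ne by auto
  moreover have "hd (ls @ rs) \<in> set (ls @ rs)" using ne by (rule hd_in_set)
  ultimately have "pidx (hd (ls @ rev rs)) = pidx (hd (ls @ rs))" using h unfolding homL_def by blast
  then have "fst (hd (map conv (ls @ rev rs))) = pidx (hd (ls @ rs))"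
    using ne by (subst hd_map) (auto simp: conv_def)
  then show ?thesis
    unfolding mm_def momL_def pair_moment_def prod_conv
    using P1 P2 by (simp add: f mom_cm rev_map[symmetric] rev_filter[symmetric])
qed

lemma hom_conv: "hom (map conv (ls @ rev rs)) \<longleftrightarrow> homL (ls @ rs)"
proof -
  have c: "fst (conv a) = pidx a" for a by (simp add: conv_def)
  have "hom (map conv (ls @ rev rs)) \<longleftrightarrow> (\<forall>a\<in>set (ls @ rs). \<forall>b\<in>set (ls @ rs). pidx a = pidx b)"
    by (simp add: hom_def c ball_Un)
  then show ?thesis unfolding homL_def by blast
qed

text \<open>After reindexing by \<open>chi_pos\<close> both cumulants obey the same moment-cumulant
  formula, the letters of one pair being commuting functions. Terms with shorter blocks agree by
  induction, which leaves the one-block terms.\<close>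

lemma cumulant_conv:
  assumes "\<forall>x\<in>set ls. lft x" "\<forall>x\<in>set rs. \<not> lft x"
  shows "bf_cumulant \<nu>1 \<nu>2 (ls @ rs) = K (map conv (ls @ rev rs))"
  using assms
proof (induction "length (ls @ rs)" arbitrary: ls rs rule: less_induct)
  case less
  let ?\<kappa> = "bf_cumulant \<nu>1 \<nu>2" and ?w = "ls @ rs" and ?u = "map conv (ls @ rev rs)"
  let ?n = "length ?w" and ?f = "chi_pos (length ls) (length (ls @ rs))"
  show ?case
  proof (cases "?w = [] \<or> \<not> homL ?w")
    case True
    then show ?thesis
      unfolding bf_cumulant_eq K_def using hom_conv[of ls rs] by (subst (1 2) cumul_trivial) auto
  next
    case False
    have lu: "length ?u = ?n" by simp
    have fin: "finite (NC id {..<?n})" by (rule finite_NC) simp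
    have tp: "{{..<?n}} \<in> NC id {..<?n}" using top_NC[of ?u] False by simp
    have "(\<Sum>\<pi>\<in>NC id {..<?n}. \<Prod>B\<in>\<pi>. ?\<kappa> (nths ?w (?f ` B))) = (\<Sum>\<pi>\<in>BNC ?w. \<Prod>B\<in>\<pi>. ?\<kappa> (nths ?w B))"
      by (rule sum_BNC_reindex[symmetric]) (use less.prems in auto)
    also have "\<dots> = momL ?w"
      unfolding bf_cumulant_eq by (intro cumul_moment top_BNC BNC_partition) (use False in auto)
    also have "\<dots> = mm ?u" by (rule mm_conv[symmetric]) (use less.prems False in auto)
    also have "\<dots> = M ?u" by (rule M_hom[symmetric]) (use False hom_conv in auto)
    also have "\<dots> = (\<Sum>\<pi>\<in>NC id {..<?n}. \<Prod>B\<in>\<pi>. K (nths ?u B))" by (simp only: M_def MC_def lu)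
    finally have e: "(\<Sum>\<pi>\<in>NC id {..<?n}. \<Prod>B\<in>\<pi>. ?\<kappa> (nths ?w (?f ` B))) = (\<Sum>\<pi>\<in>NC id {..<?n}. \<Prod>B\<in>\<pi>. K (nths ?u B))" .
    have rest: "(\<Sum>\<pi>\<in>NC id {..<?n} - {{{..<?n}}}. \<Prod>B\<in>\<pi>. ?\<kappa> (nths ?w (?f ` B))) =
       (\<Sum>\<pi>\<in>NC id {..<?n} - {{{..<?n}}}. \<Prod>B\<in>\<pi>. K (nths ?u B))"
    proof (intro sum.cong prod.cong refl)
      fix \<pi> B assume \<pi>: "\<pi> \<in> NC id {..<?n} - {{{..<?n}}}" and B: "B \<in> \<pi>"
      have "partition_on {..<length ?u} \<pi>" "\<pi> \<noteq> {{..<length ?u}}" using \<pi> lu by (auto simp: NC_def)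
      from length_nths_block[OF this B] have len: "length (nths ?u B) < ?n" by simp
      have "B \<subseteq> {..<?n}" using \<pi> B by (auto dest: NC_subset)
      from nths_chi_pos[OF this] obtain l r where lr: "nths ?w (?f ` B) = l @ r" "nths (ls @ rev rs) B = l @ rev r"
        "set l \<subseteq> set ls" "set r \<subseteq> set rs" by blast
      have "length (l @ r) < ?n" using len unfolding nths_map lr(2) by simp
      then have "?\<kappa> (l @ r) = K (map conv (l @ rev r))" by (rule less.hyps) (use lr less.prems in auto)
      then show "?\<kappa> (nths ?w (?f ` B)) = K (nths ?u B)" by (simp only: lr nths_map)
    qed
    have im: "?f ` {..<?n} = {..<?n}" by (rule chi_pos_image) simp
    have "nths ?w {..<?n} = ?w" "nths ?u {..<?n} = ?u" by (simp_all add: nths_all)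
    then have "?\<kappa> ?w = K ?u" using e unfolding sum.remove[OF fin tp] rest by (simp del: length_append map_append add: im)
    then show ?thesis .
  qed
qed

lemma bf_moment_eq_M:
  assumes ls: "\<forall>x\<in>set ls. lft x" and rs: "\<forall>x\<in>set rs. \<not> lft x"
  shows "bf_moment \<nu>1 \<nu>2 (ls @ rs) = M (map conv (ls @ rev rs))"
proof -
  let ?n = "length (ls @ rs)" and ?f = "chi_pos (length ls) (length (ls @ rs))" and ?u = "map conv (ls @ rev rs)"
  have "bf_moment \<nu>1 \<nu>2 (ls @ rs) = (\<Sum>\<pi>\<in>NC id {..<?n}. \<Prod>B\<in>\<pi>. bf_cumulant \<nu>1 \<nu>2 (nths (ls @ rs) (?f ` B)))"
    unfolding bf_moment_def by (rule sum_BNC_reindex[OF ls rs])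
  also have "\<dots> = (\<Sum>\<pi>\<in>NC id {..<?n}. \<Prod>B\<in>\<pi>. K (nths ?u B))"
  proof (intro sum.cong prod.cong refl)
    fix \<pi> B assume \<pi>: "\<pi> \<in> NC id {..<?n}" and B: "B \<in> \<pi>"
    have "B \<subseteq> {..<?n}" using \<pi> B by (auto dest: NC_subset)
    from nths_chi_pos[OF this] obtain l r where lr: "nths (ls @ rs) (?f ` B) = l @ r" "nths (ls @ rev rs) B = l @ rev r"
      "set l \<subseteq> set ls" "set r \<subseteq> set rs" by blast
    have "bf_cumulant \<nu>1 \<nu>2 (l @ r) = K (map conv (l @ rev r))" by (rule cumulant_conv) (use lr ls rs in auto)
    then show "bf_cumulant \<nu>1 \<nu>2 (nths (ls @ rs) (?f ` B)) = K (nths ?u B)" by (simp only: lr nths_map)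
  qed
  also have "\<dots> = M ?u" by (simp add: M_def MC_def)
  finally show ?thesis .
qed

section \<open>Integer powers of a product of two free unitaries\<close>

definition altpow :: "'b \<Rightarrow> 'b \<Rightarrow> nat \<Rightarrow> 'b list" where
  "altpow x y n = concat (replicate n [x, y])"

lemma altpow_simps [simp]: "altpow x y 0 = []" "altpow x y (Suc n) = x # y # altpow x y n"
  by (simp_all add: altpow_def)

lemma altpow_add: "altpow x y (m + n) = altpow x y m @ altpow x y n"
  by (simp add: altpow_def replicate_add)

lemma altpow_Suc': "altpow x y (Suc n) = altpow x y n @ [x, y]"
  using altpow_add[of x y n 1] by simp

lemma rev_altpow: "rev (altpow x y n) = altpow y x n"
proof (induction n)
  case (Suc n)
  have "rev (altpow x y (Suc n)) = rev (altpow x y n) @ [y, x]" by simp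
  then show ?case using Suc altpow_Suc'[of y x n] by simp
qed simp

lemma map_altpow: "map h (altpow x y n) = altpow (h x) (h y) n"
  by (induction n) simp_all

lemma set_altpow: "set (altpow x y n) \<subseteq> {x, y}"
  by (induction n) auto

text \<open>The factor of index \<open>i\<close> stands first; for negative \<open>p\<close> the
  inverse has its factors in reverse order, hence the swapped indices.\<close>

definition zpow :: "bool \<Rightarrow> (int \<Rightarrow> complex \<times> complex \<Rightarrow> complex) \<Rightarrow> int \<Rightarrow> (bool \<times> (complex \<times> complex \<Rightarrow> complex)) list" where
  "zpow i E p = (if p \<ge> 0 then altpow (i, E 1) (\<not> i, E 1) (nat p) else altpow (\<not> i, E (-1)) (i, E (-1)) (nat (- p)))"

definition UU where "UU p = zpow False (\<lambda>e. cm e 0) p"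
definition VV where "VV q = zpow True (\<lambda>e. cm 0 e) q"

lemma bf_moment_UV: "bf_moment \<nu>1 \<nu>2 (UV_word p q) = M (UU p @ VV q)"
proof -
  have pp: "prod_pow l p = (if p \<ge> 0 then altpow (Let False l 1) (Let True l 1) (nat p)
      else altpow (Let True l (-1)) (Let False l (-1)) (nat (- p)))" for l p
    by (simp add: prod_pow_def altpow_def)
  have L: "lft x = l" if "x \<in> set (prod_pow l p)" for x l p
    using that set_altpow[of "Let False l 1" "Let True l 1" "nat p"]
      set_altpow[of "Let True l (-1)" "Let False l (-1)" "nat (-p)"] by (auto simp: pp split: if_splits)
  have "bf_moment \<nu>1 \<nu>2 (UV_word p q) = M (map conv (prod_pow True p @ rev (prod_pow False q)))"
    unfolding UV_word_def by (rule bf_moment_eq_M) (use L in auto)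
  also have "map conv (prod_pow True p @ rev (prod_pow False q)) = UU p @ VV q"
    by (auto simp: pp UU_def VV_def zpow_def rev_altpow map_altpow conv_def)
  finally show ?thesis .
qed

definition char_fam :: "(int \<Rightarrow> complex \<times> complex \<Rightarrow> complex) \<Rightarrow> bool" where
  "char_fam E \<longleftrightarrow> (\<forall>e. good (E e)) \<and> (\<forall>e s. cnj (E e s) = E (- e) s) \<and> (\<forall>e s. E e s * E (- e) s = 1)"

lemma good_cm: "good (cm p q)"
  unfolding good_def using cm_measurable by (auto simp: norm_cm)

lemma char_fam_cm: "char_fam (\<lambda>e. cm e 0)" "char_fam (\<lambda>e. cm 0 e)"
  by (simp_all add: char_fam_def good_cm cm_cnj cm_mult cm_0)

lemma star_altpow: "star (altpow (i, f) (j, g) n) = altpow (j, \<lambda>s. cnj (g s)) (i, \<lambda>s. cnj (f s)) n"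
  unfolding star_def map_altpow rev_altpow by simp

lemma star_zpow: "char_fam E \<Longrightarrow> star (zpow i E p) = zpow i E (- p)"
proof -
  assume E: "char_fam E"
  have c: "(\<lambda>s. cnj (E e s)) = E (- e)" for e using E unfolding char_fam_def by blast
  show ?thesis by (cases "p = 0") (auto simp: zpow_def star_altpow c)
qed

lemma unitary_zpow: "char_fam E \<Longrightarrow> unitary (zpow i E p)"
  unfolding unitary_def
proof
  fix a assume E: "char_fam E" and a: "a \<in> set (zpow i E p)"
  have "a \<in> {(i, E 1), (\<not> i, E 1), (\<not> i, E (-1)), (i, E (-1))}"
    using a set_altpow[of "(i, E 1)" "(\<not> i, E 1)" "nat p"] set_altpow[of "(\<not> i, E (-1))" "(i, E (-1))" "nat (-p)"]
    unfolding zpow_def by (auto split: if_splits)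
  moreover have "E 1 s * E (-1) s = 1" "E (-1) s * E 1 s = 1" for s
    using E unfolding char_fam_def by (metis add.inverse_inverse)+
  ultimately show "good (snd a) \<and> (\<forall>s. snd a s * cnj (snd a s) = 1)"
    using E unfolding char_fam_def by auto
qed

text \<open>Exponents of equal sign concatenate; otherwise one of the two powers is split so that a
  word cancels against its adjoint.\<close>

lemma M_zpow_add:
  assumes E: "char_fam E"
  shows "M (x @ zpow i E p @ zpow i E p' @ y) = M (x @ zpow i E (p + p') @ y)"
proof -
  have same: "zpow i E a @ zpow i E b = zpow i E (a + b)" if ab: "a \<ge> 0 \<and> b \<ge> 0 \<or> a \<le> 0 \<and> b \<le> 0" for a b
  proof -
    consider "a \<ge> 0" "b \<ge> 0" | "a < 0" "b < 0" | "a = 0" | "b = 0" using ab by linarith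
    then show ?thesis
    proof cases
      case 1
      then show ?thesis by (simp add: zpow_def nat_add_distrib altpow_add)
    next
      case 2
      have "nat (- a - b) = nat (- a) + nat (- b)" using 2 by linarith
      then show ?thesis using 2 by (simp add: zpow_def altpow_add)
    qed (simp_all add: zpow_def)
  qed
  have cancel: "M (x @ zpow i E a @ zpow i E (- a) @ y) = M (x @ y)" for x a y
    using M_unitary_cancel[OF unitary_zpow[OF E, of i a], of x y] by (simp add: star_zpow[OF E])
  consider "p \<ge> 0 \<and> p' \<ge> 0 \<or> p \<le> 0 \<and> p' \<le> 0" |
    "(p + p') \<ge> 0 \<and> - p' \<ge> 0 \<or> (p + p') \<le> 0 \<and> - p' \<le> 0" |
    "- p \<ge> 0 \<and> p + p' \<ge> 0 \<or> - p \<le> 0 \<and> p + p' \<le> 0" by linarith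
  then show ?thesis
  proof cases
    case 1
    then show ?thesis by (metis append.assoc same)
  next
    case 2
    from same[OF 2] have e: "zpow i E p = zpow i E (p + p') @ zpow i E (- p')" by simp
    show ?thesis unfolding e using cancel[of "x @ zpow i E (p + p')" "- p'" y] by simp
  next
    case 3
    from same[OF 3] have e: "zpow i E p' = zpow i E (- p) @ zpow i E (p + p')" by simp
    show ?thesis unfolding e using cancel[of x p "zpow i E (p + p') @ y"] by simp
  qed
qed

text \<open>The value at a - b is the inner product of the words U^p V^q attached to a and b. U and
  V need not commute; the trace property lets V^(-q') travel around the word to meet V^q.\<close>

lemma herglotz_UV: "herglotz (\<lambda>p q. M (UU p @ VV q))"
proof
  fix I :: "(int \<times> int) set" and c assume I: "finite I"
  have E: "M (UU (p - p') @ VV (q - q')) = M (star (UU p' @ VV q') @ (UU p @ VV q))" for p q p' q'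
  proof -
    have "M (star (UU p' @ VV q') @ (UU p @ VV q)) = M (VV (- q') @ UU (- p') @ UU p @ VV q)"
      by (simp add: UU_def VV_def star_zpow char_fam_cm)
    also have "\<dots> = M (VV (- q') @ UU (p - p') @ VV q)"
      unfolding UU_def by (simp add: M_zpow_add char_fam_cm)
    also have "\<dots> = M (UU (p - p') @ VV q @ VV (- q') @ [])"
      by (subst M_rotate) simp
    also have "\<dots> = M (UU (p - p') @ VV (q - q') @ [])"
      unfolding VV_def by (subst M_zpow_add) (simp_all add: char_fam_cm)
    finally show ?thesis by simp
  qed
  have "(\<Sum>a\<in>I. \<Sum>b\<in>I. c a * cnj (c b) * M (star (UU (fst b) @ VV (snd b)) @ (UU (fst a) @ VV (snd a)))) \<in> \<real>\<^sub>\<ge>\<^sub>0"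
    by (rule M_psd[OF I]) (simp add: UU_def VV_def unitary_goods unitary_zpow char_fam_cm)
  then show "(\<Sum>a\<in>I. \<Sum>b\<in>I. c a * cnj (c b) * M (UU (fst a - fst b) @ VV (snd a - snd b))) \<in> \<real>\<^sub>\<ge>\<^sub>0"
    by (simp only: E)
next
  show "M (UU 0 @ VV 0) = 1" by (simp add: UU_def VV_def zpow_def)
qed

text \<open>\<open>herglotz_UV\<close> gives existence and \<open>PT2_eqI\<close> uniqueness, which
  discharges the description defining the convolution.\<close>

lemma bfmult: "PT2 (\<nu>1 \<boxtimes>\<boxtimes> \<nu>2)" "mom (\<nu>1 \<boxtimes>\<boxtimes> \<nu>2) p q = M (UU p @ VV q)"
proof -
  obtain \<mu> where \<mu>: "PT2 \<mu>" "\<forall>p q. mom \<mu> p q = M (UU p @ VV q)"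
    using herglotz.herglotz[OF herglotz_UV] by blast
  have "PT2 (\<nu>1 \<boxtimes>\<boxtimes> \<nu>2) \<and> (\<forall>p q. mom (\<nu>1 \<boxtimes>\<boxtimes> \<nu>2) p q = bf_moment \<nu>1 \<nu>2 (UV_word p q))"
    unfolding bfmult_def
  proof (rule theI)
    show "PT2 \<mu> \<and> (\<forall>p q. mom \<mu> p q = bf_moment \<nu>1 \<nu>2 (UV_word p q))" using \<mu> by (simp add: bf_moment_UV)
    show "\<mu>' = \<mu>" if "PT2 \<mu>' \<and> (\<forall>p q. mom \<mu>' p q = bf_moment \<nu>1 \<nu>2 (UV_word p q))" for \<mu>'
      using that \<mu> by (intro PT2_eqI) (simp_all add: bf_moment_UV)
  qed
  then show "PT2 (\<nu>1 \<boxtimes>\<boxtimes> \<nu>2)" "mom (\<nu>1 \<boxtimes>\<boxtimes> \<nu>2) p q = M (UU p @ VV q)"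
    by (simp_all add: bf_moment_UV)
qed

end

section \<open>Moments of the bi-free convolution\<close>

context bf_pair
begin

abbreviation "\<nu>b b \<equiv> (if b then \<nu>2 else \<nu>1)"

abbreviation "\<nu>12 \<equiv> \<nu>1 \<boxtimes>\<boxtimes> \<nu>2"

lemma PT2_\<nu>b: "PT2 (\<nu>b b)" using P1 P2 by simp

lemma \<phi>_cm: "\<phi> (b, cm p q) = mom (\<nu>b b) p q"
  unfolding \<phi>_def fst_conv snd_conv using mom_cm[OF PT2_\<nu>b] by simp

lemma M_single: "M [a] = \<phi> a"
  by (subst M_hom) (simp_all add: hom_def mm_def \<phi>_def)

lemma M_two:
  assumes "good f" "good g" "i \<noteq> j"
  shows "M [(i, f), (j, g)] = \<phi> (i, f) * \<phi> (j, g)"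
proof -
  let ?c = "\<phi> (i, f)" and ?d = "\<phi> (j, g)"
  have "M [(i, f), (j, g)] = M [(i, \<lambda>s. f s - ?c), (j, g)] + ?c * ?d"
    using M_center[of f "[]" "[(j, g)]" i ?c] assms by (simp add: M_single)
  also have "M [(i, \<lambda>s. f s - ?c), (j, g)] = M [(i, \<lambda>s. f s - ?c), (j, \<lambda>s. g s - ?d)] + ?d * \<phi> (i, \<lambda>s. f s - ?c)"
    using M_center[of g "[(i, \<lambda>s. f s - ?c)]" "[]" j ?d] assms good_diff_const[of f] by (simp add: M_single)
  also have "M [(i, \<lambda>s. f s - ?c), (j, \<lambda>s. g s - ?d)] = 0"
    by (rule M_reduced) (use assms good_diff_const \<phi>_center in \<open>auto simp: reduced_Cons reduced_Nil\<close>)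
  finally show ?thesis using assms by (simp add: \<phi>_center)
qed

lemma mom_mult:
  "mom \<nu>12 1 0 = mom \<nu>1 1 0 * mom \<nu>2 1 0"
  "mom \<nu>12 0 1 = mom \<nu>1 0 1 * mom \<nu>2 0 1"
  "mom \<nu>12 1 1 = mom \<nu>1 1 1 * mom \<nu>2 1 1"
proof -
  have u: "UU 1 = [(False, cm 1 0), (True, cm 1 0)]" "UU 0 = []"
    "VV 1 = [(True, cm 0 1), (False, cm 0 1)]" "VV 0 = []"
    by (simp_all add: UU_def VV_def zpow_def)
  show "mom \<nu>12 1 0 = mom \<nu>1 1 0 * mom \<nu>2 1 0"
    unfolding bfmult u by (simp add: M_two good_cm \<phi>_cm)
  show "mom \<nu>12 0 1 = mom \<nu>1 0 1 * mom \<nu>2 0 1"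
    unfolding bfmult u by (simp add: M_two good_cm \<phi>_cm)
  \<comment> \<open>In u1 u2 v2 v1 the letters of the second pair are neighbours, and after a
    rotation so are those of the first.\<close>
  have "M (UU 1 @ VV 1) = M ([(False, cm 1 0)] @ (True, cm 1 0) # (True, cm 0 1) # [(False, cm 0 1)])"
    by (simp add: u)
  also have "\<dots> = M ([(False, cm 1 0), (True, cm 1 1)] @ [(False, cm 0 1)])"
    by (subst M_merge) (simp add: cm_mult)
  also have "\<dots> = M ((False, cm 0 1) # (False, cm 1 0) # [(True, cm 1 1)])"
    by (subst M_rotate) simp
  also have "\<dots> = M [(False, cm 1 1), (True, cm 1 1)]"
    by (subst M_merge0) (simp add: cm_mult)
  also have "\<dots> = mom \<nu>1 1 1 * mom \<nu>2 1 1" by (simp add: M_two good_cm \<phi>_cm)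
  finally show "mom \<nu>12 1 1 = mom \<nu>1 1 1 * mom \<nu>2 1 1" unfolding bfmult .
qed

lemma reduced_altpow:
  assumes "good f" "good g" "\<phi> (i, f) = 0" "\<phi> (j, g) = 0" "i \<noteq> j"
  shows "reduced (altpow (i, f) (j, g) n)"
proof (induction n)
  case (Suc n)
  then show ?case using assms by (cases n) (auto simp: reduced_Cons)
qed (simp add: reduced_Nil)

lemma ker_altpow:
  "ker (altpow (i, f) (j, g) m) (altpow (i, f') (j, g') n) =
    (if m = n then (\<phi> (i, \<lambda>s. cnj (f s) * f' s) * \<phi> (j, \<lambda>s. cnj (g s) * g' s)) ^ n else 0)"
proof (induction m arbitrary: n)
  case 0
  show ?case by (cases n) auto
next
  case (Suc m)
  then show ?case by (cases n) (auto simp: mult_ac)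
qed

lemma reduced_zpow:
  assumes "char_fam E" "\<And>b. \<phi> (b, E 1) = 0"
  shows "reduced (zpow i E p)"
proof -
  have "\<phi> (b, E (-1)) = 0" for b
  proof -
    have "(\<lambda>s. cnj (E 1 s)) = E (-1)" using assms(1) unfolding char_fam_def by blast
    then show ?thesis using \<phi>_cnj[of b "E 1"] assms(2) by simp
  qed
  then show ?thesis using assms unfolding zpow_def char_fam_def by (auto intro!: reduced_altpow)
qed

text \<open>With zero means all powers are reduced words, and U^p is the adjoint of U^(-p), so the
  moment is a value of \<open>ker\<close>. It vanishes unless lengths and index patterns match,
  which forces p = q; then each pair of letters contributes m11 of one factor or its
  conjugate.\<close>

lemma mom_centered:
  assumes "\<And>b. mom (\<nu>b b) 1 0 = 0" "\<And>b. mom (\<nu>b b) 0 1 = 0"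
  shows "mom \<nu>12 p q = (if p = q then if p \<ge> 0 then (mom \<nu>1 1 1 * mom \<nu>2 1 1) ^ nat p
     else cnj (mom \<nu>1 1 1 * mom \<nu>2 1 1) ^ nat (- p) else 0)"
proof -
  have nU: "reduced (UU p)" for p unfolding UU_def by (rule reduced_zpow[OF char_fam_cm(1)]) (simp only: \<phi>_cm assms)
  have nV: "reduced (VV p)" for p unfolding VV_def by (rule reduced_zpow[OF char_fam_cm(2)]) (simp only: \<phi>_cm assms)
  have "mom \<nu>12 p q = M (star (UU (- p)) @ VV q)"
    unfolding bfmult UU_def star_zpow[OF char_fam_cm(1)] by simp
  also have "\<dots> = ker (UU (- p)) (VV q)" by (rule M_star_reduced[OF nU nV])
  also have "\<dots> = (if p = q then if p \<ge> 0 then (mom \<nu>1 1 1 * mom \<nu>2 1 1) ^ nat p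
     else cnj (mom \<nu>1 1 1 * mom \<nu>2 1 1) ^ nat (- p) else 0)"
  proof -
    have m: "\<phi> (b, \<lambda>s. cm x y s) = mom (\<nu>b b) x y" for b x y using \<phi>_cm[of b x y] by simp
    consider "p > 0" "q \<ge> 0" | "p > 0" "q < 0" | "p = 0" | "p < 0" "q < 0" | "p < 0" "q > 0" | "p < 0" "q = 0" by linarith
    then show ?thesis
    proof cases
      case 1
      then show ?thesis by (simp add: UU_def VV_def zpow_def ker_altpow cm_cnj cm_mult m nat_eq_iff mult.commute)
    next
      case 2
      then obtain m n where "nat p = Suc m" "nat (- q) = Suc n" by (metis Suc_pred zero_less_nat_eq neg_0_less_iff_less)
      then show ?thesis using 2 by (simp add: UU_def VV_def zpow_def)
    next
      case 3
      then show ?thesis by (cases "nat q"; cases "nat (-q)") (auto simp: UU_def VV_def zpow_def)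
    next
      case 4
      then show ?thesis using mom_cnj[OF P1, of 1 1] mom_cnj[OF P2, of 1 1]
        by (simp add: UU_def VV_def zpow_def ker_altpow cm_cnj cm_mult m eq_nat_nat_iff)
    next
      case 5
      then obtain m n where "nat (- p) = Suc m" "nat q = Suc n" by (metis Suc_pred zero_less_nat_eq neg_0_less_iff_less)
      then show ?thesis using 5 by (simp add: UU_def VV_def zpow_def)
    next
      case 6
      then obtain m where "nat (- p) = Suc m" by (metis Suc_pred zero_less_nat_eq neg_0_less_iff_less)
      then show ?thesis using 6 by (simp add: UU_def VV_def zpow_def)
    qed
  qed
  finally show ?thesis .
qed

text \<open>If the new letter has the index of the last one, they merge: the centred product still
  alternates, and the mean leaves a reduced word that is non-empty because \<open>X\<close> has at
  least two letters. Otherwise centring the new letter leaves two reduced words.\<close>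

lemma M_reduced_snoc:
  assumes X: "reduced X" "length X \<ge> 2" and h: "good h"
  shows "M (X @ [(k, h)]) = 0"
proof -
  have XM: "M X = 0" using X by (intro M_reduced) auto
  have gX: "goods X" using X by (simp add: reduced_def)
  obtain Y a where Y: "X = Y @ [a]" using X by (metis length_0_conv not_numeral_le_zero rev_exhaust)
  obtain l f where a: "a = (l, f)" by force
  have Yne: "Y \<noteq> []" using X Y by auto
  have nY: "reduced Y" "fst (last Y) \<noteq> l" and f: "good f" using X Yne unfolding Y a reduced_append reduced_Cons by auto
  show ?thesis
  proof (cases "l = k")
    case True
    let ?g = "\<lambda>s. f s * h s"
    have g: "good ?g" using f h by (rule good_mult)
    have "M (X @ [(k, h)]) = M (Y @ [(k, ?g)])" using M_merge[of Y k f h "[]"] True by (simp add: Y a)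
    also have "\<dots> = M (Y @ [(k, \<lambda>s. ?g s - \<phi> (k, ?g))]) + \<phi> (k, ?g) * M Y"
      using M_center[of ?g Y "[]" k] g nY by (simp add: reduced_def)
    also have "M (Y @ [(k, \<lambda>s. ?g s - \<phi> (k, ?g))]) = 0"
    proof (rule M_reduced)
      show "reduced (Y @ [(k, \<lambda>s. ?g s - \<phi> (k, ?g))])"
        unfolding reduced_append reduced_Cons using nY True g by (auto simp: reduced_Nil good_diff_const \<phi>_center)
    qed simp
    also have "M Y = 0" using nY Yne by (intro M_reduced)
    finally show ?thesis by simp
  next
    case False
    have "M (X @ [(k, h)]) = M (X @ [(k, \<lambda>s. h s - \<phi> (k, h))]) + \<phi> (k, h) * M X"
      using M_center[of h X "[]" k] h gX by simp
    also have "M (X @ [(k, \<lambda>s. h s - \<phi> (k, h))]) = 0"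
    proof (rule M_reduced)
      show "reduced (X @ [(k, \<lambda>s. h s - \<phi> (k, h))])"
        using X(1) False h unfolding reduced_append[of X] reduced_Cons by (auto simp: reduced_Nil good_diff_const \<phi>_center Y a)
    qed simp
    finally show ?thesis using XM by simp
  qed
qed

section \<open>Replacing a nearly constant unitary by its mean\<close>

lemma replace_by_const:
  assumes "unitary x" "unitary y" "good f" and e: "(\<integral>s. (norm (f s - c))\<^sup>2 \<partial>\<nu>b j) \<le> \<epsilon>\<^sup>2" "\<epsilon> \<ge> 0"
  shows "norm (M (x @ (j, f) # y) - c * M (x @ y)) \<le> \<epsilon>"
proof -
  have "M (x @ (j, f) # y) - c * M (x @ y) = M (x @ (j, \<lambda>s. f s - c) # y)"
    using M_center[of f x y j c] assms unitary_goods by simp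
  moreover have "(norm (M (x @ (j, \<lambda>s. f s - c) # y)))\<^sup>2 \<le> \<epsilon>\<^sup>2"
    using M_Cauchy_Schwarz[OF assms(1,2) good_diff_const[OF assms(3)], of j c] e(1) by (rule order_trans)
  then have "norm (M (x @ (j, \<lambda>s. f s - c) # y)) \<le> \<epsilon>" using e(2) by (rule power2_le_imp_le)
  ultimately show ?thesis by simp
qed

lemma norm_chain:
  fixes T T' S :: complex
  assumes "norm (T - c * T') \<le> \<epsilon>" "norm (T' - c ^ n * S) \<le> of_nat n * \<epsilon>" "norm c \<le> 1"
  shows "norm (T - c ^ Suc n * S) \<le> of_nat (Suc n) * \<epsilon>"
proof -
  have "norm (T - c ^ Suc n * S) = norm ((T - c * T') + c * (T' - c ^ n * S))" by (simp add: algebra_simps)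
  also have "\<dots> \<le> norm (T - c * T') + norm c * norm (T' - c ^ n * S)" using norm_triangle_ineq norm_mult by metis
  also have "\<dots> \<le> \<epsilon> + 1 * (of_nat n * \<epsilon>)" using assms by (intro add_mono mult_mono) auto
  finally show ?thesis by (simp add: algebra_simps)
qed

lemma unitary_power: "unitary [(k, g)] \<Longrightarrow> unitary [(k, \<lambda>s. g s ^ m)]"
proof (induction m)
  case 0
  then show ?case using good_const[of 1] by (simp add: unitary_def)
next
  case (Suc m)
  then show ?case
    using good_mult[of g "\<lambda>s. g s ^ m"] by (simp add: unitary_def) (metis mult.assoc mult.left_commute mult_1_right)
qed

lemma unitary_ConsI: "unitary [a] \<Longrightarrow> unitary w \<Longrightarrow> unitary (a # w)" by (auto simp: unitary_def)

lemma unitary_altpow: "unitary [(j, f)] \<Longrightarrow> unitary [(k, g)] \<Longrightarrow> unitary (altpow (j, f) (k, g) n)"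
proof (induction n)
  case 0
  show ?case by (simp add: unitary_def)
next
  case (Suc n)
  show ?case
    unfolding altpow_simps by (rule unitary_ConsI[OF Suc.prems(1) unitary_ConsI[OF Suc.prems(2) Suc.IH[OF Suc.prems]]])
qed

text \<open>Each \<open>f\<close> is replaced by \<open>c\<close> at cost \<open>\<epsilon>\<close>,
  after which neighbouring copies of \<open>g\<close> merge; \<open>m\<close> counts the copies
  merged so far and varies in the induction. The bound on \<open>c\<close> keeps later errors from
  growing. The two claims treat the two orders of the letters.\<close>

lemma telescope:
  assumes X: "unitary X" and f: "unitary [(j, f)]" and g: "unitary [(k, g)]"
    and e: "(\<integral>s. (norm (f s - c))\<^sup>2 \<partial>\<nu>b j) \<le> \<epsilon>\<^sup>2" "\<epsilon> \<ge> 0" "norm c \<le> 1"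
  shows "norm (M (X @ (k, \<lambda>s. g s ^ m) # altpow (j, f) (k, g) n) - c ^ n * M (X @ [(k, \<lambda>s. g s ^ (m + n))])) \<le> of_nat n * \<epsilon>"
    and "norm (M (X @ (k, \<lambda>s. g s ^ m) # altpow (k, g) (j, f) n) - c ^ n * M (X @ [(k, \<lambda>s. g s ^ (m + n))])) \<le> of_nat n * \<epsilon>"
proof -
  have gf: "good f" using f by (simp add: unitary_def)
  show "norm (M (X @ (k, \<lambda>s. g s ^ m) # altpow (j, f) (k, g) n) - c ^ n * M (X @ [(k, \<lambda>s. g s ^ (m + n))])) \<le> of_nat n * \<epsilon>"
  proof (induction n arbitrary: m)
    case (Suc n)
    let ?A = "altpow (j, f) (k, g) n"
    have "norm (M ((X @ [(k, \<lambda>s. g s ^ m)]) @ (j, f) # (k, g) # ?A) - c * M ((X @ [(k, \<lambda>s. g s ^ m)]) @ (k, g) # ?A)) \<le> \<epsilon>"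
      by (rule replace_by_const[OF _ _ gf e(1,2)])
        (simp add: X unitary_power[OF g], rule unitary_ConsI[OF g unitary_altpow[OF f g]])
    moreover have "M ((X @ [(k, \<lambda>s. g s ^ m)]) @ (k, g) # ?A) = M (X @ (k, \<lambda>s. g s ^ Suc m) # ?A)"
      using M_merge[of X k "\<lambda>s. g s ^ m" g ?A] by (simp add: mult.commute)
    ultimately have "norm (M (X @ (k, \<lambda>s. g s ^ m) # altpow (j, f) (k, g) (Suc n)) - c * M (X @ (k, \<lambda>s. g s ^ Suc m) # ?A)) \<le> \<epsilon>"
      by simp
    from norm_chain[OF this Suc.IH[of "Suc m"] e(3)] show ?case by simp
  qed simp
  show "norm (M (X @ (k, \<lambda>s. g s ^ m) # altpow (k, g) (j, f) n) - c ^ n * M (X @ [(k, \<lambda>s. g s ^ (m + n))])) \<le> of_nat n * \<epsilon>"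
  proof (induction n arbitrary: m)
    case (Suc n)
    let ?A = "altpow (k, g) (j, f) n"
    have "norm (M ((X @ [(k, \<lambda>s. g s ^ Suc m)]) @ (j, f) # ?A) - c * M ((X @ [(k, \<lambda>s. g s ^ Suc m)]) @ ?A)) \<le> \<epsilon>"
      by (rule replace_by_const[OF _ _ gf e(1,2)])
        (simp add: X unitary_power[OF g] del: power_Suc, rule unitary_altpow[OF g f])
    moreover have "M (X @ (k, \<lambda>s. g s ^ m) # (k, g) # (j, f) # ?A) = M (X @ (k, \<lambda>s. g s ^ Suc m) # (j, f) # ?A)"
      using M_merge[of X k "\<lambda>s. g s ^ m" g "(j, f) # ?A"] by (simp add: mult.commute)
    ultimately have "norm (M (X @ (k, \<lambda>s. g s ^ m) # altpow (k, g) (j, f) (Suc n)) - c * M (X @ (k, \<lambda>s. g s ^ Suc m) # ?A)) \<le> \<epsilon>"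
      by (simp del: power_Suc)
    from norm_chain[OF this Suc.IH[of "Suc m"] e(3)] show ?case by simp
  qed simp
qed

lemma telescope_zpow:
  assumes X: "unitary X" and E: "char_fam E" and q: "q \<ge> 0"
    and e: "(\<integral>s. (norm (E 1 s - c))\<^sup>2 \<partial>\<nu>b b) \<le> \<epsilon>\<^sup>2" "\<epsilon> \<ge> 0" "norm c \<le> 1"
  shows "norm (M (X @ zpow i E q) - c ^ nat q * M (X @ [(\<not> b, \<lambda>s. E 1 s ^ nat q)])) \<le> of_int q * \<epsilon>"
proof -
  have u: "unitary [(j, E 1)]" for j
  proof -
    have "unitary (zpow j E 1)" by (rule unitary_zpow[OF E])
    then show ?thesis by (simp add: zpow_def unitary_def)
  qed
  \<comment> \<open>A unit is inserted behind \<open>X\<close>, so that \<open>telescope\<close>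
    applies with exponent 0.\<close>
  have s: "M (X @ (\<not> b, \<lambda>s. E 1 s ^ 0) # w) = M (X @ w)" for w using M_unit[of X "\<not> b" w] by simp
  have z: "zpow i E q = altpow (i, E 1) (\<not> i, E 1) (nat q)" using q by (simp add: zpow_def)
  show ?thesis
  proof (cases "b = i")
    case True
    then show ?thesis using telescope(1)[OF X u u e, of "\<not> b" 0 "nat q"] q unfolding s z by simp
  next
    case False
    then have "b = (\<not> i)" by auto
    then show ?thesis using telescope(2)[OF X u u e, of "\<not> b" 0 "nat q"] q unfolding s z by simp
  qed
qed

text \<open>A unitary has second absolute moment 1, so its variance is 1 minus the squared modulus
  of its mean; all square roots below come from here.\<close>

lemma variance_unitary:
  assumes "unitary [(b, f)]"
  shows "(\<integral>s. (norm (f s - \<phi> (b, f)))\<^sup>2 \<partial>\<nu>b b) = 1 - (norm (\<phi> (b, f)))\<^sup>2" "norm (\<phi> (b, f)) \<le> 1"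
proof -
  interpret prob_space "\<nu>b b" by (rule prob)
  let ?c = "\<phi> (b, f)"
  have h: "good (snd (b, f)) \<and> (\<forall>s. snd (b, f) s * cnj (snd (b, f) s) = 1)"
    by (rule bspec[OF assms[unfolded unitary_def]]) simp
  have f: "good f" using h by simp
  have fn: "f s * cnj (f s) = 1" for s using h unfolding snd_conv by blast
  have i: "integrable (\<nu>b b) f" using good_integrable[OF f] .
  have c: "(\<integral>s. f s \<partial>\<nu>b b) = ?c" by (simp add: \<phi>_def)
  have "complex_of_real ((norm (f s - ?c))\<^sup>2) = 1 - cnj ?c * f s - ?c * cnj (f s) + ?c * cnj ?c" for s
  proof -
    have "complex_of_real ((norm (f s - ?c))\<^sup>2) = (f s - ?c) * cnj (f s - ?c)" by (rule complex_norm_square)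
    also have "\<dots> = f s * cnj (f s) - cnj ?c * f s - ?c * cnj (f s) + ?c * cnj ?c" by (simp add: algebra_simps)
    finally show ?thesis unfolding fn .
  qed
  then have "complex_of_real (\<integral>s. (norm (f s - ?c))\<^sup>2 \<partial>\<nu>b b) = (\<integral>s. 1 - cnj ?c * f s - ?c * cnj (f s) + ?c * cnj ?c \<partial>\<nu>b b)"
    by (simp flip: integral_complex_of_real)
  also have "\<dots> = 1 - cnj ?c * ?c - ?c * cnj ?c + ?c * cnj ?c"
    using i c integrable_cnj[of "\<nu>b b" f] by (simp add: prob_space)
  also have "\<dots> = complex_of_real (1 - (norm ?c)\<^sup>2)" using complex_norm_square[of ?c] by (simp add: mult.commute)
  finally show v: "(\<integral>s. (norm (f s - ?c))\<^sup>2 \<partial>\<nu>b b) = 1 - (norm ?c)\<^sup>2" using of_real_eq_iff by blast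
  have "0 \<le> (\<integral>s. (norm (f s - ?c))\<^sup>2 \<partial>\<nu>b b)" by simp
  then have "(norm ?c)\<^sup>2 \<le> 1\<^sup>2" unfolding v by simp
  then show "norm ?c \<le> 1" by (rule power2_le_imp_le) simp
qed

lemma telescope_variance:
  assumes X: "unitary X" and E: "char_fam E" and q: "q \<ge> 0"
  shows "norm (M (X @ zpow i E q) - \<phi> (b, E 1) ^ nat q * M (X @ [(\<not> b, \<lambda>s. E 1 s ^ nat q)]))
    \<le> of_int q * sqrt (1 - (norm (\<phi> (b, E 1)))\<^sup>2)"
proof -
  have u: "unitary [(b, E 1)]"
  proof -
    have "unitary (zpow b E 1)" by (rule unitary_zpow[OF E])
    then show ?thesis by (simp add: zpow_def unitary_def)
  qed
  have "(norm (\<phi> (b, E 1)))\<^sup>2 \<le> 1" using variance_unitary(2)[OF u] by (simp add: power_le_one)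
  then show ?thesis
    by (intro telescope_zpow[OF X E q]) (simp_all add: variance_unitary[OF u])
qed

lemma length_zpow: "p \<noteq> 0 \<Longrightarrow> length (zpow i E p) \<ge> 2"
proof -
  assume p: "p \<noteq> 0"
  have l: "length (altpow x y n) = 2 * n" for x y :: "bool \<times> (complex \<times> complex \<Rightarrow> complex)" and n by (induction n) auto
  show ?thesis using p by (auto simp: zpow_def l)
qed

text \<open>Once the letters of index \<open>b\<close> are replaced by their mean, a single letter
  follows the reduced word, and that trace is 0 by \<open>M_reduced_snoc\<close>. Only the error
  remains.\<close>

lemma M_zpow_bound:
  assumes X: "reduced X" "length X \<ge> 2" "unitary X" and E: "char_fam E" and q: "q \<ge> 0"
  shows "norm (M (X @ zpow i E q)) \<le> of_int q * sqrt (1 - (norm (\<phi> (b, E 1)))\<^sup>2)"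
proof -
  have "unitary (zpow (\<not> b) E 1)" by (rule unitary_zpow[OF E])
  then have "unitary [(\<not> b, E 1)]" by (simp add: zpow_def unitary_def)
  from unitary_power[OF this, of "nat q"] have "good (\<lambda>s. E 1 s ^ nat q)" by (simp add: unitary_def)
  from M_reduced_snoc[OF X(1,2) this, of "\<not> b"] show ?thesis
    using telescope_variance[OF X(3) E q, of i b] by simp
qed

lemma norm_mom_uminus: "norm (mom \<nu>12 (- p) (- q)) = norm (mom \<nu>12 p q)"
  by (simp only: mom_cnj[OF bfmult(1)] complex_mod_cnj)

lemma mom_bound_left:
  assumes "\<And>b. mom (\<nu>b b) 1 0 = 0" "p \<noteq> 0"
  shows "norm (mom \<nu>12 p q) \<le> of_int \<bar>q\<bar> * sqrt (1 - (norm (mom (\<nu>b b) 0 1))\<^sup>2)"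
proof -
  have *: "norm (mom \<nu>12 p q) \<le> of_int q * sqrt (1 - (norm (mom (\<nu>b b) 0 1))\<^sup>2)" if "p \<noteq> 0" "q \<ge> 0" for p q
    unfolding bfmult \<phi>_cm[symmetric] VV_def UU_def using that
    by (intro M_zpow_bound[of _ "\<lambda>e. cm 0 e"] reduced_zpow length_zpow unitary_zpow char_fam_cm) (simp_all only: \<phi>_cm assms not_False_eq_True)
  show ?thesis
    using *[of p q] *[of "- p" "- q"] norm_mom_uminus[of p q] assms by (cases "q \<ge> 0") simp_all
qed

text \<open>Cyclicity puts the word of the right face in front, which exchanges the roles of the two
  faces.\<close>

lemma mom_bound_right:
  assumes "\<And>b. mom (\<nu>b b) 0 1 = 0" "q \<noteq> 0"
  shows "norm (mom \<nu>12 p q) \<le> of_int \<bar>p\<bar> * sqrt (1 - (norm (mom (\<nu>b b) 1 0))\<^sup>2)"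
proof -
  have *: "norm (mom \<nu>12 p q) \<le> of_int p * sqrt (1 - (norm (mom (\<nu>b b) 1 0))\<^sup>2)" if "q \<noteq> 0" "p \<ge> 0" for p q
    unfolding bfmult M_rotate[of "UU p"] unfolding \<phi>_cm[symmetric] VV_def UU_def using that
    by (intro M_zpow_bound[of _ "\<lambda>e. cm e 0"] reduced_zpow length_zpow unitary_zpow char_fam_cm) (simp_all only: \<phi>_cm assms not_False_eq_True)
  show ?thesis
    using *[of q p] *[of "- q" "- p"] norm_mom_uminus[of p q] assms by (cases "p \<ge> 0") simp_all
qed

lemma cm_power: "cm p q s ^ n = cm (int n * p) (int n * q) s"
  by (induction n) (simp_all add: cm_0 cm_mult algebra_simps)

text \<open>Mean 1 means variance 0, so replacing the right letters of \<open>\<nu>1\<close> by 1 is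
  exact.\<close>

lemma marginal_right:
  assumes "mom \<nu>1 0 1 = 1"
  shows "mom \<nu>12 0 q = mom \<nu>2 0 q"
proof -
  have *: "mom \<nu>12 0 q = mom \<nu>2 0 q" if "q \<ge> 0" for q
  proof -
    have "unitary []" by (simp add: unitary_def)
    from telescope_variance[OF this char_fam_cm(2) that, of True False]
    show ?thesis using that assms unfolding bfmult UU_def VV_def \<phi>_cm
      by (simp add: zpow_def[of False] M_single cm_power \<phi>_cm)
  qed
  show ?thesis
  proof (cases "q \<ge> 0")
    case False
    have "mom \<nu>12 (- 0) (- (- q)) = mom \<nu>2 (- 0) (- (- q))"
      unfolding mom_cnj[OF bfmult(1)] mom_cnj[OF P2] using *[of "- q"] False by simp
    then show ?thesis by simp
  qed (rule *)
qed

lemma marginal_left: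
  assumes "mom \<nu>1 1 0 = 1"
  shows "mom \<nu>12 p 0 = mom \<nu>2 p 0"
proof -
  have *: "mom \<nu>12 p 0 = mom \<nu>2 p 0" if "p \<ge> 0" for p
  proof -
    have "unitary []" by (simp add: unitary_def)
    from telescope_variance[OF this char_fam_cm(1) that, of False False]
    show ?thesis using that assms unfolding bfmult UU_def VV_def \<phi>_cm
      by (simp add: zpow_def[of True] M_single cm_power \<phi>_cm)
  qed
  show ?thesis
  proof (cases "p \<ge> 0")
    case False
    have "mom \<nu>12 (- (- p)) (- 0) = mom \<nu>2 (- (- p)) (- 0)"
      unfolding mom_cnj[OF bfmult(1)] mom_cnj[OF P2] using *[of "- p"] False by simp
    then show ?thesis by simp
  qed (rule *)
qed

text \<open>Cauchy-Schwarz inside one measure: the word has two letters of the same index, and the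
  first is replaced by its mean.\<close>

lemma covariance_bound:
  "norm (mom \<nu>1 (p + p') (q + q') - mom \<nu>1 p q * mom \<nu>1 p' q') \<le> sqrt (1 - (norm (mom \<nu>1 p q))\<^sup>2)"
proof -
  have u: "unitary [(False, cm a b)]" for a b by (simp add: unitary_def good_cm cm_cnj cm_mult cm_0)
  have n: "unitary []" by (simp add: unitary_def)
  have c: "(norm (\<phi> (False, cm p q)))\<^sup>2 \<le> 1" using variance_unitary(2)[OF u] by (simp add: power_le_one)
  have "norm (M ([] @ (False, cm p q) # [(False, cm p' q')]) - \<phi> (False, cm p q) * M ([] @ [(False, cm p' q')]))
     \<le> sqrt (1 - (norm (\<phi> (False, cm p q)))\<^sup>2)"
    by (rule replace_by_const[OF n u good_cm]) (use c variance_unitary[OF u] in simp_all)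
  then show ?thesis using \<phi>_cm[of False] by (simp add: M_merge0 M_single cm_mult)
qed

end

section \<open>Idempotents and infinite divisibility\<close>

lemmas PT2_bfmult = bf_pair.bfmult(1)[OF bf_pair.intro]
lemmas mom_bfmult = bf_pair.mom_mult[OF bf_pair.intro]

lemma PT2_return: "PT2 (return borel (1, 1))"
proof -
  have "torus2 \<in> sets borel" using borel_closed[OF compact_imp_closed[OF compact_torus2]] .
  then show ?thesis by (simp add: PT2_def prob_space_return torus2_def)
qed

lemma mom_return: "mom (return borel (1, 1)) p q = 1"
  unfolding mom_mono2 by (subst integral_return) (simp_all add: mono2_measurable mono2_def)

lemma bfpow_props:
  assumes "PT2 \<mu>"
  shows "PT2 (bfpow \<mu> n) \<and> mom (bfpow \<mu> n) 1 0 = mom \<mu> 1 0 ^ n \<and> mom (bfpow \<mu> n) 0 1 = mom \<mu> 0 1 ^ n \<and>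
    mom (bfpow \<mu> n) 1 1 = mom \<mu> 1 1 ^ n"
proof (induction n)
  case 0
  show ?case by (simp add: PT2_return mom_return)
next
  case (Suc n)
  then show ?case using assms by (simp add: PT2_bfmult mom_bfmult)
qed

text \<open>The indicator of the kernel of a homomorphism is positive definite: grouping by the
  value of \<open>\<psi>\<close> turns the form into a sum of squared moduli. The choices
  \<open>p\<close>, \<open>q\<close> and \<open>p - q\<close> give the idempotents m x delta_1,
  delta_1 x m and P by their moments.\<close>

lemma ex_subgroup_measure:
  fixes \<psi> :: "int \<Rightarrow> int \<Rightarrow> int"
  assumes \<psi>: "\<And>p q p' q'. \<psi> (p - p') (q - q') = \<psi> p q - \<psi> p' q'"
  shows "\<exists>\<mu>. PT2 \<mu> \<and> (\<forall>p q. mom \<mu> p q = of_bool (\<psi> p q = 0))"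
proof (rule herglotz.herglotz, rule herglotz.intro)
  fix I :: "(int \<times> int) set" and c :: "int \<times> int \<Rightarrow> complex" assume I: "finite I"
  let ?g = "\<lambda>a. \<psi> (fst a) (snd a)"
  define S where "S t = (\<Sum>a\<in>{a \<in> I. ?g a = t}. c a)" for t
  have "(\<Sum>b\<in>I. c a * cnj (c b) * of_bool (\<psi> (fst a - fst b) (snd a - snd b) = 0)) = c a * cnj (S (?g a))" for a
  proof -
    have "(\<Sum>b\<in>I. c a * cnj (c b) * of_bool (\<psi> (fst a - fst b) (snd a - snd b) = 0)) =
        c a * (\<Sum>b\<in>I. if ?g b = ?g a then cnj (c b) else 0)"
      unfolding sum_distrib_left by (intro sum.cong refl) (auto simp: \<psi>)
    also have "(\<Sum>b\<in>I. if ?g b = ?g a then cnj (c b) else 0) = (\<Sum>b\<in>{b \<in> I. ?g b = ?g a}. cnj (c b))"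
      by (rule sum.inter_filter[OF I, symmetric])
    finally show ?thesis by (simp add: S_def)
  qed
  then have "(\<Sum>a\<in>I. \<Sum>b\<in>I. c a * cnj (c b) * of_bool (\<psi> (fst a - fst b) (snd a - snd b) = 0)) =
     (\<Sum>a\<in>I. c a * cnj (S (?g a)))" by simp
  also have "\<dots> = (\<Sum>t\<in>?g ` I. \<Sum>a\<in>{a \<in> I. ?g a = t}. c a * cnj (S (?g a)))"
    by (rule sum.group[symmetric]) (use I in auto)
  also have "\<dots> = (\<Sum>t\<in>?g ` I. S t * cnj (S t))"
    by (intro sum.cong refl) (simp add: S_def sum_distrib_right)
  also have "\<dots> \<in> \<real>\<^sub>\<ge>\<^sub>0"
  proof -
    have "(\<Sum>t\<in>T. S t * cnj (S t)) \<in> \<real>\<^sub>\<ge>\<^sub>0" for T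
      by (induction T rule: infinite_finite_induct) (auto intro!: nonneg_Reals_add_I mult_cnj_nonneg_Reals)
    then show ?thesis .
  qed
  finally show "(\<Sum>a\<in>I. \<Sum>b\<in>I. c a * cnj (c b) * of_bool (\<psi> (fst a - fst b) (snd a - snd b) = 0)) \<in> \<real>\<^sub>\<ge>\<^sub>0" .
next
  have "\<psi> 0 0 = 0" using \<psi>[of 0 0 0 0] by simp
  then show "of_bool (\<psi> 0 0 = 0) = (1 :: complex)" by simp
qed

text \<open>A mean of modulus 1 has variance 0, so \<open>covariance_bound\<close> makes the moments
  invariant under unit shifts of \<open>p\<close> and of \<open>q\<close>.\<close>

lemma trivial_if_mom_1:
  assumes \<mu>: "PT2 \<mu>" "mom \<mu> 1 0 = 1" "mom \<mu> 0 1 = 1"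
  shows "\<mu> = return borel (1, 1)"
proof (rule PT2_eqI[OF \<mu>(1) PT2_return])
  interpret bf_pair \<mu> \<mu> using \<mu> by unfold_locales
  have a: "mom \<mu> (1 + p) q = mom \<mu> p q" for p q
    using covariance_bound[of 1 p 0 q] \<mu>(2) by simp
  have b: "mom \<mu> p (1 + q) = mom \<mu> p q" for p q
    using covariance_bound[of 0 p 1 q] \<mu>(3) by simp
  interpret prob_space \<mu> using \<mu> by (simp add: PT2_def)
  have "mom \<mu> 0 0 = 1" by (simp add: mom_def prob_space)
  moreover have "mom \<mu> p q = mom \<mu> 0 q" for p q
  proof (induction p rule: int_induct[where k = 0])
    case (step1 i)
    then show ?case using a[of i q] by (simp add: add.commute)
  next
    case (step2 i)
    then show ?case using a[of "i - 1" q] by simp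
  qed simp
  moreover have "mom \<mu> 0 q = mom \<mu> 0 0" for q
  proof (induction q rule: int_induct[where k = 0])
    case (step1 i)
    then show ?case using b[of 0 i] by (simp add: add.commute)
  next
    case (step2 i)
    then show ?case using b[of 0 "i - 1"] by simp
  qed simp
  ultimately show "mom \<mu> p q = mom (return borel (1, 1)) p q" for p q unfolding mom_return by metis
qed

lemma no_idempotent_factor:
  assumes nz: "mom \<nu> 1 0 \<noteq> 0" "mom \<nu> 0 1 \<noteq> 0" and \<mu>: "nontrivial_bb_idempotent \<mu>"
  shows "\<not> bb_factor \<mu> \<nu>"
proof
  assume "bb_factor \<mu> \<nu>"
  then obtain \<mu>'' where m: "PT2 \<mu>" "PT2 \<mu>''" "\<nu> = \<mu> \<boxtimes>\<boxtimes> \<mu>''" by (auto simp: bb_factor_def)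
  have "\<mu> = \<mu> \<boxtimes>\<boxtimes> \<mu>" and ne: "\<mu> \<noteq> return borel (1, 1)"
    using \<mu> by (auto simp: nontrivial_bb_idempotent_def bb_idempotent_def)
  then have "mom \<mu> 1 0 = mom \<mu> 1 0 * mom \<mu> 1 0" "mom \<mu> 0 1 = mom \<mu> 0 1 * mom \<mu> 0 1"
    using mom_bfmult[OF m(1) m(1)] by metis+
  moreover have "mom \<mu> 1 0 \<noteq> 0" "mom \<mu> 0 1 \<noteq> 0" using nz mom_bfmult[OF m(1,2)] m(3) by auto
  ultimately have "mom \<mu> 1 0 = 1" "mom \<mu> 0 1 = 1" by (metis mult_cancel_left1)+
  then show False using trivial_if_mom_1[OF m(1)] ne by simp
qed

lemma root_tendsto_1:
  fixes x :: "nat \<Rightarrow> real"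
  assumes "\<And>n. n \<ge> 1 \<Longrightarrow> x n \<ge> 0 \<and> x n ^ n = r" and "r > 0"
  shows "x \<longlonglongrightarrow> 1"
proof -
  have "root n r = x n" if "n \<ge> 1" for n
    using assms(1)[OF that] that by (metis One_nat_def Suc_le_eq real_root_pos_unique)
  then have "\<forall>\<^sub>F n in sequentially. root n r = x n" unfolding eventually_sequentially by blast
  then show ?thesis using LIMSEQ_root_const[OF assms(2)] by (rule Lim_transform_eventually[rotated])
qed

lemma ID_roots:
  assumes "\<nu> \<in> ID_bb"
  obtains \<mu> where "\<And>n. n \<ge> 1 \<Longrightarrow> PT2 (\<mu> n)" "\<And>n. n \<ge> 1 \<Longrightarrow> \<nu> = bfpow (\<mu> n) n"
    "mom \<nu> 1 0 \<noteq> 0 \<Longrightarrow> (\<lambda>n. norm (mom (\<mu> n) 1 0)) \<longlonglongrightarrow> 1"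
    "mom \<nu> 0 1 \<noteq> 0 \<Longrightarrow> (\<lambda>n. norm (mom (\<mu> n) 0 1)) \<longlonglongrightarrow> 1"
proof -
  have "\<forall>n. \<exists>\<mu>. n \<ge> 1 \<longrightarrow> PT2 \<mu> \<and> \<nu> = bfpow \<mu> n" using assms by (auto simp: ID_bb_def)
  then obtain \<mu> where \<mu>: "\<And>n. n \<ge> 1 \<Longrightarrow> PT2 (\<mu> n) \<and> \<nu> = bfpow (\<mu> n) n" by metis
  have "norm (mom (\<mu> n) 1 0) ^ n = norm (mom \<nu> 1 0)" "norm (mom (\<mu> n) 0 1) ^ n = norm (mom \<nu> 0 1)" if "n \<ge> 1" for n
    using \<mu>[OF that] bfpow_props[of "\<mu> n" n] by (simp_all add: norm_power[symmetric])
  then show ?thesis using that[of \<mu>] \<mu> root_tendsto_1[of _ "norm (mom \<nu> 1 0)"] root_tendsto_1[of _ "norm (mom \<nu> 0 1)"] by simp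
qed

text \<open>If m11 of the n-th root vanished, \<open>covariance_bound\<close> would give |m10 m01|
  \<le> sqrt (1 - |m10|^2) for that root; for large n the left side is near 1 and the right side
  near 0. Multiplicativity carries the conclusion to \<nu>.\<close>

lemma ID_mom11_nonzero:
  assumes \<nu>: "\<nu> \<in> ID_bb" and nz: "mom \<nu> 1 0 \<noteq> 0" "mom \<nu> 0 1 \<noteq> 0"
  shows "mom \<nu> 1 1 \<noteq> 0"
proof -
  obtain \<mu> where \<mu>: "\<And>n. n \<ge> 1 \<Longrightarrow> PT2 (\<mu> n)" "\<And>n. n \<ge> 1 \<Longrightarrow> \<nu> = bfpow (\<mu> n) n"
    and lim: "(\<lambda>n. norm (mom (\<mu> n) 1 0)) \<longlonglongrightarrow> 1" "(\<lambda>n. norm (mom (\<mu> n) 0 1)) \<longlonglongrightarrow> 1"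
    using ID_roots[OF \<nu>] nz by metis
  define x where "x n = norm (mom (\<mu> n) 1 0)" for n
  define y where "y n = norm (mom (\<mu> n) 0 1)" for n
  have x: "x \<longlonglongrightarrow> 1" and y: "y \<longlonglongrightarrow> 1" using lim unfolding x_def y_def .
  have "(\<lambda>n. x n * y n - sqrt (1 - (x n)\<^sup>2)) \<longlonglongrightarrow> 1 * 1 - sqrt (1 - 1\<^sup>2)"
    by (intro tendsto_intros x y)
  then have "\<forall>\<^sub>F n in sequentially. 0 < x n * y n - sqrt (1 - (x n)\<^sup>2)"
    by (rule order_tendstoD(1)) simp
  then obtain n where n: "n \<ge> 1" "sqrt (1 - (x n)\<^sup>2) < x n * y n"
    unfolding eventually_sequentially by (metis diff_gt_0_iff_gt nat_le_linear)
  have Pn: "PT2 (\<mu> n)" using \<mu>[OF n(1)] by simp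
  interpret bf_pair "\<mu> n" "\<mu> n" using Pn by unfold_locales
  have "mom (\<mu> n) 1 1 \<noteq> 0"
  proof
    assume "mom (\<mu> n) 1 1 = 0"
    then have "x n * y n \<le> sqrt (1 - (x n)\<^sup>2)"
      using covariance_bound[of 1 0 0 1] by (simp add: x_def y_def norm_mult)
    then show False using n by simp
  qed
  then show ?thesis using \<mu>[OF n(1)] bfpow_props[OF Pn, of n] by auto
qed

lemma ID_split:
  assumes "PT2 \<mu>" "n \<ge> 1"
  shows "bfpow \<mu> n = bfpow \<mu> (n - 1) \<boxtimes>\<boxtimes> \<mu>"
  using assms by (cases n) auto

text \<open>A square root is enough: \<open>mom_centered\<close> then expresses all moments of \<nu>
  by its m11, and with m11 of \<open>P\<close> equal to 1 the same formula describes
  \<open>P\<close> convolved with \<nu>.\<close>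

lemma factor_both_zero:
  assumes \<nu>: "\<nu> \<in> ID_bb" and z: "mom \<nu> 1 0 = 0" "mom \<nu> 0 1 = 0"
  shows "\<exists>\<mu>. nontrivial_bb_idempotent \<mu> \<and> bb_factor \<mu> \<nu>"
proof -
  obtain P where P: "PT2 P" "\<And>p q. mom P p q = of_bool (p - q = 0)"
    using ex_subgroup_measure[of "\<lambda>p q. p - q"] by auto
  obtain \<mu> where \<mu>: "PT2 \<mu>" "\<nu> = bfpow \<mu> 2"
    using ID_roots[OF \<nu>] by (metis one_le_numeral)
  \<comment> \<open>The recursion gives the second power as this measure convolved with \<mu>. It is
    the unit convolved with \<mu> and enters through its multiplicative moments.\<close>
  let ?\<rho> = "bfpow \<mu> 1"
  have \<rho>: "PT2 ?\<rho>" "\<nu> = ?\<rho> \<boxtimes>\<boxtimes> \<mu>" using bfpow_props[OF \<mu>(1), of 1] \<mu> by (simp_all add: numeral_2_eq_2)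
  have PTnu: "PT2 \<nu>" using \<nu> by (simp add: ID_bb_def)
  have mz: "mom \<mu> 1 0 = 0" "mom \<mu> 0 1 = 0" using z bfpow_props[OF \<mu>(1), of 2] \<mu>(2) by auto
  then have rz: "mom ?\<rho> 1 0 = 0" "mom ?\<rho> 0 1 = 0" using bfpow_props[OF \<mu>(1), of 1] by auto
  interpret A: bf_pair ?\<rho> \<mu> using \<mu> \<rho> by unfold_locales
  interpret B: bf_pair P \<nu> using P PTnu by unfold_locales
  interpret C: bf_pair P P using P by unfold_locales
  have nu: "mom \<nu> p q = (if p = q then if p \<ge> 0 then mom \<nu> 1 1 ^ nat p else cnj (mom \<nu> 1 1) ^ nat (- p) else 0)" for p q
    using A.mom_centered[of p q] mz rz A.mom_mult(3) unfolding \<rho>(2)[symmetric] by simp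
  have Pm: "mom P 1 0 = 0" "mom P 0 1 = 0" "mom P 1 1 = 1" by (simp_all add: P)
  have "P \<boxtimes>\<boxtimes> \<nu> = \<nu>"
  proof (rule PT2_eqI[OF B.bfmult(1) PTnu])
    fix p q show "mom (P \<boxtimes>\<boxtimes> \<nu>) p q = mom \<nu> p q"
      using B.mom_centered[of p q] nu[of p q] z Pm by simp
  qed
  moreover have "P \<boxtimes>\<boxtimes> P = P"
  proof (rule PT2_eqI[OF C.bfmult(1) P(1)])
    fix p q show "mom (P \<boxtimes>\<boxtimes> P) p q = mom P p q"
      using C.mom_centered[of p q] Pm by (simp add: P(2)[of p q])
  qed
  moreover have "P \<noteq> return borel (1, 1)" using Pm(1) mom_return by auto
  ultimately show ?thesis
    using P(1) PTnu by (intro exI[of _ P]) (auto simp: nontrivial_bb_idempotent_def bb_idempotent_def bb_factor_def)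
qed

text \<open>For p = 0 the marginal of \<open>e\<close> on the right face is trivial. For p \<noteq>
  0 both factors have m10 = 0, and the error in \<open>mom_bound_left\<close>, measured on
  \<open>e\<close>, is 0.\<close>

lemma absorb_left:
  assumes e: "PT2 e" "mom e 1 0 = 0" "mom e 0 1 = 1" and \<sigma>: "PT2 \<sigma>" "\<And>p q. p \<noteq> 0 \<Longrightarrow> mom \<sigma> p q = 0"
  shows "e \<boxtimes>\<boxtimes> \<sigma> = \<sigma>"
proof -
  interpret bf_pair e \<sigma> using e \<sigma> by unfold_locales
  show ?thesis
  proof (rule PT2_eqI[OF bfmult(1) \<sigma>(1)])
    fix p q show "mom (e \<boxtimes>\<boxtimes> \<sigma>) p q = mom \<sigma> p q"
    proof (cases "p = 0")
      case True
      then show ?thesis using marginal_right[OF e(3)] by simp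
    next
      case False
      then show ?thesis using mom_bound_left[of p q False] e \<sigma> by simp
    qed
  qed
qed

lemma absorb_right:
  assumes e: "PT2 e" "mom e 0 1 = 0" "mom e 1 0 = 1" and \<sigma>: "PT2 \<sigma>" "\<And>p q. q \<noteq> 0 \<Longrightarrow> mom \<sigma> p q = 0"
  shows "e \<boxtimes>\<boxtimes> \<sigma> = \<sigma>"
proof -
  interpret bf_pair e \<sigma> using e \<sigma> by unfold_locales
  show ?thesis
  proof (rule PT2_eqI[OF bfmult(1) \<sigma>(1)])
    fix p q show "mom (e \<boxtimes>\<boxtimes> \<sigma>) p q = mom \<sigma> p q"
    proof (cases "q = 0")
      case True
      then show ?thesis using marginal_left[OF e(3)] by simp
    next
      case False
      then show ?thesis using mom_bound_right[of q p False] e \<sigma> by simp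
    qed
  qed
qed

lemma vanishing_limit:
  fixes a :: complex and x :: "nat \<Rightarrow> real"
  assumes "x \<longlonglongrightarrow> 1" "\<And>n. n \<ge> 2 \<Longrightarrow> norm a \<le> c * sqrt (1 - (x n)\<^sup>2)"
  shows "a = 0"
proof -
  have "(\<lambda>n. c * sqrt (1 - (x n)\<^sup>2)) \<longlonglongrightarrow> c * sqrt (1 - 1\<^sup>2)" by (intro tendsto_intros assms(1))
  then have "norm a \<le> c * sqrt (1 - 1\<^sup>2)"
    by (rule LIMSEQ_le_const) (use assms(2) in blast)
  then show ?thesis by simp
qed

text \<open>For p \<noteq> 0 each splitting of \<nu> into an (n-1)-st power and an n-th root bounds
  the moment by |q| sqrt (1 - |m01|^2), with m01 taken of the root. The bound tends to 0, so \<nu>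
  satisfies the condition of \<open>absorb_left\<close>.\<close>

lemma factor_left_zero:
  assumes \<nu>: "\<nu> \<in> ID_bb" and z: "mom \<nu> 1 0 = 0" "mom \<nu> 0 1 \<noteq> 0"
  shows "\<exists>\<mu>. nontrivial_bb_idempotent \<mu> \<and> bb_factor \<mu> \<nu>"
proof -
  obtain e where e: "PT2 e" "\<And>p q. mom e p q = of_bool (p = 0)"
    using ex_subgroup_measure[of "\<lambda>p q. p"] by auto
  have PTnu: "PT2 \<nu>" using \<nu> by (simp add: ID_bb_def)
  obtain \<mu> where \<mu>: "\<And>n. n \<ge> 1 \<Longrightarrow> PT2 (\<mu> n)" "\<And>n. n \<ge> 1 \<Longrightarrow> \<nu> = bfpow (\<mu> n) n"
    and lim: "(\<lambda>n. norm (mom (\<mu> n) 0 1)) \<longlonglongrightarrow> 1"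
    using ID_roots[OF \<nu>] z by metis
  have "mom \<nu> p q = 0" if p: "p \<noteq> 0" for p q
  proof (rule vanishing_limit[OF lim])
    \<comment> \<open>Then n - 1 is positive, so the power in front also has m10 = 0.\<close>
    fix n :: nat assume n: "n \<ge> 2"
    have Pn: "PT2 (\<mu> n)" "\<nu> = bfpow (\<mu> n) n" using \<mu>[of n] n by auto
    interpret bf_pair "bfpow (\<mu> n) (n - 1)" "\<mu> n" using Pn bfpow_props[OF Pn(1)] by unfold_locales auto
    have "\<nu> = bfpow (\<mu> n) (n - 1) \<boxtimes>\<boxtimes> \<mu> n" unfolding Pn(2) by (rule ID_split[OF Pn(1)]) (use n in simp)
    moreover have mz: "mom (\<mu> n) 1 0 = 0" using z bfpow_props[OF Pn(1), of n] Pn(2) by auto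
    moreover have "mom (bfpow (\<mu> n) (n - 1)) 1 0 = 0" using bfpow_props[OF Pn(1), of "n - 1"] mz n by simp
    ultimately show "norm (mom \<nu> p q) \<le> of_int \<bar>q\<bar> * sqrt (1 - (norm (mom (\<mu> n) 0 1))\<^sup>2)"
      using mom_bound_left[of p q True] p by simp
  qed
  then have "e \<boxtimes>\<boxtimes> \<nu> = \<nu>" using e PTnu by (intro absorb_left) simp_all
  moreover have "e \<boxtimes>\<boxtimes> e = e" using e by (intro absorb_left) simp_all
  moreover have "e \<noteq> return borel (1, 1)" using e(2)[of 1 0] mom_return by auto
  ultimately show ?thesis
    using e(1) PTnu by (intro exI[of _ e]) (auto simp: nontrivial_bb_idempotent_def bb_idempotent_def bb_factor_def)
qed

lemma factor_right_zero:
  assumes \<nu>: "\<nu> \<in> ID_bb" and z: "mom \<nu> 0 1 = 0" "mom \<nu> 1 0 \<noteq> 0"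
  shows "\<exists>\<mu>. nontrivial_bb_idempotent \<mu> \<and> bb_factor \<mu> \<nu>"
proof -
  obtain e where e: "PT2 e" "\<And>p q. mom e p q = of_bool (q = 0)"
    using ex_subgroup_measure[of "\<lambda>p q. q"] by auto
  have PTnu: "PT2 \<nu>" using \<nu> by (simp add: ID_bb_def)
  obtain \<mu> where \<mu>: "\<And>n. n \<ge> 1 \<Longrightarrow> PT2 (\<mu> n)" "\<And>n. n \<ge> 1 \<Longrightarrow> \<nu> = bfpow (\<mu> n) n"
    and lim: "(\<lambda>n. norm (mom (\<mu> n) 1 0)) \<longlonglongrightarrow> 1"
    using ID_roots[OF \<nu>] z by metis
  have "mom \<nu> p q = 0" if q: "q \<noteq> 0" for p q
  proof (rule vanishing_limit[OF lim])
    fix n :: nat assume n: "n \<ge> 2"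
    have Pn: "PT2 (\<mu> n)" "\<nu> = bfpow (\<mu> n) n" using \<mu>[of n] n by auto
    interpret bf_pair "bfpow (\<mu> n) (n - 1)" "\<mu> n" using Pn bfpow_props[OF Pn(1)] by unfold_locales auto
    have "\<nu> = bfpow (\<mu> n) (n - 1) \<boxtimes>\<boxtimes> \<mu> n" unfolding Pn(2) by (rule ID_split[OF Pn(1)]) (use n in simp)
    moreover have mz: "mom (\<mu> n) 0 1 = 0" using z bfpow_props[OF Pn(1), of n] Pn(2) by auto
    moreover have "mom (bfpow (\<mu> n) (n - 1)) 0 1 = 0" using bfpow_props[OF Pn(1), of "n - 1"] mz n by simp
    ultimately show "norm (mom \<nu> p q) \<le> of_int \<bar>p\<bar> * sqrt (1 - (norm (mom (\<mu> n) 1 0))\<^sup>2)"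
      using mom_bound_right[of q p True] q by simp
  qed
  then have "e \<boxtimes>\<boxtimes> \<nu> = \<nu>" using e PTnu by (intro absorb_right) simp_all
  moreover have "e \<boxtimes>\<boxtimes> e = e" using e by (intro absorb_right) simp_all
  moreover have "e \<noteq> return borel (1, 1)" using e(2)[of 0 1] mom_return by auto
  ultimately show ?thesis
    using e(1) PTnu by (intro exI[of _ e]) (auto simp: nontrivial_bb_idempotent_def bb_idempotent_def bb_factor_def)
qed

theorem theorem3p11:
  assumes "\<nu> \<in> ID_bb"
  shows "((\<not> (\<exists>\<mu>. nontrivial_bb_idempotent \<mu> \<and> bb_factor \<mu> \<nu>))
            \<longleftrightarrow> (mom \<nu> 1 0 \<noteq> 0 \<and> mom \<nu> 0 1 \<noteq> 0))
         \<and> (mom \<nu> 1 0 \<noteq> 0 \<and> mom \<nu> 0 1 \<noteq> 0 \<longrightarrow> mom \<nu> 1 1 \<noteq> 0)"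
  using no_idempotent_factor[of \<nu>] factor_both_zero[OF assms] factor_left_zero[OF assms]
    factor_right_zero[OF assms] ID_mom11_nonzero[OF assms] by blast

end
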